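(* For every partition $\lambda$, the element of $P$ defined by $$S_\lambda=\det(H_{\lambda_i+j-i})=\det(E_{\lambda'_i+j-i})$$ (in particular the two determinants are equal) is such that for every positive integer $n$ and every $w\in S_n$, $$S_\lambda(w)=\mathrm{trace}(w;W_\lambda(K^n)).$$
   Context: Let $K$ be a field of characteristic $0$ and $P=K[X_1,X_2,\dots]$. For $w\in S_n$ let $X_i(w)$ be the number of $i$-cycles of $w$, and for $q\in P$ write $q(w)=q(X_1(w),X_2(w),\dots)$. Define $H_d,E_d\in P$ ($d\ge0$) by $\sum_{d\ge0}H_dt^d=\prod_{i\ge1}(1-t^i)^{-X_i}$ and $\sum_{d\ge0}E_dt^d=\prod_{i\ge1}(1-(-t)^i)^{X_i}$ in $P[[t]]$ (powers expanded by the binomial series), and $H_d=E_d=0$ for $d<0$. For a partition $\lambda=(\lambda_1,\dots,\lambda_l)$, $\lambda'$ denotes the conjugate partition; the first determinant is of the $l\times l$ matrix with $(i,j)$ entry $H_{\lambda_i+j-i}$, and the second of the $\lambda_1\times\lambda_1$ matrix with $(i,j)$ entry $E_{\lambda'_i+j-i}$. $W_\lambda$ is the Weyl functor associated to $\lambda$: $W_\lambda(K^n)$ is the irreducible polynomial representation of $GL_n(K)$ of highest weight $\lambda$ if $\lambda$ has at most $n$ parts, and is $0$ otherwise (so $W_{(d)}(K^n)=\mathrm{Sym}^d(K^n)$, $W_{(1^d)}(K^n)=\wedge^d(K^n)$). $S_n$ acts on it as the subgroup of permutation matrices in $GL_n(K)$. *)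

theory Defs
  imports
    "HOL-Library.Poly_Mapping"
    "HOL-Computational_Algebra.Formal_Power_Series"
    "HOL-Analysis.Infinite_Products"
    "HOL-Combinatorics.Orbits"
    "Jordan_Normal_Form.Determinant"
    "Jordan_Normal_Form.VS_Connect"
begin

section \<open>Multivariate polynomials\<close>

text \<open>Exponent vectors are finitely supported maps from variables to naturals; a polynomial is a
  finitely supported map from exponent vectors to coefficients, with the convolution product.\<close>

type_synonym ('v, 'a) mpoly = "('v \<Rightarrow>\<^sub>0 nat) \<Rightarrow>\<^sub>0 'a"

definition mp_const :: "'a \<Rightarrow> ('v, 'a :: zero) mpoly" where
  "mp_const c = Poly_Mapping.single 0 c"

definition mp_eval :: "('v \<Rightarrow> 'a) \<Rightarrow> ('v, 'a) mpoly \<Rightarrow> 'a :: comm_semiring_1" where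
  "mp_eval x p = (\<Sum>\<alpha> \<in> Poly_Mapping.keys p.
     Poly_Mapping.lookup p \<alpha> * (\<Prod>v \<in> Poly_Mapping.keys \<alpha>. x v ^ Poly_Mapping.lookup \<alpha> v))"

section \<open>The ring \<open>P = K[X\<^sub>1, X\<^sub>2, \<dots>]\<close>\<close>

text \<open>The variable \<open>X\<^sub>i\<close> (\<open>i \<ge> 1\<close>) is the variable with index \<open>i - 1 :: nat\<close>, so that
  the type contains no superfluous \<open>X\<^sub>0\<close>.\<close>

type_synonym 'a cycle_poly = "(nat, 'a) mpoly"

definition Xvar :: "nat \<Rightarrow> 'a :: comm_semiring_1 cycle_poly" where
  "Xvar i = Poly_Mapping.single (Poly_Mapping.single (i - 1) 1) 1"

text \<open>\<open>S\<^sub>n\<close> consists of the permutations of \<open>{..<n}\<close>.\<close>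

definition num_cycles :: "nat \<Rightarrow> (nat \<Rightarrow> nat) \<Rightarrow> nat \<Rightarrow> nat" where
  "num_cycles n w i = card {C. \<exists>x<n. C = orbit w x \<and> card C = i}"

definition eval_perm :: "'a cycle_poly \<Rightarrow> nat \<Rightarrow> (nat \<Rightarrow> nat) \<Rightarrow> 'a :: comm_semiring_1" where
  "eval_perm q n w = mp_eval (\<lambda>k. of_nat (num_cycles n w (Suc k))) q"

section \<open>The generating series\<close>

text \<open>The library's generalised binomial coefficient and binomial series require the exponent to
  lie in a field, which \<open>P\<close> is not; here division is only by \<open>k!\<close>, which is a unit of \<open>K\<close>.\<close>

definition mp_gbinomial :: "'a :: field_char_0 cycle_poly \<Rightarrow> nat \<Rightarrow> 'a cycle_poly" where
  "mp_gbinomial q k = mp_const (1 / fact k) * (\<Prod>j<k. q - of_nat j)"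

text \<open>The power \<open>(1 + u)\<^sup>q\<close> in \<open>P[[t]]\<close>, for \<open>u\<close> without constant term and \<open>q\<close> in \<open>P\<close>.\<close>

definition binomial_series ::
  "'a :: field_char_0 cycle_poly fps \<Rightarrow> 'a cycle_poly \<Rightarrow> 'a cycle_poly fps" where
  "binomial_series u q = fps_compose (Abs_fps (mp_gbinomial q)) u"

text \<open>The infinite products converge in the \<open>t\<close>-adic topology, which is the library's topology
  on formal power series. The index \<open>k\<close> corresponds to \<open>i = k + 1\<close>.\<close>

definition H_series :: "'a :: field_char_0 cycle_poly fps" where
  "H_series = prodinf (\<lambda>k. binomial_series (- (fps_X ^ Suc k)) (- Xvar (Suc k)))"

definition E_series :: "'a :: field_char_0 cycle_poly fps" where
  "E_series = prodinf (\<lambda>k. binomial_series (- ((- fps_X) ^ Suc k)) (Xvar (Suc k)))"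

definition H_poly :: "int \<Rightarrow> 'a :: field_char_0 cycle_poly" where
  "H_poly d = (if d < 0 then 0 else fps_nth H_series (nat d))"

definition E_poly :: "int \<Rightarrow> 'a :: field_char_0 cycle_poly" where
  "E_poly d = (if d < 0 then 0 else fps_nth E_series (nat d))"

section \<open>Partitions and the two determinants\<close>

definition is_partition :: "nat list \<Rightarrow> bool" where
  "is_partition lam \<longleftrightarrow> sorted_wrt (\<ge>) lam \<and> 0 \<notin> set lam"

definition conjugate :: "nat list \<Rightarrow> nat list" where
  "conjugate lam = map (\<lambda>j. card {i. i < length lam \<and> j < lam ! i}) [0..<(if lam = [] then 0 else hd lam)]"

definition det_H :: "nat list \<Rightarrow> 'a :: field_char_0 cycle_poly" where
  "det_H lam = det (mat (length lam) (length lam) (\<lambda>(i, j). H_poly (int (lam ! i) + int j - int i)))"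

definition det_E :: "nat list \<Rightarrow> 'a :: field_char_0 cycle_poly" where
  "det_E lam = (let lam' = conjugate lam in
     det (mat (length lam') (length lam') (\<lambda>(i, j). E_poly (int (lam' ! i) + int j - int i))))"

definition S_poly :: "nat list \<Rightarrow> 'a :: field_char_0 cycle_poly" where
  "S_poly lam = det_H lam"

section \<open>Polynomial representations of \<open>GL\<^sub>n(K)\<close>\<close>

definition GL :: "nat \<Rightarrow> 'a :: field mat set" where
  "GL n = {g \<in> carrier_mat n n. invertible_mat g}"

text \<open>A representation of \<open>GL\<^sub>n(K)\<close> on \<open>K\<^sup>m\<close>; only the values of \<open>\<rho>\<close> on \<open>GL\<^sub>n(K)\<close>
  are relevant.\<close>

definition representation :: "nat \<Rightarrow> nat \<Rightarrow> ('a :: field mat \<Rightarrow> 'a mat) \<Rightarrow> bool" where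
  "representation n m \<rho> \<longleftrightarrow>
     (\<forall>g\<in>GL n. \<rho> g \<in> carrier_mat m m) \<and> \<rho> (1\<^sub>m n) = 1\<^sub>m m \<and>
     (\<forall>g\<in>GL n. \<forall>h\<in>GL n. \<rho> (g * h) = \<rho> g * \<rho> h)"

text \<open>The matrix entries of \<open>\<rho> g\<close> are polynomials in the entries of \<open>g\<close>; variables
  \<open>(i, j)\<close> outside the index range are evaluated to \<open>0\<close>.\<close>

definition polynomial_representation :: "nat \<Rightarrow> nat \<Rightarrow> ('a :: field mat \<Rightarrow> 'a mat) \<Rightarrow> bool" where
  "polynomial_representation n m \<rho> \<longleftrightarrow> representation n m \<rho> \<and>
     (\<forall>a<m. \<forall>b<m. \<exists>p :: (nat \<times> nat, 'a) mpoly. \<forall>g\<in>GL n.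
        \<rho> g $$ (a, b) = mp_eval (\<lambda>(i, j). if i < n \<and> j < n then g $$ (i, j) else 0) p)"

definition irreducible_representation :: "nat \<Rightarrow> nat \<Rightarrow> ('a :: field mat \<Rightarrow> 'a mat) \<Rightarrow> bool" where
  "irreducible_representation n m \<rho> \<longleftrightarrow> representation n m \<rho> \<and> m \<noteq> 0 \<and>
     (\<forall>U. VectorSpace.subspace class_ring U (module_vec TYPE('a) m) \<and>
          (\<forall>g\<in>GL n. \<forall>u\<in>U. \<rho> g *\<^sub>v u \<in> U) \<longrightarrow>
        U = {0\<^sub>v m} \<or> U = carrier_vec m)"

text \<open>A highest weight vector of weight \<open>lam\<close> is a nonzero eigenvector of the upper triangular
  group, with the character given by the diagonal torus weight \<open>lam\<close>. Missing parts count as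
  \<open>0\<close>, and \<open>lam\<close> is assumed to have at most \<open>n\<close> parts.\<close>

definition has_highest_weight ::
  "nat \<Rightarrow> nat \<Rightarrow> ('a :: field mat \<Rightarrow> 'a mat) \<Rightarrow> nat list \<Rightarrow> bool" where
  "has_highest_weight n m \<rho> lam \<longleftrightarrow> (\<exists>v\<in>carrier_vec m. v \<noteq> 0\<^sub>v m \<and>
     (\<forall>b\<in>GL n. upper_triangular b \<longrightarrow>
        \<rho> b *\<^sub>v v = (\<Prod>i<length lam. b $$ (i, i) ^ (lam ! i)) \<cdot>\<^sub>v v))"

text \<open>\<open>W\<^sub>\<lambda>(K\<^sup>n)\<close> is determined up to isomorphism, so it is described by the predicate that
  \<open>\<rho>\<close> is a realisation of it on \<open>K\<^sup>m\<close>, that is, after a choice of basis.\<close>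

definition is_Weyl_module ::
  "nat list \<Rightarrow> nat \<Rightarrow> nat \<Rightarrow> ('a :: field mat \<Rightarrow> 'a mat) \<Rightarrow> bool" where
  "is_Weyl_module lam n m \<rho> \<longleftrightarrow> polynomial_representation n m \<rho> \<and>
     (if length lam \<le> n then irreducible_representation n m \<rho> \<and> has_highest_weight n m \<rho> lam
      else m = 0)"

text \<open>The matrix of \<open>e\<^sub>j \<mapsto> e\<^sub>w\<^sub>(\<^sub>j\<^sub>)\<close>.\<close>

definition perm_matrix :: "nat \<Rightarrow> (nat \<Rightarrow> nat) \<Rightarrow> 'a :: {zero, one} mat" where
  "perm_matrix n w = mat n n (\<lambda>(i, j). if i = w j then 1 else 0)"

definition mat_trace :: "'a :: comm_monoid_add mat \<Rightarrow> 'a" where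
  "mat_trace A = (\<Sum>i<dim_row A. A $$ (i, i))"

end

theory Submission
  imports
    Defs
    "HOL-Algebra.Algebraic_Closure_Type"
    "Jordan_Normal_Form.Ring_Hom_Matrix"
    "Jordan_Normal_Form.Char_Poly"
begin

text \<open>The two determinants agree by Jacobi's theorem on complementary minors, applied to the mutually inverse Toeplitz
matrices of the coefficients of the two series.

For the trace, extend the polynomial representation to matrices over any commutative \<open>K\<close>-algebra. The trace is
conjugation invariant, so over the algebraic closure the permutation matrix of \<open>w\<close> may be replaced by the diagonal
matrix of its eigenvalues \<open>y\<^sub>i\<close>. The character of an irreducible representation on the diagonal torus is found
without integration or complete reducibility: the Casimir operator is a scalar by irreducibility, and its radial part
is, after multiplication by the Vandermonde determinant, the Laplacian of the torus. The product of the character and the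
Vandermonde determinant is thus an alternating polynomial all of whose exponents have the same norm as the shifted
highest weight. Only the permutations of that weight remain, which gives Weyl's formula as a quotient of alternants, and
the Jacobi--Trudi identity turns it into a determinant of complete symmetric polynomials \<open>h\<^sub>d(y)\<close>. Finally
\<open>h\<^sub>d(y) = H\<^sub>d(w)\<close>, because \<open>\<Prod>(1 - y\<^sub>i t)\<close> is the product of \<open>1 - t\<^sup>c\<close> over the cycle lengths \<open>c\<close> of \<open>w\<close>: both
have the logarithmic derivative given by the numbers of fixed points of the powers of \<open>w\<close>.\<close>

hide_const (open) up_ring.monom up_ring.coeff Polynomials.degree module.smult

no_notation fps_nth (infixl "$" 75)
no_notation Finite_Cartesian_Product.vec_nth (infixl "$" 90)

section \<open>Evaluation of polynomials\<close>

text \<open>The representation is given only on \<open>GL n\<close>, over a field that need not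
  contain the eigenvalues of a permutation and carries no topology. Analysis is therefore replaced
  by polynomial identities: fixed polynomials for the matrix entries are evaluated in other rings,
  an identity known at invertible matrices is multiplied by determinants so as to hold everywhere,
  and characteristic zero makes it an identity of polynomials. Derivatives are coefficients of
  degree one in a parameter s, and limits along the torus are substitutions s = 0. The norm alone
  does not single out the permutations of the shifted highest weight. The second ingredient is a
  bound: paired with any decreasing vector, no weight exceeds the highest one. With the equality
  case of Cauchy-Schwarz this identifies every sorted exponent. The bound and the multiplicity one
  of the highest weight both come from the orbit of the highest weight vector under lower
  unitriangular matrices. Eigenvalues of a permutation may repeat, and then the Vandermonde
  determinant vanishes; it is cancelled after a parameter has made the points distinct.\<close>

definition mp_mon :: "('v \<Rightarrow> 'r) \<Rightarrow> ('v \<Rightarrow>\<^sub>0 nat) \<Rightarrow> 'r :: comm_monoid_mult" where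
  "mp_mon x \<alpha> = (\<Prod>v \<in> Poly_Mapping.keys \<alpha>. x v ^ Poly_Mapping.lookup \<alpha> v)"

text \<open>Coefficients pass through \<open>\<phi>\<close>, so that a polynomial over the base
  field can be evaluated in a polynomial ring or in the algebraic closure.\<close>

definition mp_ev :: "('a \<Rightarrow> 'r) \<Rightarrow> ('v \<Rightarrow> 'r) \<Rightarrow> ('v, 'a :: zero) mpoly \<Rightarrow> 'r :: comm_semiring_1" where
  "mp_ev \<phi> x p = (\<Sum>\<alpha> \<in> Poly_Mapping.keys p. \<phi> (Poly_Mapping.lookup p \<alpha>) * mp_mon x \<alpha>)"

lemma mp_eval_eq_mp_ev: "mp_eval x p = mp_ev (\<lambda>c. c) x p"
  by (simp add: mp_eval_def mp_ev_def mp_mon_def)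

lemma mp_mon_superset:
  assumes "finite V" "Poly_Mapping.keys \<alpha> \<subseteq> V"
  shows "mp_mon x \<alpha> = (\<Prod>v \<in> V. x v ^ Poly_Mapping.lookup \<alpha> v)"
  unfolding mp_mon_def using assms
  by (intro prod.mono_neutral_left) (auto simp: in_keys_iff)

lemma mp_mon_add: "mp_mon x (\<alpha> + \<beta>) = mp_mon x \<alpha> * mp_mon x \<beta>"
proof -
  let ?V = "Poly_Mapping.keys \<alpha> \<union> Poly_Mapping.keys \<beta>"
  have "mp_mon x (\<alpha> + \<beta>) = (\<Prod>v \<in> ?V. x v ^ Poly_Mapping.lookup (\<alpha> + \<beta>) v)"
    by (rule mp_mon_superset) (auto simp: Poly_Mapping.keys_add)
  also have "\<dots> = mp_mon x \<alpha> * mp_mon x \<beta>"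
    by (simp add: mp_mon_superset[of ?V] lookup_add power_add prod.distrib)
  finally show ?thesis .
qed

lemma mp_mon_0 [simp]: "mp_mon x 0 = 1"
  by (simp add: mp_mon_def)

lemma mp_mon_single [simp]: "mp_mon x (Poly_Mapping.single v k) = x v ^ k"
  by (simp add: mp_mon_def)

lemma mp_ev_superset:
  assumes "finite S" "Poly_Mapping.keys p \<subseteq> S" "\<phi> 0 = 0"
  shows "mp_ev \<phi> x p = (\<Sum>\<alpha> \<in> S. \<phi> (Poly_Mapping.lookup p \<alpha>) * mp_mon x \<alpha>)"
  unfolding mp_ev_def using assms
  by (intro sum.mono_neutral_left) (auto simp: in_keys_iff)

lemma mp_ev_single:
  assumes "\<phi> 0 = 0"
  shows "mp_ev \<phi> x (Poly_Mapping.single \<alpha> c) = \<phi> c * mp_mon x \<alpha>"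
  using assms by (simp add: mp_ev_superset[of "{\<alpha>}"])

lemma poly_mapping_eq_sum_single:
  "p = (\<Sum>\<alpha> \<in> Poly_Mapping.keys p. Poly_Mapping.single \<alpha> (Poly_Mapping.lookup p \<alpha>))"
proof (rule poly_mapping_eqI)
  fix \<beta>
  have "Poly_Mapping.lookup (\<Sum>\<alpha> \<in> Poly_Mapping.keys p. Poly_Mapping.single \<alpha> (Poly_Mapping.lookup p \<alpha>)) \<beta>
      = (\<Sum>\<alpha> \<in> Poly_Mapping.keys p. Poly_Mapping.lookup p \<alpha> when \<alpha> = \<beta>)"
    by (simp add: lookup_sum lookup_single)
  also have "\<dots> = (\<Sum>\<alpha> \<in> Poly_Mapping.keys p. if \<beta> = \<alpha> then Poly_Mapping.lookup p \<alpha> else 0)"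
    by (intro sum.cong) (auto simp: when_def)
  also have "\<dots> = Poly_Mapping.lookup p \<beta>"
    by (simp add: sum.delta in_keys_iff)
  finally show "Poly_Mapping.lookup p \<beta> = Poly_Mapping.lookup (\<Sum>\<alpha> \<in> Poly_Mapping.keys p.
      Poly_Mapping.single \<alpha> (Poly_Mapping.lookup p \<alpha>)) \<beta>" ..
qed

lemma mp_ev_comm_ring_hom:
  fixes \<phi> :: "'a :: comm_ring_1 \<Rightarrow> 'r :: comm_ring_1"
  assumes "comm_ring_hom \<phi>"
  shows "comm_ring_hom (mp_ev \<phi> x :: ('v, 'a) mpoly \<Rightarrow> 'r)"
proof -
  interpret \<phi>: comm_ring_hom \<phi> by fact
  have add: "mp_ev \<phi> x (p + q) = mp_ev \<phi> x p + mp_ev \<phi> x q" for p q :: "('v, 'a) mpoly"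
  proof -
    let ?S = "Poly_Mapping.keys p \<union> Poly_Mapping.keys q"
    have "mp_ev \<phi> x (p + q) = (\<Sum>\<alpha>\<in>?S. \<phi> (Poly_Mapping.lookup (p + q) \<alpha>) * mp_mon x \<alpha>)"
      by (rule mp_ev_superset) (auto simp: Poly_Mapping.keys_add)
    then show ?thesis
      by (simp add: mp_ev_superset[of ?S] lookup_add \<phi>.hom_add algebra_simps sum.distrib)
  qed
  have zero: "mp_ev \<phi> x 0 = 0" by (simp add: mp_ev_def)
  have sum: "mp_ev \<phi> x (sum f A) = (\<Sum>a\<in>A. mp_ev \<phi> x (f a))"
    if "finite A" for f and A :: "('v \<Rightarrow>\<^sub>0 nat) set"
    using that by induction (simp_all add: zero add)
  have mult: "mp_ev \<phi> x (p * q) = mp_ev \<phi> x p * mp_ev \<phi> x q" for p q :: "('v, 'a) mpoly"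
  proof -
    have "mp_ev \<phi> x (p * q) = mp_ev \<phi> x (\<Sum>\<alpha>\<in>Poly_Mapping.keys p. \<Sum>\<beta>\<in>Poly_Mapping.keys q.
        Poly_Mapping.single (\<alpha> + \<beta>) (Poly_Mapping.lookup p \<alpha> * Poly_Mapping.lookup q \<beta>))"
      by (subst (1) poly_mapping_eq_sum_single[of p], subst (1) poly_mapping_eq_sum_single[of q])
        (simp add: sum_product mult_single)
    also have "\<dots> = (\<Sum>\<alpha>\<in>Poly_Mapping.keys p. \<Sum>\<beta>\<in>Poly_Mapping.keys q.
        \<phi> (Poly_Mapping.lookup p \<alpha>) * \<phi> (Poly_Mapping.lookup q \<beta>) * (mp_mon x \<alpha> * mp_mon x \<beta>))"
      by (simp add: sum mp_ev_single mp_mon_add \<phi>.hom_mult)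
    also have "\<dots> = mp_ev \<phi> x p * mp_ev \<phi> x q"
      by (simp add: mp_ev_def sum_product mult_ac)
    finally show ?thesis .
  qed
  have one: "mp_ev \<phi> x 1 = 1"
    using mp_ev_single[of \<phi> x 0 1] by simp
  show ?thesis by unfold_locales (simp_all add: zero one add mult)
qed

text \<open>All later specialisations are instances: setting a parameter to a value, extending
  scalars, and inserting matrices for generic ones.\<close>

lemma mp_ev_natural:
  assumes "comm_ring_hom \<psi>"
  shows "\<psi> (mp_ev \<phi> x p) = mp_ev (\<lambda>c. \<psi> (\<phi> c)) (\<lambda>v. \<psi> (x v)) p"
proof -
  interpret \<psi>: comm_ring_hom \<psi> by fact
  show ?thesis by (simp add: mp_ev_def mp_mon_def \<psi>.hom_sum \<psi>.hom_mult \<psi>.hom_prod \<psi>.hom_power)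
qed

lemma mp_ev_const:
  assumes "\<phi> 0 = 0"
  shows "mp_ev \<phi> x (mp_const c) = \<phi> c"
  using assms by (simp add: mp_const_def mp_ev_single)

section \<open>Kronecker substitution and identities of polynomials\<close>

lemma radix_inj:
  fixes a b :: "nat \<Rightarrow> nat"
  assumes "(\<Sum>i<n. a i * N ^ i) = (\<Sum>i<n. b i * N ^ i)" "\<And>i. i < n \<Longrightarrow> a i < N" "\<And>i. i < n \<Longrightarrow> b i < N" "i < n"
  shows "a i = b i"
  using assms
proof (induction n arbitrary: a b i)
  case (Suc n)
  have e: "(\<Sum>i<Suc n. f i * N ^ i) = f 0 + N * (\<Sum>i<n. f (Suc i) * N ^ i)" for f
    by (subst sum.lessThan_Suc_shift) (simp add: sum_distrib_left mult_ac)
  have eq: "a 0 + N * (\<Sum>i<n. a (Suc i) * N ^ i) = b 0 + N * (\<Sum>i<n. b (Suc i) * N ^ i)"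
    using Suc.prems(1) unfolding e .
  have "a 0 < N" "b 0 < N" using Suc.prems by auto
  then have 0: "a 0 = b 0"
    using arg_cong[OF eq, of "\<lambda>z. z mod N"] by simp
  then have "(\<Sum>i<n. a (Suc i) * N ^ i) = (\<Sum>i<n. b (Suc i) * N ^ i)"
    using eq \<open>a 0 < N\<close> by simp
  then have "a (Suc i) = b (Suc i)" if "i < n" for i
    using Suc.IH[of "\<lambda>i. a (Suc i)" "\<lambda>i. b (Suc i)" i] Suc.prems that by auto
  with 0 Suc.prems(4) show ?case by (cases i) auto
qed simp

text \<open>In characteristic zero the naturals are infinitely many points. The bound
  \<open>K\<close> allows the first few to be skipped, typically the parameter 0 at which a torus
  element is singular.\<close>

lemma poly_eq_0_if_nat_roots:
  fixes p :: "'a :: field_char_0 poly"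
  assumes "\<And>k. k \<ge> K \<Longrightarrow> poly p (of_nat k) = 0"
  shows "p = 0"
proof (rule ccontr)
  assume "p \<noteq> 0"
  then have "finite {x. poly p x = 0}" by (rule poly_roots_finite)
  moreover have "of_nat ` {K..} \<subseteq> {x. poly p x = 0}" using assms by auto
  ultimately have "finite ((of_nat :: nat \<Rightarrow> 'a) ` {K..})" by (rule finite_subset[rotated])
  then have "finite {K..}" by (subst (asm) finite_image_iff) (auto simp: inj_on_def)
  then show False by (simp add: infinite_Ici)
qed

text \<open>Kronecker substitution: the points \<open>x\<^sub>i = k\<^bsup>N^i\<^esup>\<close> separate the monomials, and they have
  pairwise distinct nonzero coordinates.\<close>

lemma monomials_independent:
  fixes c :: "(nat \<Rightarrow> nat) \<Rightarrow> 'a :: field_char_0"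
  assumes W: "finite W" "\<And>\<nu> i. \<nu> \<in> W \<Longrightarrow> i \<ge> n \<Longrightarrow> \<nu> i = 0"
    and z: "\<And>x. (\<And>i. i < n \<Longrightarrow> x i \<noteq> 0) \<Longrightarrow> inj_on x {..<n} \<Longrightarrow>
              (\<Sum>\<nu>\<in>W. c \<nu> * (\<Prod>i<n. x i ^ \<nu> i)) = 0"
    and \<nu>: "\<nu> \<in> W"
  shows "c \<nu> = 0"
proof -
  \<comment> \<open>One \<open>Suc\<close> makes \<open>N\<close> exceed all exponents, so that they
    are digits in base \<open>N\<close>; the other ensures \<open>N \<ge> 2\<close>, so that the
    powers \<open>N ^ i\<close> are distinct.\<close>
  define N where "N = Suc (Suc (Max (insert 0 ((\<lambda>(\<nu>, i). \<nu> i) ` (W \<times> {..<n})))))"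
  have N: "\<nu> i < N" if "\<nu> \<in> W" "i < n" for \<nu> i
  proof -
    have "\<nu> i \<in> (\<lambda>(\<nu>, i). \<nu> i) ` (W \<times> {..<n})" using that by force
    then have "\<nu> i \<le> Max (insert 0 ((\<lambda>(\<nu>, i). \<nu> i) ` (W \<times> {..<n})))"
      using W(1) by (intro Max_ge) auto
    then show ?thesis by (simp add: N_def)
  qed
  define code where "code \<nu> = (\<Sum>i<n. \<nu> i * N ^ i)" for \<nu> :: "nat \<Rightarrow> nat"
  have inj: "inj_on code W"
  proof
    fix \<mu> \<nu> assume *: "\<mu> \<in> W" "\<nu> \<in> W" "code \<mu> = code \<nu>"
    show "\<mu> = \<nu>"
    proof
      fix i show "\<mu> i = \<nu> i"
        using radix_inj[of \<mu> N n \<nu> i] N W(2)[of \<mu> i] W(2)[of \<nu> i] * by (cases "i < n") (auto simp: code_def)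
    qed
  qed
  define P where "P = (\<Sum>\<nu>\<in>W. monom (c \<nu>) (code \<nu>))"
  \<comment> \<open>For \<open>k\<close> equal to 0 or 1 the coordinates of the point would
    coincide.\<close>
  have "poly P (of_nat k) = 0" if k: "k \<ge> 2" for k
  proof -
    define x :: "nat \<Rightarrow> 'a" where "x i = of_nat k ^ (N ^ i)" for i
    have "N \<ge> 2" by (simp add: N_def)
    have "i = j" if "x i = x j" for i j
    proof -
      have "of_nat (k ^ (N ^ i)) = (of_nat (k ^ (N ^ j)) :: 'a)" using that by (simp add: x_def)
      then have "k ^ (N ^ i) = k ^ (N ^ j)" by (simp only: of_nat_eq_iff)
      then have "N ^ i = N ^ j" using k power_inject_exp[of k] by simp
      then show ?thesis using \<open>N \<ge> 2\<close> power_inject_exp[of N] by simp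
    qed
    then have "inj_on x {..<n}" by (auto simp: inj_on_def)
    moreover have "x i \<noteq> 0" for i using k by (simp add: x_def)
    ultimately have "(\<Sum>\<nu>\<in>W. c \<nu> * (\<Prod>i<n. x i ^ \<nu> i)) = 0" by (intro z) auto
    also have "(\<Sum>\<nu>\<in>W. c \<nu> * (\<Prod>i<n. x i ^ \<nu> i)) = poly P (of_nat k)"
      by (simp add: P_def poly_sum poly_monom x_def code_def power_mult[symmetric] power_sum[symmetric] mult.commute)
    finally show ?thesis .
  qed
  then have "P = 0" by (rule poly_eq_0_if_nat_roots)
  then have "0 = coeff P (code \<nu>)" by simp
  also have "\<dots> = (\<Sum>\<mu>\<in>W. if \<mu> = \<nu> then c \<mu> else 0)"
    unfolding P_def coeff_sum coeff_monom using inj \<nu> by (intro sum.cong) (auto simp: inj_on_def)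
  also have "\<dots> = c \<nu>" using W(1) \<nu> by simp
  finally show ?thesis ..
qed

text \<open>Only finitely many variables occur. The bijection \<open>g\<close> numbers them, and
  \<open>r\<close> turns exponent vectors into functions supported below \<open>n\<close>, the
  format of \<open>monomials_independent\<close>.\<close>

lemma mp_eval_vanish:
  fixes p :: "('v, 'a :: field_char_0) mpoly"
  assumes "\<And>x. mp_eval x p = 0"
  shows "p = 0"
proof (rule ccontr)
  assume "p \<noteq> 0"
  define V where "V = (\<Union>\<alpha>\<in>Poly_Mapping.keys p. Poly_Mapping.keys \<alpha>)"
  have V: "finite V" "\<And>\<alpha>. \<alpha> \<in> Poly_Mapping.keys p \<Longrightarrow> Poly_Mapping.keys \<alpha> \<subseteq> V" by (auto simp: V_def)
  define n where "n = card V"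
  obtain g where g: "bij_betw g {..<n} V"
    using ex_bij_betw_nat_finite[OF V(1)] by (auto simp: n_def lessThan_atLeast0)
  define h where "h = the_inv_into {..<n} g"
  have hg: "h (g i) = i" if "i < n" for i
    using g that by (auto simp: h_def bij_betw_def intro: the_inv_into_f_f)
  define r where "r \<alpha> = (\<lambda>i. if i < n then Poly_Mapping.lookup \<alpha> (g i) else 0)" for \<alpha> :: "'v \<Rightarrow>\<^sub>0 nat"
  have inj: "inj_on r (Poly_Mapping.keys p)"
  proof
    fix \<alpha> \<beta> assume *: "\<alpha> \<in> Poly_Mapping.keys p" "\<beta> \<in> Poly_Mapping.keys p" "r \<alpha> = r \<beta>"
    show "\<alpha> = \<beta>"
    proof (rule poly_mapping_eqI)
      fix v
      show "Poly_Mapping.lookup \<alpha> v = Poly_Mapping.lookup \<beta> v"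
      proof (cases "v \<in> V")
        case True
        then obtain i where "i < n" "v = g i" using g by (auto simp: bij_betw_def)
        then show ?thesis using fun_cong[OF *(3), of i] by (simp add: r_def)
      next
        case False
        then have "v \<notin> Poly_Mapping.keys \<alpha>" "v \<notin> Poly_Mapping.keys \<beta>" using V(2) * by auto
        then show ?thesis by (simp add: in_keys_iff)
      qed
    qed
  qed
  obtain \<alpha> where \<alpha>: "\<alpha> \<in> Poly_Mapping.keys p" using \<open>p \<noteq> 0\<close> by (meson ex_in_conv keys_eq_empty)
  define c where "c = (\<lambda>\<nu>. Poly_Mapping.lookup p (the_inv_into (Poly_Mapping.keys p) r \<nu>))"
  have "c (r \<alpha>) = 0"
  proof (rule monomials_independent[where c = c and \<nu> = "r \<alpha>" and W = "r ` Poly_Mapping.keys p" and n = n])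
    fix y :: "nat \<Rightarrow> 'a"
    have "0 = mp_eval (\<lambda>v. y (h v)) p" using assms by simp
    also have "\<dots> = (\<Sum>\<beta>\<in>Poly_Mapping.keys p. Poly_Mapping.lookup p \<beta> * (\<Prod>i<n. y i ^ r \<beta> i))"
      unfolding mp_eval_eq_mp_ev mp_ev_def
    proof (intro sum.cong refl arg_cong2[of _ _ _ _ times])
      fix \<beta> assume "\<beta> \<in> Poly_Mapping.keys p"
      then have "mp_mon (\<lambda>v. y (h v)) \<beta> = (\<Prod>v\<in>V. y (h v) ^ Poly_Mapping.lookup \<beta> v)"
        using V by (intro mp_mon_superset) auto
      also have "\<dots> = (\<Prod>i<n. y (h (g i)) ^ Poly_Mapping.lookup \<beta> (g i))"
        by (rule prod.reindex_bij_betw[OF g, symmetric])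
      also have "\<dots> = (\<Prod>i<n. y i ^ r \<beta> i)" by (intro prod.cong) (auto simp: hg r_def)
      finally show "mp_mon (\<lambda>v. y (h v)) \<beta> = (\<Prod>i<n. y i ^ r \<beta> i)" .
    qed
    also have "\<dots> = (\<Sum>\<nu>\<in>r ` Poly_Mapping.keys p. c \<nu> * (\<Prod>i<n. y i ^ \<nu> i))"
      using inj by (simp add: sum.reindex c_def the_inv_into_f_f)
    finally show "(\<Sum>\<nu>\<in>r ` Poly_Mapping.keys p. c \<nu> * (\<Prod>i<n. y i ^ \<nu> i)) = 0" ..
  qed (use \<alpha> in \<open>auto simp: r_def\<close>)
  then show False using \<alpha> inj by (simp add: c_def the_inv_into_f_f in_keys_iff)
qed

section \<open>The dual Jacobi--Trudi identity\<close>

lemma det_scale_rows_cols: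
  fixes f :: "nat \<Rightarrow> nat \<Rightarrow> 'a :: comm_ring_1"
  shows "det (mat n n (\<lambda>(i, j). u i * v j * f i j)) =
    (\<Prod>i<n. u i) * (\<Prod>i<n. v i) * det (mat n n (\<lambda>(i, j). f i j))"
proof -
  have "(\<Prod>i=0..<n. u i * v (p i) * f i (p i)) = (\<Prod>i<n. u i) * (\<Prod>i<n. v i) * (\<Prod>i=0..<n. f i (p i))"
    if "p permutes {0..<n}" for p
    using prod.permute[OF that, of v] by (simp add: prod.distrib o_def lessThan_atLeast0)
  then have "signof p * (\<Prod>i=0..<n. mat n n (\<lambda>(i, j). u i * v j * f i j) $$ (i, p i)) =
      (\<Prod>i<n. u i) * (\<Prod>i<n. v i) * (signof p * (\<Prod>i=0..<n. mat n n (\<lambda>(i, j). f i j) $$ (i, p i)))"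
    if "p permutes {0..<n}" for p
    using that permutes_in_image[OF that] by (simp add: mult_ac)
  then show ?thesis
    by (simp add: det_def'[of _ n] sum_distrib_left)
qed

text \<open>The sign of the permutation enters once for the rows and once for the columns, and its
  square is 1.\<close>

lemma det_permute_both:
  fixes f :: "nat \<Rightarrow> nat \<Rightarrow> 'a :: comm_ring_1"
  assumes p: "p permutes {0..<n}"
  shows "det (mat n n (\<lambda>(i, j). f (p i) (p j))) = det (mat n n (\<lambda>(i, j). f i j))"
proof -
  have lt: "p i < n" if "i < n" for i using permutes_in_image[OF p, of i] that by simp
  let ?A = "mat n n (\<lambda>(i, j). f i j)"
  let ?B = "mat n n (\<lambda>(i, j). f i (p j))"
  have "det (mat n n (\<lambda>(i, j). f (p i) (p j))) = det (mat n n (\<lambda>(i, j). ?B $$ (p i, j)))"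
    by (intro arg_cong[where f = det] eq_matI) (auto simp: lt)
  also have "\<dots> = signof p * det ?B" by (rule det_permute_rows[OF _ p]) simp
  also have "det ?B = det (transpose_mat ?B)" by (rule det_transpose[symmetric, of _ n]) simp
  also have "transpose_mat ?B = mat n n (\<lambda>(i, j). transpose_mat ?A $$ (p i, j))"
    by (intro eq_matI) (auto simp: lt)
  also have "det \<dots> = signof p * det (transpose_mat ?A)" by (rule det_permute_rows[OF _ p]) simp
  also have "det (transpose_mat ?A) = det ?A" by (rule det_transpose[of _ n]) simp
  finally show ?thesis by (simp add: sign_def)
qed

lemma det_reverse:
  fixes f :: "nat \<Rightarrow> nat \<Rightarrow> 'a :: comm_ring_1"
  shows "det (mat n n (\<lambda>(i, j). f (n - 1 - i) (n - 1 - j))) = det (mat n n (\<lambda>(i, j). f i j))"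
proof -
  define p where "p i = (if i < n then n - 1 - i else i)" for i
  have "p permutes {0..<n}"
    by (rule bij_imp_permutes, rule bij_betw_byWitness[of _ p]) (auto simp: p_def)
  from det_permute_both[OF this, of f] show ?thesis
    by (subst (asm) cong_mat[of n n n n _ "\<lambda>(i, j). f (n - 1 - i) (n - 1 - j)"]) (auto simp: p_def)
qed

text \<open>Values grow by at least one per step. Counting up from 0 gives
  \<open>i \<le> r i\<close>, and counting from \<open>i\<close> to \<open>l - 1\<close> gives
  \<open>r i \<le> i\<close>.\<close>

lemma strict_mono_on_bounded_id:
  fixes r :: "nat \<Rightarrow> nat"
  assumes "strict_mono_on {..<l} r" "\<And>i. i < l \<Longrightarrow> r i < l" "i < l"
  shows "r i = i"
proof -
  have ge: "i \<le> r i" if "i < l" for i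
    using that
  proof (induction i)
    case (Suc i)
    have "r i < r (Suc i)" using assms(1) Suc.prems by (auto simp: strict_mono_on_def)
    with Suc show ?case by simp
  qed simp
  have "r i + k \<le> r (i + k)" if "i + k < l" for k
    using that
  proof (induction k)
    case (Suc k)
    have "r (i + k) < r (i + Suc k)" using assms(1) Suc.prems by (auto simp: strict_mono_on_def)
    with Suc show ?case by simp
  qed simp
  from this[of "l - 1 - i"] ge[OF assms(3)] assms(2)[of "l - 1"] assms(3) show ?thesis by simp
qed

text \<open>Expansion along the last column, a unit vector with its 1 in row \<open>c m\<close>.
  This is the largest of the \<open>c j\<close>, so deleting that row leaves the other
  \<open>c j\<close> in place and only renumbers the rows \<open>r i\<close> below it.\<close>

lemma det_unit_columns:
  fixes a :: "nat \<Rightarrow> nat \<Rightarrow> 'a :: comm_ring_1"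
  assumes "strict_mono_on {..<l} r" "strict_mono_on {..<m} c"
    "\<And>i. i < l \<Longrightarrow> r i < l + m" "\<And>j. j < m \<Longrightarrow> c j < l + m"
    "\<And>i j. i < l \<Longrightarrow> j < m \<Longrightarrow> r i \<noteq> c j"
  shows "det (mat (l + m) (l + m) (\<lambda>(i, j). if j < l then a i j else if i = c (j - l) then 1 else 0)) =
    (\<Prod>j<m. (- 1) ^ (c j + l + j)) * det (mat l l (\<lambda>(i, j). a (r i) j))"
  using assms
proof (induction m arbitrary: a r)
  case 0
  then have "r i = i" if "i < l" for i using strict_mono_on_bounded_id[of l r i] that by auto
  then show ?case by (auto intro!: arg_cong[where f = det] eq_matI)
next
  case (Suc m)
  let ?N = "l + Suc m"
  let ?M = "mat ?N ?N (\<lambda>(i, j). if j < l then a i j else if i = c (j - l) then 1 else 0)"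
  have cm: "c m < ?N" using Suc.prems by simp
  have cl: "c j < c m" if "j < m" for j using Suc.prems(2) that by (auto simp: strict_mono_on_def)
  define a' where "a' i j = a (if i < c m then i else Suc i) j" for i j
  define r' where "r' i = (if r i < c m then r i else r i - 1)" for i
  have rc: "r i \<noteq> c m" if "i < l" for i using Suc.prems(5) that by blast
  have "det ?M = (\<Sum>i<?N. ?M $$ (i, l + m) * cofactor ?M i (l + m))"
    by (rule laplace_expansion_column) auto
  also have "\<dots> = (\<Sum>i<?N. if i = c m then cofactor ?M i (l + m) else 0)"
    by (intro sum.cong) auto
  also have "\<dots> = cofactor ?M (c m) (l + m)" using cm by simp
  also have "\<dots> = (- 1) ^ (c m + l + m) * det (mat_delete ?M (c m) (l + m))"
    by (simp add: cofactor_def add_ac)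
  also have "mat_delete ?M (c m) (l + m) =
      mat (l + m) (l + m) (\<lambda>(i, j). if j < l then a' i j else if i = c (j - l) then 1 else 0)"
  proof (rule eq_matI)
    fix i j assume "i < dim_row (mat (l + m) (l + m) (\<lambda>(i, j). if j < l then a' i j else if i = c (j - l) then 1 else 0))"
      "j < dim_col (mat (l + m) (l + m) (\<lambda>(i, j). if j < l then a' i j else if i = c (j - l) then 1 else 0))"
    then show "mat_delete ?M (c m) (l + m) $$ (i, j) =
      mat (l + m) (l + m) (\<lambda>(i, j). if j < l then a' i j else if i = c (j - l) then 1 else 0) $$ (i, j)"
      using cl[of "j - l"] by (cases "j < l"; cases "j - l < m") (auto simp: mat_delete_def a'_def)
  qed (auto simp: mat_delete_def)
  also have "det \<dots> = (\<Prod>j<m. (- 1) ^ (c j + l + j)) * det (mat l l (\<lambda>(i, j). a' (r' i) j))"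
  proof (rule Suc.IH)
    show "strict_mono_on {..<l} r'"
    proof (rule strict_mono_onI)
      fix x y assume xy: "x \<in> {..<l}" "y \<in> {..<l}" "x < y"
      have "r x < r y" using strict_mono_onD[OF Suc.prems(1) xy] .
      then show "r' x < r' y" using rc[of x] rc[of y] xy by (auto simp: r'_def)
    qed
    show "strict_mono_on {..<m} c" using Suc.prems(2) by (auto simp: strict_mono_on_def)
    show "r' i < l + m" if "i < l" for i using Suc.prems(3)[OF that] cm rc[OF that] by (auto simp: r'_def)
    show "c j < l + m" if "j < m" for j using cl[OF that] cm by simp
    show "r' i \<noteq> c j" if "i < l" "j < m" for i j
      using Suc.prems(5)[of i j] that cl[of j] rc[of i] by (auto simp: r'_def)
  qed
  also have "mat l l (\<lambda>(i, j). a' (r' i) j) = mat l l (\<lambda>(i, j). a (r i) j)"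
  proof (rule eq_matI)
    fix i j assume "i < dim_row (mat l l (\<lambda>(i, j). a (r i) j))" "j < dim_col (mat l l (\<lambda>(i, j). a (r i) j))"
    then show "mat l l (\<lambda>(i, j). a' (r' i) j) $$ (i, j) = mat l l (\<lambda>(i, j). a (r i) j) $$ (i, j)"
      using rc[of i] by (auto simp: a'_def r'_def)
  qed auto
  finally show ?case by simp
qed

text \<open>Both Toeplitz matrices are lower triangular, so truncation to size \<open>N\<close>
  loses no term of the convolution.\<close>

lemma sum_toeplitz:
  fixes b h :: "int \<Rightarrow> 'a :: comm_ring_1"
  assumes neg: "\<And>d. d < 0 \<Longrightarrow> b d = 0" "\<And>d. d < 0 \<Longrightarrow> h d = 0"
    and inv: "\<And>d. (\<Sum>k\<le>d. b (int k) * h (int (d - k))) = (if d = 0 then 1 else 0)"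
    and ij: "i < N" "j < N"
  shows "(\<Sum>k<N. b (int i - int k) * h (int k - int j)) = (if i = j then 1 else 0)"
proof (cases "j \<le> i")
  case True
  have "(\<Sum>k<N. b (int i - int k) * h (int k - int j)) = (\<Sum>k\<in>{j..i}. b (int i - int k) * h (int k - int j))"
  proof (rule sum.mono_neutral_right)
    show "\<forall>k\<in>{..<N} - {j..i}. b (int i - int k) * h (int k - int j) = 0"
    proof
      fix k assume "k \<in> {..<N} - {j..i}"
      then have "int i - int k < 0 \<or> int k - int j < 0" by auto
      then show "b (int i - int k) * h (int k - int j) = 0" using neg by auto
    qed
  qed (use ij in auto)
  also have "\<dots> = (\<Sum>k\<le>i - j. b (int k) * h (int (i - j - k)))"
    by (rule sum.reindex_bij_witness[of _ "\<lambda>k. i - k" "\<lambda>k. i - k"]) (use True in \<open>auto simp: of_nat_diff\<close>)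
  finally show ?thesis using inv[of "i - j"] True by auto
next
  case False
  have "b (int i - int k) * h (int k - int j) = 0" for k
    using False neg(1)[of "int i - int k"] neg(2)[of "int k - int j"] by (cases "i < k") auto
  then show ?thesis using False by simp
qed

text \<open>This is Jacobi's identity for complementary minors of the mutually inverse unitriangular Toeplitz
  matrices of \<open>h\<close> and of the signed \<open>e\<close>: the beta numbers \<open>r\<close> of the partition and the complementary
  numbers \<open>c\<close> coming from the conjugate partition select the two minors.\<close>

lemma dual_Jacobi_Trudi:
  fixes h e :: "int \<Rightarrow> 'a :: idom"
  assumes neg: "\<And>d. d < 0 \<Longrightarrow> h d = 0" "\<And>d. d < 0 \<Longrightarrow> e d = 0" and zero: "e 0 = 1"
    and inv: "\<And>d. (\<Sum>k\<le>d. (- 1) ^ k * e (int k) * h (int (d - k))) = (if d = 0 then 1 else 0)"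
    and conj: "\<And>i j. i < l \<Longrightarrow> j < m \<Longrightarrow> j < L i \<longleftrightarrow> i < L' j"
    and anti: "\<And>i j. i \<le> j \<Longrightarrow> j < l \<Longrightarrow> L j \<le> L i" "\<And>i j. i \<le> j \<Longrightarrow> j < m \<Longrightarrow> L' j \<le> L' i"
    and bound: "\<And>i. i < l \<Longrightarrow> L i \<le> m" "\<And>j. j < m \<Longrightarrow> L' j \<le> l"
  shows "det (mat l l (\<lambda>(i, j). h (int (L i) + int j - int i))) =
    det (mat m m (\<lambda>(i, j). e (int (L' i) + int j - int i)))"
proof -
  define b where "b d = (if d < 0 then 0 else (- 1) ^ nat d * e d)" for d
  \<comment> \<open>The beta numbers are listed in increasing order, which reverses the rows;
    \<open>det_reverse\<close> undoes this below.\<close>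
  define r where "r i = L (l - 1 - i) + i" for i
  define c where "c j = l + j - L' j" for j
  let ?N = "l + m"
  \<comment> \<open>The columns from \<open>l\<close> on are unit vectors at the complementary rows,
    so \<open>det M\<close> is up to sign the minor of the rows \<open>r\<close>. Multiplication by
    \<open>B\<close> turns the first \<open>l\<close> columns into unit vectors and brings out the
    complementary minor of \<open>B\<close>.\<close>
  define M where "M = mat ?N ?N (\<lambda>(i, j). if j < l then h (int i - int j) else if i = c (j - l) then 1 else 0)"
  define B where "B = mat ?N ?N (\<lambda>(i, j). b (int i - int j))"
  have M: "M \<in> carrier_mat ?N ?N" and B: "B \<in> carrier_mat ?N ?N" by (auto simp: M_def B_def)
  have c_lt: "c j < ?N" if "j < m" for j using that by (simp add: c_def)
  have detM: "det M = (\<Prod>j<m. (- 1) ^ (c j + l + j)) * det (mat l l (\<lambda>(i, j). h (int (r i) - int j)))"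
    unfolding M_def
  proof (rule det_unit_columns)
    show "strict_mono_on {..<l} r"
    proof (rule strict_mono_onI)
      fix x y assume "x \<in> {..<l}" "y \<in> {..<l}" "x < y"
      moreover from this have "L (l - 1 - x) \<le> L (l - 1 - y)" by (intro anti(1)) auto
      ultimately show "r x < r y" by (simp add: r_def)
    qed
    show "strict_mono_on {..<m} c"
    proof (rule strict_mono_onI)
      fix x y assume "x \<in> {..<m}" "y \<in> {..<m}" "x < y"
      then show "c x < c y" using anti(2)[of x y] bound(2)[of x] bound(2)[of y] by (auto simp: c_def)
    qed
    show "r i < ?N" if "i < l" for i using bound(1)[of "l - 1 - i"] that by (auto simp: r_def)
    show "c j < ?N" if "j < m" for j by (rule c_lt[OF that])
    show "r i \<noteq> c j" if "i < l" "j < m" for i j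
      using conj[of "l - 1 - i" j] bound(2)[of j] that by (cases "j < L (l - 1 - i)") (auto simp: r_def c_def)
  qed
  have "mat l l (\<lambda>(i, j). h (int (r i) - int j)) =
      mat l l (\<lambda>(i, j). h (int (L (l - 1 - i)) + int (l - 1 - j) - int (l - 1 - i)))"
    by (rule eq_matI) (auto simp: r_def of_nat_diff intro!: arg_cong[where f = h])
  then have detA: "det (mat l l (\<lambda>(i, j). h (int (r i) - int j))) =
      det (mat l l (\<lambda>(i, j). h (int (L i) + int j - int i)))"
    using det_reverse[of l "\<lambda>i j. h (int (L i) + int j - int i)"] by simp
  have "det B = prod_list (diag_mat B)"
    by (rule det_lower_triangular[OF _ B]) (auto simp: B_def b_def)
  also have "diag_mat B = map (\<lambda>_. 1) [0..<?N]"
    by (auto simp: diag_mat_def B_def b_def zero)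
  finally have detB: "det B = 1" by (simp add: map_replicate_const)
  let ?U = "mat l m (\<lambda>(i, k). b (int i - int (c k)))"
  let ?D = "mat m m (\<lambda>(i, k). b (int (l + i) - int (c k)))"
  have "B * M = four_block_mat (1\<^sub>m l) ?U (0\<^sub>m m l) ?D"
  proof (rule eq_matI)
    fix i j assume "i < dim_row (four_block_mat (1\<^sub>m l) ?U (0\<^sub>m m l) ?D)"
      "j < dim_col (four_block_mat (1\<^sub>m l) ?U (0\<^sub>m m l) ?D)"
    then have ij: "i < ?N" "j < ?N" by auto
    have "(B * M) $$ (i, j) = (\<Sum>k<?N. B $$ (i, k) * M $$ (k, j))"
      using B M ij by (simp add: scalar_prod_def lessThan_atLeast0)
    also have "\<dots> = (if j < l then if i = j then 1 else 0 else b (int i - int (c (j - l))))"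
    proof (cases "j < l")
      case True
      then have "(\<Sum>k<?N. B $$ (i, k) * M $$ (k, j)) = (\<Sum>k<?N. b (int i - int k) * h (int k - int j))"
        using ij by (intro sum.cong) (auto simp: B_def M_def)
      also have "\<dots> = (if i = j then 1 else 0)"
        by (rule sum_toeplitz) (use ij neg inv in \<open>auto simp: b_def\<close>)
      finally show ?thesis using True by simp
    next
      case False
      then have "(\<Sum>k<?N. B $$ (i, k) * M $$ (k, j)) = (\<Sum>k<?N. if k = c (j - l) then b (int i - int k) else 0)"
        using ij by (intro sum.cong) (auto simp: B_def M_def)
      then show ?thesis using False c_lt[of "j - l"] ij by simp
    qed
    also have "\<dots> = four_block_mat (1\<^sub>m l) ?U (0\<^sub>m m l) ?D $$ (i, j)"
      using ij by auto
    finally show "(B * M) $$ (i, j) = four_block_mat (1\<^sub>m l) ?U (0\<^sub>m m l) ?D $$ (i, j)" .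
  qed (use B M in auto)
  then have "det B * det M = det (four_block_mat (1\<^sub>m l) ?U (0\<^sub>m m l) ?D)"
    using det_mult[OF B M] by simp
  also have "\<dots> = det ?D"
    by (subst det_four_block_mat_lower_left_zero[of _ l _ m]) auto
  finally have MD: "det M = det ?D" using detB by simp
  \<comment> \<open>Modulo 2 the degree \<open>L' k + i - k\<close> is the sum of \<open>i\<close>
    and \<open>L' k + k\<close>, so the sign splits into a row factor and a column factor.\<close>
  have "?D = mat m m (\<lambda>(i, k). (- 1) ^ i * (- 1) ^ (L' k + k) * e (int (L' k) + int i - int k))"
  proof (rule eq_matI)
    fix i k assume "i < dim_row (mat m m (\<lambda>(i, k). (- 1) ^ i * (- 1) ^ (L' k + k) * e (int (L' k) + int i - int k)))"
      "k < dim_col (mat m m (\<lambda>(i, k). (- 1) ^ i * (- 1) ^ (L' k + k) * e (int (L' k) + int i - int k)))"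
    then have ik: "i < m" "k < m" by auto
    have d: "int (l + i) - int (c k) = int (L' k) + int i - int k"
      using bound(2)[OF ik(2)] by (auto simp: c_def of_nat_diff)
    have "b (int (L' k) + int i - int k) = (- 1) ^ i * (- 1) ^ (L' k + k) * e (int (L' k) + int i - int k)"
    proof (cases "int (L' k) + int i - int k < 0")
      case False
      have "even (nat (int (L' k) + int i - int k)) = even (i + (L' k + k))"
        using False by (auto simp: even_nat_iff)
      then have "(- 1 :: 'a) ^ nat (int (L' k) + int i - int k) = (- 1) ^ (i + (L' k + k))"
        by (simp add: minus_one_power_iff)
      then show ?thesis using False by (simp add: b_def power_add)
    qed (simp add: b_def neg)
    then show "?D $$ (i, k) = mat m m (\<lambda>(i, k). (- 1) ^ i * (- 1) ^ (L' k + k) * e (int (L' k) + int i - int k)) $$ (i, k)"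
      using ik by (simp only: d[symmetric] index_mat prod.case)
  qed auto
  then have "det ?D = (\<Prod>i<m. (- 1) ^ i) * (\<Prod>k<m. (- 1) ^ (L' k + k)) *
      det (mat m m (\<lambda>(i, k). e (int (L' k) + int i - int k)))"
    by (simp only: det_scale_rows_cols)
  also have "det (mat m m (\<lambda>(i, k). e (int (L' k) + int i - int k))) =
      det (transpose_mat (mat m m (\<lambda>(i, j). e (int (L' i) + int j - int i))))"
    by (intro arg_cong[where f = det] eq_matI) auto
  also have "\<dots> = det (mat m m (\<lambda>(i, j). e (int (L' i) + int j - int i)))"
    by (rule det_transpose[of _ m]) simp
  also have "(\<Prod>i<m. (- 1) ^ i) * (\<Prod>k<m. (- 1) ^ (L' k + k)) = (\<Prod>j<m. (- 1 :: 'a) ^ (c j + l + j))"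
    unfolding prod.distrib[symmetric]
  proof (rule prod.cong)
    fix j assume "j \<in> {..<m}"
    then have "L' j \<le> l" using bound(2) by simp
    then have "even (j + (L' j + j)) = even (c j + l + j)" by (auto simp: c_def)
    then show "(- 1) ^ j * (- 1) ^ (L' j + j) = (- 1 :: 'a) ^ (c j + l + j)"
      unfolding power_add[symmetric] by (simp only: minus_one_power_iff)
  qed simp
  finally have "(\<Prod>j<m. (- 1 :: 'a) ^ (c j + l + j)) * det (mat l l (\<lambda>(i, j). h (int (L i) + int j - int i))) =
      (\<Prod>j<m. (- 1) ^ (c j + l + j)) * det (mat m m (\<lambda>(i, j). e (int (L' i) + int j - int i)))"
    using detM MD detA by simp
  moreover have "(\<Prod>j<m. (- 1 :: 'a) ^ (c j + l + j)) \<noteq> 0" by simp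
  ultimately show ?thesis by simp
qed

section \<open>Coefficients of the generating series and their evaluation\<close>

definition fps_map :: "('a \<Rightarrow> 'b) \<Rightarrow> 'a fps \<Rightarrow> 'b fps" where
  "fps_map \<phi> f = Abs_fps (\<lambda>d. \<phi> (fps_nth f d))"

lemma fps_map_nth [simp]: "fps_nth (fps_map \<phi> f) d = \<phi> (fps_nth f d)"
  by (simp add: fps_map_def)

lemma fps_map_comm_ring_hom:
  fixes \<phi> :: "'a :: comm_ring_1 \<Rightarrow> 'b :: comm_ring_1"
  assumes "comm_ring_hom \<phi>"
  shows "comm_ring_hom (fps_map \<phi>)"
proof -
  interpret \<phi>: comm_ring_hom \<phi> by fact
  show ?thesis
    by unfold_locales (auto simp: fps_eq_iff fps_mult_nth \<phi>.hom_add \<phi>.hom_mult \<phi>.hom_sum)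
qed

lemma fps_map_compose:
  fixes \<phi> :: "'a :: comm_ring_1 \<Rightarrow> 'b :: comm_ring_1"
  assumes "comm_ring_hom \<phi>"
  shows "fps_map \<phi> (fps_compose f u) = fps_compose (fps_map \<phi> f) (fps_map \<phi> u)"
proof -
  interpret \<phi>: comm_ring_hom \<phi> by fact
  interpret F: comm_ring_hom "fps_map \<phi>" by (rule fps_map_comm_ring_hom[OF assms])
  show ?thesis
    by (simp add: fps_eq_iff fps_compose_nth \<phi>.hom_sum \<phi>.hom_mult F.hom_power[symmetric])
qed

lemma fps_map_X [simp]:
  assumes "comm_ring_hom \<phi>"
  shows "fps_map \<phi> fps_X = fps_X"
proof -
  interpret \<phi>: comm_ring_hom \<phi> by fact
  show ?thesis by (simp add: fps_eq_iff fps_X_def)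
qed

text \<open>Factor \<open>k\<close> is 1 plus terms of degree above \<open>k\<close>, so the factors
  from index \<open>d\<close> on do not touch coefficient \<open>d\<close>.\<close>

lemma fps_prod_stable:
  fixes f :: "nat \<Rightarrow> 'a :: comm_ring_1 fps"
  assumes "\<And>k. fps_nth (f k) 0 = 1" "\<And>k d. 0 < d \<Longrightarrow> d \<le> k \<Longrightarrow> fps_nth (f k) d = 0"
    and "d \<le> N" "N \<le> M"
  shows "fps_nth (\<Prod>k<M. f k) d = fps_nth (\<Prod>k<N. f k) d"
  using \<open>N \<le> M\<close>
proof (induction M rule: dec_induct)
  case (step M)
  have "fps_nth (\<Prod>k<Suc M. f k) d = (\<Sum>i=0..d. fps_nth (\<Prod>k<M. f k) i * fps_nth (f M) (d - i))"
    by (simp add: fps_mult_nth)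
  also have "\<dots> = (\<Sum>i\<in>{d}. fps_nth (\<Prod>k<M. f k) i * fps_nth (f M) (d - i))"
    using assms step.hyps by (intro sum.mono_neutral_right) auto
  finally show ?case using assms(1) step.IH by simp
qed simp

lemma fps_prodinf_nth:
  fixes f :: "nat \<Rightarrow> 'a :: idom fps"
  assumes f: "\<And>k. fps_nth (f k) 0 = 1" "\<And>k d. 0 < d \<Longrightarrow> d \<le> k \<Longrightarrow> fps_nth (f k) d = 0"
    and "d \<le> N"
  shows "fps_nth (prodinf f) d = fps_nth (\<Prod>k<N. f k) d"
proof -
  define L where "L = Abs_fps (\<lambda>d. fps_nth (\<Prod>k<d. f k) d)"
  have "(\<lambda>n. \<Prod>k\<le>n. f k) \<longlonglongrightarrow> L"
  proof (rule tendsto_fpsI)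
    fix d
    show "\<forall>\<^sub>F n in sequentially. fps_nth (\<Prod>k\<le>n. f k) d = fps_nth L d"
      using eventually_ge_at_top[of d]
    proof eventually_elim
      case (elim n)
      show ?case
        unfolding lessThan_Suc_atMost[symmetric] L_def fps_nth_Abs_fps
        by (rule fps_prod_stable) (use f elim in auto)
    qed
  qed
  \<comment> \<open>Convergence of an infinite product includes a nonzero limit; here the constant
    coefficient is 1.\<close>
  moreover have "L \<noteq> 0"
  proof
    assume "L = 0"
    then have "fps_nth L 0 = 0" by simp
    then show False by (simp add: L_def)
  qed
  ultimately have "f has_prod L" by (simp add: has_prod_def raw_has_prod_def)
  then have "prodinf f = L" by (rule has_prod_unique[symmetric])
  then have "fps_nth (prodinf f) d = fps_nth (\<Prod>k<d. f k) d" by (simp add: L_def)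
  also have "\<dots> = fps_nth (\<Prod>k<N. f k) d"
    using f \<open>d \<le> N\<close> by (intro fps_prod_stable[symmetric]) auto
  finally show ?thesis .
qed

lemma binomial_series_nth:
  fixes u :: "'a :: field_char_0 cycle_poly fps"
  assumes u: "\<And>d. d \<le> k \<Longrightarrow> fps_nth u d = 0"
  shows "fps_nth (binomial_series u q) 0 = 1"
    and "0 < d \<Longrightarrow> d \<le> k \<Longrightarrow> fps_nth (binomial_series u q) d = 0"
proof -
  have pow: "fps_nth (u ^ i) d = 0" if "0 < i" "d \<le> k" for i d
  proof -
    have "u ^ i = u ^ (i - 1) * u" using that by (cases i) auto
    then show ?thesis using u that by (auto simp: fps_mult_nth intro!: sum.neutral)
  qed
  have 0: "mp_gbinomial q 0 = (1 :: 'a cycle_poly)"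
    by (simp add: mp_gbinomial_def mp_const_def)
  show "fps_nth (binomial_series u q) 0 = 1"
    by (simp add: binomial_series_def fps_compose_nth 0)
  assume d: "0 < d" "d \<le> k"
  have "mp_gbinomial q i * fps_nth (u ^ i) d = 0" for i
    using pow[of i d] d by (cases "i = 0") auto
  then show "fps_nth (binomial_series u q) d = 0"
    by (simp add: binomial_series_def fps_compose_nth)
qed

lemma mp_eval_comm_ring_hom: "comm_ring_hom (mp_eval x :: ('v, 'a :: comm_ring_1) mpoly \<Rightarrow> 'a)"
proof -
  have "comm_ring_hom (\<lambda>c :: 'a. c)" by unfold_locales auto
  from mp_ev_comm_ring_hom[OF this, of x] show ?thesis
    by (simp add: mp_eval_eq_mp_ev[abs_def])
qed

lemma mp_eval_Xvar [simp]: "mp_eval x (Xvar (Suc k)) = (x k :: 'a :: comm_ring_1)"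
  by (simp add: mp_eval_eq_mp_ev Xvar_def mp_ev_single)

lemma mp_eval_gbinomial: "mp_eval x (mp_gbinomial q k) = (mp_eval x q gchoose k :: 'a :: field_char_0)"
proof -
  interpret ev: comm_ring_hom "mp_eval x :: 'a cycle_poly \<Rightarrow> 'a" by (rule mp_eval_comm_ring_hom)
  have "mp_eval x (mp_const c) = c" for c :: 'a
    by (simp add: mp_eval_eq_mp_ev mp_ev_const)
  then show ?thesis
    by (simp add: mp_gbinomial_def gbinomial_prod_rev ev.hom_mult ev.hom_prod ev.hom_minus ev.hom_of_nat
        lessThan_atLeast0)
qed

lemma fps_map_binomial_series:
  "fps_map (mp_eval x) (binomial_series u q) =
    fps_compose (fps_binomial (mp_eval x q)) (fps_map (mp_eval x) u :: 'a :: field_char_0 fps)"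
proof -
  have "fps_map (mp_eval x) (Abs_fps (mp_gbinomial q)) = fps_binomial (mp_eval x q)"
    by (simp add: fps_eq_iff mp_eval_gbinomial fps_binomial_nth)
  then show ?thesis by (simp add: binomial_series_def fps_map_compose[OF mp_eval_comm_ring_hom])
qed

text \<open>Once the variables are evaluated, the exponents lie in a field and
  \<open>fps_binomial\<close> applies. This factor is (1 - t^(k+1))^(- x k), and
  \<open>E_factor\<close> is (1 - (-t)^(k+1))^(x k).\<close>

definition H_factor :: "(nat \<Rightarrow> 'a) \<Rightarrow> nat \<Rightarrow> 'a :: field_char_0 fps" where
  "H_factor x k = fps_compose (fps_binomial (- x k)) (- (fps_X ^ Suc k))"

definition E_factor :: "(nat \<Rightarrow> 'a) \<Rightarrow> nat \<Rightarrow> 'a :: field_char_0 fps" where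
  "E_factor x k = fps_compose (fps_binomial (x k)) (- ((- fps_X) ^ Suc k))"

lemma mp_eval_H_poly:
  assumes "nat d \<le> N"
  shows "mp_eval x (H_poly d :: 'a :: field_char_0 cycle_poly) =
    (if d < 0 then 0 else fps_nth (\<Prod>k<N. H_factor x k) (nat d))"
proof -
  interpret ev: comm_ring_hom "mp_eval x :: 'a cycle_poly \<Rightarrow> 'a" by (rule mp_eval_comm_ring_hom)
  interpret F: comm_ring_hom "fps_map (mp_eval x) :: 'a cycle_poly fps \<Rightarrow> 'a fps"
    by (rule fps_map_comm_ring_hom[OF mp_eval_comm_ring_hom])
  let ?f = "\<lambda>k. binomial_series (- (fps_X ^ Suc k)) (- Xvar (Suc k)) :: 'a cycle_poly fps"
  have "fps_nth (H_series :: 'a cycle_poly fps) (nat d) = fps_nth (\<Prod>k<N. ?f k) (nat d)"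
    unfolding H_series_def
    by (rule fps_prodinf_nth[OF _ _ assms]; rule binomial_series_nth) (auto simp: fps_X_power_nth)
  then have "mp_eval x (fps_nth H_series (nat d)) = fps_nth (fps_map (mp_eval x) (\<Prod>k<N. ?f k)) (nat d)"
    by simp
  also have "fps_map (mp_eval x) (\<Prod>k<N. ?f k) = (\<Prod>k<N. H_factor x k)"
    by (simp add: F.hom_prod fps_map_binomial_series H_factor_def F.hom_uminus F.hom_power F.hom_mult ev.hom_uminus
        fps_map_X[OF mp_eval_comm_ring_hom])
  finally show ?thesis by (simp add: H_poly_def)
qed

lemma mp_eval_E_poly:
  assumes "nat d \<le> N"
  shows "mp_eval x (E_poly d :: 'a :: field_char_0 cycle_poly) =
    (if d < 0 then 0 else fps_nth (\<Prod>k<N. E_factor x k) (nat d))"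
proof -
  interpret ev: comm_ring_hom "mp_eval x :: 'a cycle_poly \<Rightarrow> 'a" by (rule mp_eval_comm_ring_hom)
  interpret F: comm_ring_hom "fps_map (mp_eval x) :: 'a cycle_poly fps \<Rightarrow> 'a fps"
    by (rule fps_map_comm_ring_hom[OF mp_eval_comm_ring_hom])
  let ?f = "\<lambda>k. binomial_series (- ((- fps_X) ^ Suc k)) (Xvar (Suc k)) :: 'a cycle_poly fps"
  have u: "fps_nth (- ((- fps_X) ^ Suc k) :: 'a cycle_poly fps) d = 0" if "d \<le> k" for k d
    using that by (subst power_minus) (auto simp: fps_X_power_nth minus_one_power_iff)
  have "fps_nth (E_series :: 'a cycle_poly fps) (nat d) = fps_nth (\<Prod>k<N. ?f k) (nat d)"
    unfolding E_series_def
    by (rule fps_prodinf_nth[OF _ _ assms]; rule binomial_series_nth) (use u in auto)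
  then have "mp_eval x (fps_nth E_series (nat d)) = fps_nth (fps_map (mp_eval x) (\<Prod>k<N. ?f k)) (nat d)"
    by simp
  also have "fps_map (mp_eval x) (\<Prod>k<N. ?f k) = (\<Prod>k<N. E_factor x k)"
    by (simp add: F.hom_prod fps_map_binomial_series E_factor_def F.hom_uminus F.hom_power F.hom_mult
        fps_map_X[OF mp_eval_comm_ring_hom])
  finally show ?thesis by (simp add: E_poly_def)
qed

lemma fps_neg_nth_0_X: "fps_nth (- fps_X :: 'a :: comm_ring_1 fps) 0 = 0"
  by simp

text \<open>The substitution of -t for t removes the sign inside the power and leaves the inverse of
  \<open>H_factor x k\<close>.\<close>

lemma E_factor_reflect:
  "fps_compose (E_factor x k) (- fps_X) = fps_compose (fps_binomial (x k)) (- (fps_X ^ Suc k) :: 'a :: field_char_0 fps)"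
proof -
  have "fps_compose (- ((- fps_X) ^ Suc k)) (- fps_X) = - (fps_compose (- fps_X) (- fps_X) ^ Suc k :: 'a fps)"
    by (subst fps_compose_uminus, subst fps_compose_power) (rule fps_neg_nth_0_X, rule refl)
  also have "fps_compose (- fps_X) (- fps_X) = (fps_X :: 'a fps)"
    by (simp only: fps_compose_uminus) (subst fps_X_fps_compose_startby0, auto)
  finally have "fps_compose (- ((- fps_X) ^ Suc k)) (- fps_X) = (- (fps_X ^ Suc k) :: 'a fps)" .
  then show ?thesis
    unfolding E_factor_def by (subst fps_compose_assoc[symmetric]) auto
qed

lemma H_factor_inverse:
  "H_factor x k * fps_compose (fps_binomial (x k)) (- (fps_X ^ Suc k)) = 1"
  unfolding H_factor_def
  by (subst fps_compose_mult_distrib[symmetric]) (auto simp: fps_binomial_add_mult[symmetric])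

text \<open>This is the coefficient of degree \<open>d\<close> in E(-t) H(t) = 1. Both products may
  be truncated after \<open>d\<close> factors, since later factors only affect higher
  degrees.\<close>

lemma mp_eval_E_H:
  fixes x :: "nat \<Rightarrow> 'a :: field_char_0"
  shows "(\<Sum>k\<le>d. (- 1) ^ k * mp_eval x (E_poly (int k)) * mp_eval x (H_poly (int (d - k)))) = (if d = 0 then 1 else 0)"
proof -
  define H where "H = (\<Prod>k<d. H_factor x k)"
  define E where "E = (\<Prod>k<d. E_factor x k)"
  have *: "fps_compose E (- fps_X) * H = 1"
  proof -
    have "fps_compose E (- fps_X) = (\<Prod>k<d. fps_compose (fps_binomial (x k)) (- (fps_X ^ Suc k)))"
      unfolding E_def by (subst fps_compose_prod_distrib) (simp_all only: E_factor_reflect fps_neg_nth fps_X_nth, simp)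
    then have "fps_compose E (- fps_X) * H =
        (\<Prod>k<d. H_factor x k * fps_compose (fps_binomial (x k)) (- (fps_X ^ Suc k)))"
      by (simp only: H_def prod.distrib mult.commute)
    then show ?thesis by (simp only: H_factor_inverse prod.neutral_const)
  qed
  have c: "fps_nth (fps_compose E (- fps_X)) k = (- 1) ^ k * fps_nth E k" for k
    by (simp add: fps_compose_uminus')
  have "(\<Sum>k\<le>d. (- 1) ^ k * mp_eval x (E_poly (int k)) * mp_eval x (H_poly (int (d - k)))) =
      (\<Sum>k\<le>d. fps_nth (fps_compose E (- fps_X)) k * fps_nth H (d - k))"
  proof (rule sum.cong)
    fix k assume "k \<in> {..d}"
    have "mp_eval x (E_poly (int k)) = fps_nth E k"
      unfolding E_def using \<open>k \<in> {..d}\<close> by (subst mp_eval_E_poly[where N = d]) simp_all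
    moreover have "mp_eval x (H_poly (int (d - k))) = fps_nth H (d - k)"
      unfolding H_def by (subst mp_eval_H_poly[where N = d]) (simp_all del: of_nat_diff)
    ultimately show "(- 1) ^ k * mp_eval x (E_poly (int k)) * mp_eval x (H_poly (int (d - k))) =
        fps_nth (fps_compose E (- fps_X)) k * fps_nth H (d - k)"
      by (simp only: c)
  qed simp
  also have "\<dots> = fps_nth (fps_compose E (- fps_X) * H) d"
    by (simp add: fps_mult_nth atLeast0AtMost)
  finally show ?thesis unfolding * by simp
qed

lemma hom_det_mat:
  assumes "comm_ring_hom \<phi>"
  shows "\<phi> (det (mat n n (\<lambda>(i, j). f i j))) = det (mat n n (\<lambda>(i, j). \<phi> (f i j)))"
proof -
  interpret comm_ring_hom \<phi> by fact
  have "map_mat \<phi> (mat n n (\<lambda>(i, j). f i j)) = mat n n (\<lambda>(i, j). \<phi> (f i j))"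
    by (rule eq_matI) auto
  then show ?thesis using hom_det[of "mat n n (\<lambda>(i, j). f i j)"] by simp
qed

text \<open>The parts decrease, so the rows longer than \<open>j\<close> form an initial segment,
  and the conjugate part is its length.\<close>

lemma conjugate_nth:
  assumes "is_partition lam" "j < length (conjugate lam)" "i < length lam"
  shows "j < lam ! i \<longleftrightarrow> i < conjugate lam ! j"
proof -
  have s: "lam ! k \<le> lam ! i" if "i \<le> k" "k < length lam" for i k
    using assms(1) that by (cases "i = k") (auto simp: is_partition_def sorted_wrt_iff_nth_less)
  define I where "I = {i. i < length lam \<and> j < lam ! i}"
  have cj: "conjugate lam ! j = card I" using assms(2) by (simp add: conjugate_def I_def)
  have fin: "finite I" by (simp add: I_def)
  show ?thesis
  proof
    assume "j < lam ! i"
    then have "{..i} \<subseteq> I" using s[of _ i] assms(3) by (force simp: I_def)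
    then have "card {..i} \<le> card I" by (rule card_mono[OF fin])
    then show "i < conjugate lam ! j" by (simp add: cj)
  next
    assume "i < conjugate lam ! j"
    show "j < lam ! i"
    proof (rule ccontr)
      assume "\<not> j < lam ! i"
      have "I \<subseteq> {..<i}"
      proof
        fix k assume "k \<in> I"
        then show "k \<in> {..<i}"
          using s[of i k] \<open>\<not> j < lam ! i\<close> by (cases "i \<le> k") (auto simp: I_def)
      qed
      then have "card I \<le> i" using card_mono[of "{..<i}" I] by simp
      then show False using \<open>i < conjugate lam ! j\<close> cj by simp
    qed
  qed
qed

text \<open>The relation between the two series is available after evaluation, where the exponents
  are field elements. The determinants are therefore compared at every point, and
  \<open>mp_eval_vanish\<close> lifts the result to the polynomials.\<close>

lemma det_H_eq_det_E:
  assumes lam: "is_partition lam"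
  shows "(det_H lam :: 'a :: field_char_0 cycle_poly) = det_E lam"
proof -
  have "mp_eval x (det_H lam - det_E lam) = 0" for x :: "nat \<Rightarrow> 'a"
  proof -
    interpret ev: comm_ring_hom "mp_eval x :: 'a cycle_poly \<Rightarrow> 'a" by (rule mp_eval_comm_ring_hom)
    let ?l = "length lam" and ?m = "length (conjugate lam)"
    define h where "h d = mp_eval x (H_poly d)" for d
    define e where "e d = mp_eval x (E_poly d)" for d
    have anti: "lam ! j \<le> lam ! i" if "i \<le> j" "j < ?l" for i j
      using lam that by (cases "i = j") (auto simp: is_partition_def sorted_wrt_iff_nth_less)
    have m: "?m = (if lam = [] then 0 else lam ! 0)" by (simp add: conjugate_def hd_conv_nth)
    have L'_le: "conjugate lam ! j \<le> ?l" if "j < ?m" for j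
      using that card_mono[of "{..<?l}" "{i. i < ?l \<and> j < lam ! i}"]
      by (auto simp: conjugate_def)
    have "mp_eval x (det_H lam) = det (mat ?l ?l (\<lambda>(i, j). h (int (lam ! i) + int j - int i)))"
      by (simp only: det_H_def hom_det_mat[OF mp_eval_comm_ring_hom] h_def)
    also have "\<dots> = det (mat ?m ?m (\<lambda>(i, j). e (int (conjugate lam ! i) + int j - int i)))"
    proof (rule dual_Jacobi_Trudi)
      have "mp_eval x (0 :: 'a cycle_poly) = 0" by simp
      then show "h d = 0" "e d = 0" if "d < 0" for d using that by (auto simp: h_def e_def H_poly_def E_poly_def)
      show inv: "(\<Sum>k\<le>d. (- 1) ^ k * e (int k) * h (int (d - k))) = (if d = 0 then 1 else 0)" for d
        unfolding h_def e_def by (rule mp_eval_E_H)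
      show "e 0 = 1" using mp_eval_E_poly[of 0 0 x] by (simp add: e_def)
      show "j < lam ! i \<longleftrightarrow> i < conjugate lam ! j" if "i < ?l" "j < ?m" for i j
        using conjugate_nth[OF lam] that by simp
      show "lam ! j \<le> lam ! i" if "i \<le> j" "j < ?l" for i j by (rule anti[OF that])
      show "conjugate lam ! j \<le> conjugate lam ! i" if "i \<le> j" "j < ?m" for i j
        using that by (auto simp: conjugate_def intro!: card_mono)
      show "lam ! i \<le> ?m" if "i < ?l" for i using anti[of 0 i] that m by auto
      show "conjugate lam ! j \<le> ?l" if "j < ?m" for j by (rule L'_le[OF that])
    qed
    also have "\<dots> = mp_eval x (det_E lam)"
      by (simp only: det_E_def Let_def hom_det_mat[OF mp_eval_comm_ring_hom] e_def)
    finally show ?thesis by (simp add: ev.hom_minus)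
  qed
  then have "det_H lam - det_E lam = (0 :: 'a cycle_poly)" by (rule mp_eval_vanish)
  then show ?thesis by simp
qed

section \<open>Complete symmetric polynomials and alternants\<close>

text \<open>The geometric series 1 / (1 - a t).\<close>

definition geo :: "'a \<Rightarrow> 'a :: comm_ring_1 fps" where
  "geo a = Abs_fps (\<lambda>k. a ^ k)"

text \<open>The complete homogeneous symmetric polynomial of degree \<open>d\<close> in
  \<open>x 0\<close>, ..., \<open>x (n - 1)\<close>; the integer index makes negative degrees
  vanish, as in the Jacobi-Trudi matrix.\<close>

definition chs :: "nat \<Rightarrow> (nat \<Rightarrow> 'a) \<Rightarrow> int \<Rightarrow> 'a :: comm_ring_1" where
  "chs n x d = (if d < 0 then 0 else fps_nth (\<Prod>i<n. geo (x i)) (nat d))"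

definition alternant :: "nat \<Rightarrow> (nat \<Rightarrow> 'a) \<Rightarrow> (nat \<Rightarrow> nat) \<Rightarrow> 'a :: comm_ring_1" where
  "alternant n x \<mu> = det (mat n n (\<lambda>(i, k). x k ^ \<mu> i))"

text \<open>Truncated subtraction yields 0 for all \<open>i \<ge> n\<close>, so adding the staircase
  to a weight does not enlarge its support beyond the indices below \<open>n\<close>.\<close>

definition staircase :: "nat \<Rightarrow> nat \<Rightarrow> nat" where
  "staircase n i = n - 1 - i"

definition root_poly :: "(nat \<Rightarrow> 'a) \<Rightarrow> nat set \<Rightarrow> 'a :: comm_ring_1 poly" where
  "root_poly x A = (\<Prod>i\<in>A. [:- x i, 1:])"

lemma geo_inverse: "(1 - fps_const a * fps_X) * geo a = 1"
proof (rule fps_ext)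
  fix d show "fps_nth ((1 - fps_const a * fps_X) * geo a) d = fps_nth 1 d"
    by (cases d) (simp_all add: geo_def algebra_simps)
qed

text \<open>The product of the 1 - x t is the reversal of the product of the t - x.\<close>

lemma fps_prod_linear_nth:
  fixes x :: "nat \<Rightarrow> 'a :: comm_ring_1"
  assumes "finite A"
  shows "fps_nth (\<Prod>i\<in>A. 1 - fps_const (x i) * fps_X) s =
    (if s \<le> card A then coeff (root_poly x A) (card A - s) else 0)"
  using assms
proof (induction A arbitrary: s rule: finite_induct)
  case (insert a A)
  let ?F = "\<Prod>i\<in>A. 1 - fps_const (x i) * fps_X"
  have Q: "root_poly x (insert a A) = [:- x a, 1:] * root_poly x A"
    using insert by (simp add: root_poly_def)
  have "degree (root_poly x A) \<le> card A"
    unfolding root_poly_def using degree_prod_sum_le[OF insert(1), of "\<lambda>i. [:- x i, 1:]"] by simp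
  then have deg: "coeff (root_poly x A) d = 0" if "d > card A" for d
    using that \<open>degree (root_poly x A) \<le> card A\<close> by (intro coeff_eq_0) (rule le_less_trans)
  have "fps_nth (\<Prod>i\<in>insert a A. 1 - fps_const (x i) * fps_X) s =
      fps_nth ?F s - x a * (if s = 0 then 0 else fps_nth ?F (s - 1))"
    using insert by (simp add: left_diff_distrib mult.assoc)
  then show ?case
    using insert deg[of "Suc (card A)"]
    by (cases s) (auto simp: Q Suc_diff_le coeff_pCons' Suc_diff_Suc not_le le_Suc_eq split: nat.splits)
qed (auto simp: root_poly_def)

text \<open>In the generating series of the complete symmetric polynomials all factors but the one
  of \<open>x k\<close> are cancelled by multiplying with the polynomial \<open>?P\<close>; what
  remains is the geometric series of \<open>x k\<close>.\<close>

lemma power_eq_sum_chs: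
  fixes x :: "nat \<Rightarrow> 'a :: comm_ring_1"
  assumes k: "k < n"
  shows "x k ^ m = (\<Sum>j<n. chs n x (int m - int n + 1 + int j) * coeff (root_poly x ({..<n} - {k})) j)"
proof -
  let ?A = "{..<n} - {k}"
  let ?P = "\<Prod>i\<in>?A. 1 - fps_const (x i) * fps_X"
  let ?H = "\<Prod>i<n. geo (x i)"
  have card: "card ?A = n - 1" using k by simp
  have "?P * ?H = geo (x k) * (\<Prod>i\<in>?A. (1 - fps_const (x i) * fps_X) * geo (x i))"
    using k by (simp add: prod.remove[of "{..<n}" k] prod.distrib mult_ac)
  also have "\<dots> = geo (x k)" by (simp add: geo_inverse)
  finally have "x k ^ m = fps_nth (?P * ?H) m" by (simp add: geo_def)
  also have "\<dots> = (\<Sum>s\<in>{0..m}. fps_nth ?P s * chs n x (int m - int s))"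
    by (auto simp: fps_mult_nth chs_def nat_diff_distrib' intro!: sum.cong)
  \<comment> \<open>The range is changed in two moves: beyond \<open>m\<close> the degree of
    \<open>chs\<close> is negative, and from \<open>n\<close> on the coefficients of
    \<open>?P\<close> vanish because its degree is \<open>n - 1\<close>.\<close>
  also have "\<dots> = (\<Sum>s\<in>{..<n} \<union> {0..m}. fps_nth ?P s * chs n x (int m - int s))"
    by (rule sum.mono_neutral_left) (auto simp: chs_def)
  also have "\<dots> = (\<Sum>s<n. fps_nth ?P s * chs n x (int m - int s))"
    using k by (intro sum.mono_neutral_right) (auto simp: fps_prod_linear_nth card)
  also have "\<dots> = (\<Sum>s<n. coeff (root_poly x ?A) (n - 1 - s) * chs n x (int m - int s))"
    by (intro sum.cong) (auto simp: fps_prod_linear_nth card)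
  also have "\<dots> = (\<Sum>j<n. chs n x (int m - int n + 1 + int j) * coeff (root_poly x ?A) j)"
    using k by (intro sum.reindex_bij_witness[of _ "\<lambda>j. n - 1 - j" "\<lambda>j. n - 1 - j"])
      (auto simp: of_nat_diff algebra_simps)
  finally show ?thesis .
qed

lemma chs_0 [simp]: "chs n x 0 = 1"
proof -
  have "fps_nth (\<Prod>i<k. geo (x i)) 0 = 1" for k
    by (induction k) (auto simp: geo_def)
  then show ?thesis by (simp add: chs_def)
qed

text \<open>By \<open>power_eq_sum_chs\<close> the matrix of powers factors through a matrix
  \<open>C\<close> that does not depend on the exponents. For the zero partition the other factor is
  unitriangular, which identifies \<open>det C\<close> as the Vandermonde determinant. No division
  occurs, so the points may coincide.\<close>

lemma Jacobi_Trudi_alternant: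
  fixes x :: "nat \<Rightarrow> 'a :: idom"
  shows "alternant n x (\<lambda>i. L i + staircase n i) =
    det (mat n n (\<lambda>(i, j). chs n x (int (L i) + int j - int i))) * alternant n x (staircase n)"
proof -
  define C where "C = mat n n (\<lambda>(j, k). coeff (root_poly x ({..<n} - {k})) j)"
  have fact: "alternant n x (\<lambda>i. M i + staircase n i) =
    det (mat n n (\<lambda>(i, j). chs n x (int (M i) + int j - int i))) * det C" for M
  proof -
    let ?G = "mat n n (\<lambda>(i, j). chs n x (int (M i) + int j - int i))"
    have "mat n n (\<lambda>(i, k). x k ^ (M i + staircase n i)) = ?G * C"
    proof (rule eq_matI)
      fix i k assume "i < dim_row (?G * C)" "k < dim_col (?G * C)"
      then have ik: "i < n" "k < n" by (auto simp: C_def)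
      have "x k ^ (M i + staircase n i) =
          (\<Sum>j<n. chs n x (int (M i + staircase n i) - int n + 1 + int j) * coeff (root_poly x ({..<n} - {k})) j)"
        by (rule power_eq_sum_chs[OF ik(2)])
      also have "\<dots> = (\<Sum>j<n. chs n x (int (M i) + int j - int i) * coeff (root_poly x ({..<n} - {k})) j)"
        using ik by (intro sum.cong refl arg_cong2[of _ _ _ _ times] arg_cong[where f = "chs n x"])
          (auto simp: staircase_def of_nat_diff)
      finally show "mat n n (\<lambda>(i, k). x k ^ (M i + staircase n i)) $$ (i, k) = (?G * C) $$ (i, k)"
        using ik by (simp add: C_def scalar_prod_def lessThan_atLeast0)
    qed (auto simp: C_def)
    then show ?thesis unfolding alternant_def by (simp add: det_mult[of _ n] C_def)
  qed
  let ?U = "mat n n (\<lambda>(i, j). chs n x (int j - int i))"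
  have "det ?U = prod_list (diag_mat ?U)"
    by (rule det_upper_triangular[of _ n]) (auto simp: upper_triangular_def chs_def)
  also have "diag_mat ?U = map (\<lambda>_. 1) [0..<n]"
    by (auto simp: diag_mat_def)
  finally have "det ?U = 1" by (simp add: map_replicate_const)
  then have "alternant n x (staircase n) = det C" using fact[of "\<lambda>_. 0"] by simp
  then show ?thesis by (simp add: fact)
qed

lemma poly_root_poly: "poly (root_poly x A) z = (\<Prod>i\<in>A. z - x i)"
  by (simp add: root_poly_def poly_prod)

text \<open>The rows of \<open>C\<close> contain the coefficients of the unnormalised Lagrange
  polynomials of the points, so \<open>C * V\<close> is diagonal with nonzero diagonal.\<close>

lemma Vandermonde_nonzero:
  fixes x :: "nat \<Rightarrow> 'a :: idom"
  assumes inj: "inj_on x {..<n}"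
  shows "alternant n x (staircase n) \<noteq> 0"
proof -
  define q where "q k = root_poly x ({..<n} - {k})" for k
  define V where "V = mat n n (\<lambda>(i, k). x k ^ staircase n i)"
  define C where "C = mat n n (\<lambda>(k, i). coeff (q k) (staircase n i))"
  have "C * V = mat n n (\<lambda>(k, l). poly (q k) (x l))"
  proof (rule eq_matI)
    fix k l assume "k < dim_row (mat n n (\<lambda>(k, l). poly (q k) (x l)))" "l < dim_col (mat n n (\<lambda>(k, l). poly (q k) (x l)))"
    then have kl: "k < n" "l < n" by auto
    have "degree (q k) \<le> n - 1"
      unfolding q_def root_poly_def
      using degree_prod_sum_le[of "{..<n} - {k}" "\<lambda>i. [:- x i, 1:]"] kl by simp
    then have "poly (q k) (x l) = (\<Sum>j\<le>n - 1. coeff (q k) j * x l ^ j)"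
      by (subst poly_altdef, intro sum.mono_neutral_left) (auto simp: coeff_eq_0)
    also have "{..n - 1} = {..<n}" using kl by auto
    also have "(\<Sum>j<n. coeff (q k) j * x l ^ j) = (\<Sum>i<n. coeff (q k) (staircase n i) * x l ^ staircase n i)"
      using kl by (intro sum.reindex_bij_witness[of _ "staircase n" "staircase n"]) (auto simp: staircase_def)
    finally show "(C * V) $$ (k, l) = mat n n (\<lambda>(k, l). poly (q k) (x l)) $$ (k, l)"
      using kl by (simp add: C_def V_def scalar_prod_def lessThan_atLeast0)
  qed (auto simp: C_def V_def)
  moreover have "det (mat n n (\<lambda>(k, l). poly (q k) (x l))) \<noteq> 0"
  proof -
    let ?D = "mat n n (\<lambda>(k, l). poly (q k) (x l))"
    have off: "poly (q k) (x l) = 0" if "l < n" "l \<noteq> k" for k l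
      using that by (auto simp: q_def poly_root_poly)
    have "det ?D = prod_list (diag_mat ?D)"
      by (rule det_upper_triangular[of _ n]) (use off in \<open>auto simp: upper_triangular_def\<close>)
    moreover have "poly (q k) (x k) \<noteq> 0" if "k < n" for k
      using that inj by (auto simp: q_def poly_root_poly inj_on_def)
    ultimately show ?thesis by (auto simp: diag_mat_def prod_list_zero_iff)
  qed
  ultimately show ?thesis
    using det_mult[of C n V] by (auto simp: alternant_def C_def V_def)
qed

lemma alternant_altdef:
  fixes x :: "nat \<Rightarrow> 'a :: comm_ring_1"
  shows "alternant n x \<mu> = (\<Sum>\<sigma> | \<sigma> permutes {..<n}. of_int (sign \<sigma>) * (\<Prod>k<n. x k ^ \<mu> (\<sigma> k)))"
proof -
  have "alternant n x \<mu> = det (transpose_mat (mat n n (\<lambda>(i, k). x k ^ \<mu> i)))"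
    unfolding alternant_def by (rule det_transpose[symmetric, of _ n]) simp
  also have "transpose_mat (mat n n (\<lambda>(i, k). x k ^ \<mu> i)) = mat n n (\<lambda>(k, i). x k ^ \<mu> i)"
    by (rule eq_matI) auto
  also have "det \<dots> = (\<Sum>\<sigma> | \<sigma> permutes {0..<n}. of_int (sign \<sigma>) * (\<Prod>k=0..<n. x k ^ \<mu> (\<sigma> k)))"
    by (subst det_def'[of _ n]) (auto intro!: sum.cong arg_cong2[of _ _ _ _ times] prod.cong simp: permutes_in_image)
  finally show ?thesis by (simp add: lessThan_atLeast0)
qed

text \<open>Seen as a polynomial in \<open>x\<^sub>k\<close>, the Vandermonde determinant is a constant multiple of
  \<open>\<Prod>\<^bsub>l \<noteq> k\<^esub> (z - x\<^sub>l)\<close>; the left-hand side is its Euler derivative.\<close>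

lemma Vandermonde_euler_derivative:
  fixes x :: "nat \<Rightarrow> 'a :: field_char_0"
  assumes inj: "inj_on x {..<n}" and k: "k < n"
  shows "(\<Sum>\<sigma> | \<sigma> permutes {..<n}. of_int (sign \<sigma>) * of_nat (staircase n (\<sigma> k)) * (\<Prod>l<n. x l ^ staircase n (\<sigma> l))) =
    alternant n x (staircase n) * (\<Sum>l\<in>{..<n} - {k}. x k / (x k - x l))"
proof -
  let ?S = "{\<sigma>. \<sigma> permutes {..<n}}"
  let ?A = "{..<n} - {k}"
  define c where "c \<sigma> = of_int (sign \<sigma>) * (\<Prod>l\<in>?A. x l ^ staircase n (\<sigma> l))" for \<sigma>
  define p where "p = (\<Sum>\<sigma>\<in>?S. monom (c \<sigma>) (staircase n (\<sigma> k)))"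
  define q where "q = root_poly x ?A"
  define v where "v = alternant n x (staircase n)"
  have p_alt: "poly p z = alternant n (x(k := z)) (staircase n)" for z
  proof -
    have "alternant n (x(k := z)) (staircase n) = (\<Sum>\<sigma>\<in>?S. of_int (sign \<sigma>) *
        (z ^ staircase n (\<sigma> k) * (\<Prod>l\<in>?A. x l ^ staircase n (\<sigma> l))))"
      unfolding alternant_altdef using k
      by (intro sum.cong refl) (simp add: prod.remove[of "{..<n}" k])
    then show ?thesis by (simp add: p_def poly_sum poly_monom c_def mult_ac)
  qed
  have pk: "poly p (x k) = v" by (simp add: p_alt v_def)
  have pl: "poly p (x l) = 0" if "l \<in> ?A" for l
  proof -
    let ?M = "mat n n (\<lambda>(i, j). (x(k := x l)) j ^ staircase n i)"
    have "det ?M = 0"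
    proof (rule det_identical_columns)
      show "?M \<in> carrier_mat n n" by simp
      show "k \<noteq> l" "k < n" "l < n" using that k by auto
      show "col ?M k = col ?M l" using that k by (intro eq_vecI) auto
    qed
    then show ?thesis by (simp add: p_alt alternant_def)
  qed
  have degq: "degree q \<le> n - 1"
    unfolding q_def root_poly_def using degree_prod_sum_le[of ?A "\<lambda>i. [:- x i, 1:]"] k by simp
  have degp: "degree p \<le> n - 1"
    unfolding p_def by (intro degree_sum_le order.trans[OF degree_monom_le])
      (auto simp: staircase_def finite_permutations)
  \<comment> \<open>Proportionality of \<open>p\<close> and \<open>q\<close> without division:
    \<open>r\<close> has degree at most \<open>n - 1\<close> and vanishes at the \<open>n\<close>
    distinct points.\<close>
  define r where "r = smult (poly q (x k)) p - smult v q"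
  have "degree r \<le> n - 1"
    unfolding r_def by (intro degree_diff_le order.trans[OF degree_smult_le] degp degq)
  have "r = 0"
  proof (rule ccontr)
    assume "r \<noteq> 0"
    have "x ` {..<n} \<subseteq> {z. poly r z = 0}"
    proof
      fix z assume "z \<in> x ` {..<n}"
      then obtain l where l: "l < n" "z = x l" by auto
      show "z \<in> {z. poly r z = 0}"
        using l pk pl[of l] by (cases "l = k") (auto simp: r_def q_def poly_root_poly)
    qed
    then have "card (x ` {..<n}) \<le> card {z. poly r z = 0}"
      by (rule card_mono[OF poly_roots_finite[OF \<open>r \<noteq> 0\<close>]])
    also have "\<dots> \<le> degree r" by (rule poly_roots_degree[OF \<open>r \<noteq> 0\<close>])
    finally show False using \<open>degree r \<le> n - 1\<close> k inj by (simp add: card_image)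
  qed
  then have "smult (poly q (x k)) p = smult v q" by (simp add: r_def)
  then have "poly (pderiv (smult (poly q (x k)) p)) (x k) = poly (pderiv (smult v q)) (x k)" by simp
  then have e: "poly q (x k) * poly (pderiv p) (x k) = v * poly (pderiv q) (x k)"
    by (simp add: pderiv_smult)
  have qk: "poly q (x k) \<noteq> 0"
    using inj k by (auto simp: q_def poly_root_poly inj_on_def)
  have "poly (pderiv q) (x k) = (\<Sum>l\<in>?A. \<Prod>i\<in>?A - {l}. x k - x i)"
    by (simp add: q_def root_poly_def pderiv_prod poly_sum poly_prod pderiv_pCons)
  also have "\<dots> = (\<Sum>l\<in>?A. poly q (x k) / (x k - x l))"
  proof (rule sum.cong)
    fix l assume l: "l \<in> ?A"
    then have "x k - x l \<noteq> 0" using inj k by (auto simp: inj_on_def)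
    then show "(\<Prod>i\<in>?A - {l}. x k - x i) = poly q (x k) / (x k - x l)"
      using l by (simp add: q_def poly_root_poly prod.remove[of ?A l])
  qed simp
  finally have "poly (pderiv q) (x k) = poly q (x k) * (\<Sum>l\<in>?A. 1 / (x k - x l))"
    by (simp add: sum_distrib_left)
  with e qk have d: "poly (pderiv p) (x k) = v * (\<Sum>l\<in>?A. 1 / (x k - x l))" by simp
  have "x k * poly (pderiv p) (x k) = (\<Sum>\<sigma>\<in>?S. x k * poly (pderiv (monom (c \<sigma>) (staircase n (\<sigma> k)))) (x k))"
    by (simp add: p_def pderiv_sum poly_sum sum_distrib_left)
  also have "\<dots> = (\<Sum>\<sigma>\<in>?S. of_int (sign \<sigma>) * of_nat (staircase n (\<sigma> k)) * (\<Prod>l<n. x l ^ staircase n (\<sigma> l)))"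
  proof (rule sum.cong)
    fix \<sigma>
    have "x k * poly (pderiv (monom (c \<sigma>) (staircase n (\<sigma> k)))) (x k) =
        of_nat (staircase n (\<sigma> k)) * (c \<sigma> * x k ^ staircase n (\<sigma> k))"
      by (cases "staircase n (\<sigma> k)") (auto simp: pderiv_monom poly_monom mult_ac)
    then show "x k * poly (pderiv (monom (c \<sigma>) (staircase n (\<sigma> k)))) (x k) =
        of_int (sign \<sigma>) * of_nat (staircase n (\<sigma> k)) * (\<Prod>l<n. x l ^ staircase n (\<sigma> l))"
      using k by (simp add: c_def prod.remove[of "{..<n}" k] mult_ac)
  qed simp
  finally show ?thesis
    unfolding d by (simp add: v_def sum_distrib_left mult_ac)
qed

section \<open>Polynomial representations and their differentials\<close>

lemma GL_iff_det: "g \<in> GL n \<longleftrightarrow> g \<in> carrier_mat n n \<and> det (g :: 'a :: field mat) \<noteq> 0"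
proof
  assume "g \<in> GL n"
  then obtain B where g: "g \<in> carrier_mat n n" and B: "g * B = 1\<^sub>m (dim_row g)" "B * g = 1\<^sub>m (dim_row B)"
    by (auto simp: GL_def invertible_mat_def inverts_mat_def)
  have "dim_col B = dim_col (g * B)" "dim_col g = dim_col (B * g)" by simp_all
  then have "B \<in> carrier_mat n n" unfolding B using g by auto
  then have "det g * det B = 1" using det_mult[of g n B] B g by simp
  with g show "g \<in> carrier_mat n n \<and> det g \<noteq> 0" by auto
next
  assume g: "g \<in> carrier_mat n n \<and> det g \<noteq> 0"
  let ?B = "(1 / det g) \<cdot>\<^sub>m adj_mat g"
  have B: "?B \<in> carrier_mat n n" using g adj_mat(1)[of g n] by auto
  have "g * ?B = 1\<^sub>m n" "?B * g = 1\<^sub>m n"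
    using g adj_mat[of g n] mult_smult_distrib[of g n n "adj_mat g" n "1 / det g"]
      mult_smult_assoc_mat[of "adj_mat g" n n g n "1 / det g"]
    by (auto intro!: eq_matI)
  with g B show "g \<in> GL n"
    unfolding GL_def invertible_mat_def inverts_mat_def by auto
qed

lemma GL_inverse:
  assumes "g \<in> GL n"
  obtains h where "h \<in> GL n" "g * h = 1\<^sub>m n" "h * g = (1\<^sub>m n :: 'a :: field mat)"
proof -
  from assms obtain B where g: "g \<in> carrier_mat n n" and B: "g * B = 1\<^sub>m (dim_row g)" "B * g = 1\<^sub>m (dim_row B)"
    by (auto simp: GL_def invertible_mat_def inverts_mat_def)
  have "dim_col B = dim_col (g * B)" "dim_col g = dim_col (B * g)" by simp_all
  then have Bc: "B \<in> carrier_mat n n" unfolding B using g by auto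
  then have "det g * det B = 1" using det_mult[of g n B] B g by simp
  then have "B \<in> GL n" using Bc by (auto simp: GL_iff_det)
  with that B Bc g show ?thesis by auto
qed

lemma GL_one: "1\<^sub>m n \<in> GL n" by (simp add: GL_iff_det)

lemma GL_mult: "g \<in> GL n \<Longrightarrow> h \<in> GL n \<Longrightarrow> g * h \<in> GL n"
  using det_mult[of g n h] by (auto simp: GL_iff_det)

definition elem :: "nat \<Rightarrow> nat \<Rightarrow> nat \<Rightarrow> 'r :: {zero, one} mat" where
  "elem n k l = mat n n (\<lambda>(i, j). if i = k \<and> j = l then 1 else 0)"

definition dg :: "nat \<Rightarrow> (nat \<Rightarrow> 'r) \<Rightarrow> 'r :: zero mat" where
  "dg n t = mat n n (\<lambda>(i, j). if i = j then t i else 0)"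

definition msum :: "nat \<Rightarrow> 'i set \<Rightarrow> ('i \<Rightarrow> 'r mat) \<Rightarrow> 'r :: comm_monoid_add mat" where
  "msum m S f = mat m m (\<lambda>(a, b). \<Sum>i\<in>S. f i $$ (a, b))"

definition const_mat :: "'r mat \<Rightarrow> 'r :: zero poly mat" where
  "const_mat A = map_mat (\<lambda>c. [:c:]) A"

definition lin :: "nat \<Rightarrow> 'r mat \<Rightarrow> 'r :: comm_ring_1 poly mat" where
  "lin n A = mat n n (\<lambda>(i, j). [:if i = j then 1 else 0, A $$ (i, j):])"

definition ev_mat :: "'r \<Rightarrow> 'r poly mat \<Rightarrow> 'r :: comm_semiring_0 mat" where
  "ev_mat s F = map_mat (\<lambda>p. poly p s) F"

definition coeff_mat :: "nat \<Rightarrow> 'r poly mat \<Rightarrow> 'r :: zero mat" where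
  "coeff_mat k F = map_mat (\<lambda>p. coeff p k) F"

lemma elem_carrier [simp]: "elem n k l \<in> carrier_mat n n" by (simp add: elem_def)
lemma elem_dim [simp]: "dim_row (elem n k l) = n" "dim_col (elem n k l) = n" by (simp_all add: elem_def)
lemma dg_carrier [simp]: "dg n t \<in> carrier_mat n n" by (simp add: dg_def)
lemma msum_carrier [simp]: "msum m S f \<in> carrier_mat m m" by (simp add: msum_def)
lemma lin_carrier [simp]: "lin n A \<in> carrier_mat n n" by (simp add: lin_def)
lemma const_mat_carrier [simp]: "const_mat A \<in> carrier_mat n m \<longleftrightarrow> A \<in> carrier_mat n m"
  by (auto simp: const_mat_def)
lemma ev_mat_carrier [simp]: "ev_mat s A \<in> carrier_mat n m \<longleftrightarrow> A \<in> carrier_mat n m"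
  by (auto simp: ev_mat_def)
lemma coeff_mat_carrier [simp]: "coeff_mat s A \<in> carrier_mat n m \<longleftrightarrow> A \<in> carrier_mat n m"
  by (auto simp: coeff_mat_def)

lemma mult_mat_index:
  assumes "A \<in> carrier_mat n k" "B \<in> carrier_mat k m" "i < n" "j < m"
  shows "(A * B) $$ (i, j) = (\<Sum>l<k. A $$ (i, l) * B $$ (l, j))"
  using assms by (simp add: scalar_prod_def lessThan_atLeast0)

lemma mult_mat_vec_index:
  assumes "A \<in> carrier_mat n k" "v \<in> carrier_vec k" "i < n"
  shows "(A *\<^sub>v v) $ i = (\<Sum>l<k. A $$ (i, l) * v $ l)"
  using assms by (simp add: scalar_prod_def lessThan_atLeast0)

lemma poly_comm_ring_hom: "comm_ring_hom (\<lambda>p. poly p (s :: 'r :: comm_ring_1))"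
  by unfold_locales auto

lemma const_poly_comm_ring_hom: "comm_ring_hom (\<lambda>c :: 'r :: comm_ring_1. [:c:])"
  by unfold_locales (auto simp: one_pCons)

lemma poly_semiring_hom: "semiring_hom (\<lambda>p. poly p (s :: 'r :: comm_ring_1))"
  by unfold_locales auto

lemma ev_mat_mult:
  assumes "F \<in> carrier_mat n k" "G \<in> carrier_mat k m"
  shows "ev_mat s (F * G) = ev_mat s F * ev_mat s (G :: 'r :: comm_ring_1 poly mat)"
  unfolding ev_mat_def by (rule semiring_hom.mat_hom_mult[OF poly_semiring_hom assms])

lemma det_ev_mat: "det (ev_mat s F) = poly (det F) (s :: 'r :: comm_ring_1)"
  unfolding ev_mat_def by (rule comm_ring_hom.hom_det[OF poly_comm_ring_hom])

lemma ev_const_mat [simp]: "ev_mat s (const_mat A) = A"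
  by (rule eq_matI) (auto simp: ev_mat_def const_mat_def)

text \<open>The product rule, with the coefficient of degree one as derivative at 0.\<close>

lemma coeff_1_mult:
  assumes "F \<in> carrier_mat n k" "G \<in> carrier_mat k m"
  shows "coeff_mat (Suc 0) (F * G) =
    coeff_mat 0 F * coeff_mat (Suc 0) G + coeff_mat (Suc 0) F * coeff_mat 0 (G :: 'r :: comm_ring_1 poly mat)"
proof -
  have "coeff (p * q) 1 = coeff p 0 * coeff q 1 + coeff p 1 * coeff q 0" for p q :: "'r poly"
    by (simp add: coeff_mult)
  then show ?thesis
    using assms by (intro eq_matI) (auto simp: coeff_mat_def scalar_prod_def coeff_sum sum.distrib)
qed

lemma lin_ev: "ev_mat s (lin n A) = 1\<^sub>m n + s \<cdot>\<^sub>m (A :: 'r :: comm_ring_1 mat)" if "A \<in> carrier_mat n n"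
  using that by (intro eq_matI) (auto simp: ev_mat_def lin_def)

lemma det_lin_nonzero:
  assumes "A \<in> carrier_mat n n"
  shows "det (lin n (A :: 'r :: comm_ring_1 mat)) \<noteq> 0"
proof
  assume "det (lin n A) = 0"
  then have "poly (det (lin n A)) 0 = 0" by simp
  also have "poly (det (lin n A)) 0 = det (1\<^sub>m n + 0 \<cdot>\<^sub>m A)"
    by (simp only: det_ev_mat[symmetric] lin_ev[OF assms])
  also have "1\<^sub>m n + 0 \<cdot>\<^sub>m A = 1\<^sub>m n" using assms by (intro eq_matI) auto
  finally show False by simp
qed

lemma mult_msum:
  assumes "A \<in> carrier_mat m m" "\<And>i. i \<in> S \<Longrightarrow> f i \<in> carrier_mat m m"
  shows "A * msum m S f = msum m S (\<lambda>i. A * f i :: 'r :: comm_semiring_0 mat)"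
proof (rule eq_matI)
  fix a b assume "a < dim_row (msum m S (\<lambda>i. A * f i))" "b < dim_col (msum m S (\<lambda>i. A * f i))"
  then have ab: "a < m" "b < m" by (auto simp: msum_def)
  have "(A * msum m S f) $$ (a, b) = (\<Sum>k<m. \<Sum>i\<in>S. A $$ (a, k) * f i $$ (k, b))"
    using assms ab by (subst mult_mat_index[of _ m m _ m]) (auto simp: msum_def sum_distrib_left)
  also have "\<dots> = (\<Sum>i\<in>S. \<Sum>k<m. A $$ (a, k) * f i $$ (k, b))" by (rule sum.swap)
  also have "\<dots> = (\<Sum>i\<in>S. (A * f i) $$ (a, b))"
    using assms ab by (intro sum.cong refl, subst mult_mat_index[of _ m m _ m]) auto
  finally show "(A * msum m S f) $$ (a, b) = msum m S (\<lambda>i. A * f i) $$ (a, b)"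
    using ab by (simp add: msum_def)
qed (use assms in \<open>auto simp: msum_def\<close>)

lemma msum_mult:
  assumes "A \<in> carrier_mat m m" "\<And>i. i \<in> S \<Longrightarrow> f i \<in> carrier_mat m m"
  shows "msum m S f * A = msum m S (\<lambda>i. f i * A :: 'r :: comm_semiring_0 mat)"
proof (rule eq_matI)
  fix a b assume "a < dim_row (msum m S (\<lambda>i. f i * A))" "b < dim_col (msum m S (\<lambda>i. f i * A))"
  then have ab: "a < m" "b < m" by (auto simp: msum_def)
  have "(msum m S f * A) $$ (a, b) = (\<Sum>k<m. \<Sum>i\<in>S. f i $$ (a, k) * A $$ (k, b))"
    using assms ab by (subst mult_mat_index[of _ m m _ m]) (auto simp: msum_def sum_distrib_right)
  also have "\<dots> = (\<Sum>i\<in>S. \<Sum>k<m. f i $$ (a, k) * A $$ (k, b))" by (rule sum.swap)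
  also have "\<dots> = (\<Sum>i\<in>S. (f i * A) $$ (a, b))"
    using assms ab by (intro sum.cong refl, subst mult_mat_index[of _ m m _ m]) auto
  finally show "(msum m S f * A) $$ (a, b) = msum m S (\<lambda>i. f i * A) $$ (a, b)"
    using ab by (simp add: msum_def)
qed (use assms in \<open>auto simp: msum_def\<close>)

lemma msum_cong: "(\<And>i. i \<in> S \<Longrightarrow> f i = g i) \<Longrightarrow> msum m S f = msum m S g"
  by (simp add: msum_def cong: sum.cong)

lemma msum_swap: "msum m S (\<lambda>i. msum m T (f i)) = msum m T (\<lambda>j. msum m S (\<lambda>i. f i j))"
  by (rule eq_matI) (auto simp: msum_def intro: sum.swap)

text \<open>Congruence modulo the square of the variable, that is, equality over the dual
  numbers.\<close>

definition coeff01_eq :: "'r :: zero poly \<Rightarrow> 'r poly \<Rightarrow> bool" where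
  "coeff01_eq p q \<longleftrightarrow> coeff p 0 = coeff q 0 \<and> coeff p 1 = coeff q 1"

lemma coeff01_eq_refl [simp]: "coeff01_eq p p" by (simp add: coeff01_eq_def)

lemma coeff01_eq_add: "coeff01_eq p q \<Longrightarrow> coeff01_eq p' q' \<Longrightarrow> coeff01_eq (p + p') (q + q' :: 'r :: comm_ring_1 poly)"
  by (simp add: coeff01_eq_def)

lemma coeff01_eq_mult: "coeff01_eq p q \<Longrightarrow> coeff01_eq p' q' \<Longrightarrow> coeff01_eq (p * p') (q * q' :: 'r :: comm_ring_1 poly)"
  by (simp add: coeff01_eq_def coeff_mult)

lemma coeff01_eq_mp_ev:
  fixes x y :: "'v \<Rightarrow> 'r :: comm_ring_1 poly"
  assumes "\<And>v. coeff01_eq (x v) (y v)"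
  shows "coeff01_eq (mp_ev \<phi> x p) (mp_ev \<phi> y p)"
proof -
  have pow: "coeff01_eq (x v ^ k) (y v ^ k)" for v k
    by (induction k) (auto intro: coeff01_eq_mult assms)
  have prod: "coeff01_eq (\<Prod>v\<in>A. x v ^ f v) (\<Prod>v\<in>A. y v ^ f v)" for A f
    by (induction A rule: infinite_finite_induct) (auto intro: coeff01_eq_mult pow)
  have "coeff01_eq (\<Sum>\<alpha>\<in>A. \<phi> (f \<alpha>) * mp_mon x \<alpha>) (\<Sum>\<alpha>\<in>A. \<phi> (f \<alpha>) * mp_mon y \<alpha>)" for A f
    by (induction A rule: infinite_finite_induct)
      (auto intro!: coeff01_eq_add coeff01_eq_mult simp: mp_mon_def prod)
  then show ?thesis by (simp add: mp_ev_def)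
qed

definition mat_vars :: "nat \<Rightarrow> 'r mat \<Rightarrow> nat \<times> nat \<Rightarrow> 'r :: zero" where
  "mat_vars n g = (\<lambda>(i, j). if i < n \<and> j < n then g $$ (i, j) else 0)"

text \<open>\<open>P\<close> is a fixed choice of polynomials for the matrix entries. It is tied to
  \<open>\<rho>\<close> on \<open>GL n\<close> only; identities at other arguments have to be
  derived by density.\<close>

locale polyrep =
  fixes n m :: nat and \<rho> :: "'a :: field_char_0 mat \<Rightarrow> 'a mat" and P :: "nat \<Rightarrow> nat \<Rightarrow> (nat \<times> nat, 'a) mpoly"
  assumes rep: "representation n m \<rho>"
    and P: "\<And>a b g. a < m \<Longrightarrow> b < m \<Longrightarrow> g \<in> GL n \<Longrightarrow> \<rho> g $$ (a, b) = mp_eval (mat_vars n g) (P a b)"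
begin

text \<open>The extension of the representation to all square matrices over a
  \<open>K\<close>-algebra with structure map \<open>\<phi>\<close>, singular matrices
  included.\<close>

definition ext :: "('a \<Rightarrow> 'r) \<Rightarrow> 'r :: comm_ring_1 mat \<Rightarrow> 'r mat" where
  "ext \<phi> g = mat m m (\<lambda>(a, b). mp_ev \<phi> (mat_vars n g) (P a b))"

abbreviation cext :: "'a poly mat \<Rightarrow> 'a poly mat" where "cext \<equiv> ext (\<lambda>c. [:c:])"

text \<open>The differential of \<open>\<rho>\<close> at the identity, as the coefficient of s in
  the image of 1 + s A.\<close>

definition e :: "'a mat \<Rightarrow> 'a mat" where "e A = coeff_mat (Suc 0) (cext (lin n A))"

lemma ext_carrier [simp]: "ext \<phi> g \<in> carrier_mat m m" by (simp add: ext_def)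
lemma e_carrier [simp]: "e A \<in> carrier_mat m m" by (simp add: e_def)
lemma e_dim [simp]: "dim_row (e A) = m" "dim_col (e A) = m" by (simp_all add: e_def ext_def coeff_mat_def)
lemma ext_dim [simp]: "dim_row (ext \<phi> A) = m" "dim_col (ext \<phi> A) = m" by (simp_all add: ext_def)
lemma \<rho>_carrier: "g \<in> GL n \<Longrightarrow> \<rho> g \<in> carrier_mat m m" using rep by (simp add: representation_def)
lemma \<rho>_mult: "g \<in> GL n \<Longrightarrow> h \<in> GL n \<Longrightarrow> \<rho> (g * h) = \<rho> g * \<rho> h" using rep by (simp add: representation_def)
lemma \<rho>_one: "\<rho> (1\<^sub>m n) = 1\<^sub>m m" using rep by (simp add: representation_def)

lemma ext_natural:
  assumes "comm_ring_hom \<psi>" "g \<in> carrier_mat n n"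
  shows "map_mat \<psi> (ext \<phi> g) = ext (\<lambda>c. \<psi> (\<phi> c)) (map_mat \<psi> g)"
proof -
  interpret comm_ring_hom \<psi> by fact
  have "(\<lambda>v. \<psi> (mat_vars n g v)) = mat_vars n (map_mat \<psi> g)"
    using assms(2) by (auto simp: mat_vars_def fun_eq_iff)
  then show ?thesis by (intro eq_matI) (auto simp: ext_def mp_ev_natural[OF assms(1)])
qed

lemma ext_id: "g \<in> GL n \<Longrightarrow> ext (\<lambda>c. c) g = \<rho> g"
  using \<rho>_carrier[of g] by (intro eq_matI) (auto simp: ext_def P mp_eval_eq_mp_ev)

lemma ev_cext: "\<gamma> \<in> carrier_mat n n \<Longrightarrow> ev_mat s (cext \<gamma>) = ext (\<lambda>c. c) (ev_mat s \<gamma>)"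
  using ext_natural[OF poly_comm_ring_hom, of \<gamma> s "\<lambda>c. [:c:]"] by (simp add: ev_mat_def)

lemma cext_const: "g \<in> GL n \<Longrightarrow> cext (const_mat g) = const_mat (\<rho> g)"
  using ext_natural[OF const_poly_comm_ring_hom, of g "\<lambda>c. c"] by (simp add: const_mat_def ext_id GL_iff_det)

text \<open>At every value of the parameter for which both matrices are invertible this is
  multiplicativity of \<open>\<rho>\<close>. The factor \<open>det \<gamma> * det \<eta>\<close>
  disposes of the remaining values, and it can be cancelled because it is a nonzero
  polynomial.\<close>

lemma cext_mult:
  assumes c: "\<gamma> \<in> carrier_mat n n" "\<eta> \<in> carrier_mat n n" and d: "det \<gamma> \<noteq> 0" "det \<eta> \<noteq> 0"
  shows "cext (\<gamma> * \<eta>) = cext \<gamma> * cext \<eta>"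
proof (rule eq_matI)
  fix a b assume "a < dim_row (cext \<gamma> * cext \<eta>)" "b < dim_col (cext \<gamma> * cext \<eta>)"
  then have ab: "a < m" "b < m" by (auto simp: ext_def)
  let ?p = "cext (\<gamma> * \<eta>) $$ (a, b)" and ?q = "(cext \<gamma> * cext \<eta>) $$ (a, b)"
  let ?r = "(?p - ?q) * (det \<gamma> * det \<eta>)"
  have "poly ?r s = 0" for s
  proof (cases "poly (det \<gamma>) s = 0 \<or> poly (det \<eta>) s = 0")
    case False
    then have GL: "ev_mat s \<gamma> \<in> GL n" "ev_mat s \<eta> \<in> GL n"
      using c by (auto simp: GL_iff_det det_ev_mat)
    have "ev_mat s (cext (\<gamma> * \<eta>)) = \<rho> (ev_mat s \<gamma> * ev_mat s \<eta>)"
      using c GL by (simp add: ev_cext ev_mat_mult[of _ n n _ n] ext_id GL_mult)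
    also have "\<dots> = ev_mat s (cext \<gamma> * cext \<eta>)"
      using c GL by (simp add: \<rho>_mult ev_mat_mult[of _ m m _ m] ev_cext ext_id)
    finally have "ev_mat s (cext (\<gamma> * \<eta>)) $$ (a, b) = ev_mat s (cext \<gamma> * cext \<eta>) $$ (a, b)" by simp
    then have "poly ?p s = poly ?q s" using ab by (simp add: ev_mat_def ext_def)
    then show ?thesis by simp
  qed auto
  then have "?r = 0" using poly_all_0_iff_0[of ?r] by blast
  with d show "?p = ?q" by simp
qed (auto simp: ext_def)

lemma coeff_0_cext:
  assumes "\<gamma> \<in> carrier_mat n n" "ev_mat 0 \<gamma> = g" "g \<in> GL n"
  shows "coeff_mat 0 (cext \<gamma>) = \<rho> g"
proof -
  have "coeff_mat 0 (cext \<gamma>) = ev_mat 0 (cext \<gamma>)"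
    by (simp add: coeff_mat_def ev_mat_def poly_0_coeff_0)
  then show ?thesis using assms by (simp add: ev_cext ext_id)
qed

lemma lin_ev_0: "A \<in> carrier_mat n n \<Longrightarrow> ev_mat 0 (lin n A) = (1\<^sub>m n :: 'a mat)"
  by (subst lin_ev) (auto intro!: eq_matI)

lemma coeff_0_lin: "A \<in> carrier_mat n n \<Longrightarrow> coeff_mat 0 (cext (lin n A)) = 1\<^sub>m m"
  by (subst coeff_0_cext[of _ "1\<^sub>m n"]) (auto simp: lin_ev_0 GL_one \<rho>_one)

lemma coeff_1_cext:
  assumes "\<gamma> \<in> carrier_mat n n" "A \<in> carrier_mat n n"
    "\<And>i j. i < n \<Longrightarrow> j < n \<Longrightarrow> coeff01_eq (\<gamma> $$ (i, j)) [:if i = j then 1 else 0, A $$ (i, j):]"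
  shows "coeff_mat (Suc 0) (cext \<gamma>) = e A"
proof -
  have "coeff01_eq (mat_vars n \<gamma> v) (mat_vars n (lin n A) v)" for v
    using assms by (cases v) (auto simp: mat_vars_def lin_def)
  then have "coeff01_eq (mp_ev \<phi> (mat_vars n \<gamma>) p) (mp_ev \<phi> (mat_vars n (lin n A)) p)" for \<phi> p
    by (rule coeff01_eq_mp_ev)
  then show ?thesis by (intro eq_matI) (auto simp: e_def ext_def coeff_mat_def coeff01_eq_def)
qed

text \<open>Modulo s^2 the product of 1 + s A and 1 + s B is 1 + s (A + B); multiplicativity and the
  product rule do the rest.\<close>

lemma e_add:
  assumes A: "A \<in> carrier_mat n n" and B: "B \<in> carrier_mat n n"
  shows "e (A + B) = e A + e B"
proof -
  have "coeff_mat (Suc 0) (cext (lin n A * lin n B)) = e (A + B)"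
  proof (rule coeff_1_cext)
    fix i j assume ij: "i < n" "j < n"
    define p where "p = (\<Sum>l<n. [:if i = l then 1 else 0, A $$ (i, l):] * [:if l = j then 1 else 0, B $$ (l, j):])"
    have "(lin n A * lin n B) $$ (i, j) = p"
      unfolding p_def using A B ij by (subst mult_mat_index[of _ n n _ n]) (auto simp: lin_def)
    moreover have "coeff p 0 = (\<Sum>l<n. if i = l then if l = j then 1 else 0 else 0)"
      unfolding p_def coeff_sum by (intro sum.cong refl) (auto simp: coeff_mult)
    moreover have "coeff p 1 = (\<Sum>l<n. (if i = l then B $$ (l, j) else 0) + (if j = l then A $$ (i, l) else 0))"
      unfolding p_def coeff_sum by (intro sum.cong refl) (auto simp: coeff_mult)
    ultimately show "coeff01_eq ((lin n A * lin n B) $$ (i, j)) [:if i = j then 1 else 0, (A + B) $$ (i, j):]"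
      using A B ij by (auto simp: coeff01_eq_def sum.distrib)
  qed (use A B in \<open>auto intro: mult_carrier_mat[of _ n n]\<close>)
  also have "cext (lin n A * lin n B) = cext (lin n A) * cext (lin n B)"
    using A B by (intro cext_mult det_lin_nonzero) auto
  also have "coeff_mat (Suc 0) \<dots> = e A + e B"
    using A B by (subst coeff_1_mult[of _ m m _ m])
      (auto simp: coeff_0_lin e_def[symmetric] comm_add_mat[of _ m m]
        left_mult_one_mat[OF e_carrier] right_mult_one_mat[OF e_carrier])
  finally show ?thesis ..
qed

text \<open>The substitution of c s for s is a ring homomorphism, and it multiplies the coefficient
  of s by c.\<close>

lemma e_smult:
  assumes A: "A \<in> carrier_mat n n"
  shows "e (c \<cdot>\<^sub>m A) = c \<cdot>\<^sub>m e A"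
proof -
  have hom: "comm_ring_hom (\<lambda>p :: 'a poly. pcompose p [:0, c:])"
    by unfold_locales (auto simp: pcompose_add pcompose_mult)
  have "lin n (c \<cdot>\<^sub>m A) = map_mat (\<lambda>p. pcompose p [:0, c:]) (lin n A)"
    using A by (intro eq_matI) (auto simp: lin_def pcompose_pCons)
  then have "cext (lin n (c \<cdot>\<^sub>m A)) = map_mat (\<lambda>p. pcompose p [:0, c:]) (cext (lin n A))"
    using ext_natural[OF hom, of "lin n A" "\<lambda>c. [:c:]"] by simp
  then show ?thesis
    by (intro eq_matI) (auto simp: e_def coeff_mat_def coeff_pcompose_linear ext_def)
qed

abbreviation E :: "nat \<Rightarrow> nat \<Rightarrow> 'a mat" where "E k l \<equiv> e (elem n k l)"

lemma e_expand:
  assumes A: "A \<in> carrier_mat n n"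
  shows "e A = msum m ({..<n} \<times> {..<n}) (\<lambda>(k, l). A $$ (k, l) \<cdot>\<^sub>m E k l)"
proof -
  define R where "R S = mat n n (\<lambda>(i, j). if (i, j) \<in> S then A $$ (i, j) else 0)" for S
  have "e (R S) = msum m S (\<lambda>(k, l). A $$ (k, l) \<cdot>\<^sub>m E k l)" if "finite S" for S
    using that
  proof (induction S rule: finite_induct)
    case empty
    have "R {} = 0 \<cdot>\<^sub>m R {}" by (intro eq_matI) (auto simp: R_def)
    then have "e (R {}) = 0 \<cdot>\<^sub>m e (R {})" using e_smult[of "R {}" 0] by (simp add: R_def)
    moreover have "0 \<cdot>\<^sub>m e (R {}) = 0\<^sub>m m m" using e_carrier[of "R {}"] by (intro eq_matI) (auto simp del: e_carrier)
    ultimately show ?case by (auto simp: msum_def intro!: eq_matI)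
  next
    case (insert s S)
    obtain k l where s: "s = (k, l)" by force
    have "R (insert s S) = A $$ (k, l) \<cdot>\<^sub>m elem n k l + R S"
      using insert by (intro eq_matI) (auto simp: R_def elem_def s)
    then have "e (R (insert s S)) = A $$ (k, l) \<cdot>\<^sub>m E k l + e (R S)"
      by (simp add: e_add e_smult R_def)
    then show ?case using insert e_carrier[of "elem n k l"]
      by (intro eq_matI) (auto simp: msum_def s)
  qed
  then have "e (R ({..<n} \<times> {..<n})) = msum m ({..<n} \<times> {..<n}) (\<lambda>(k, l). A $$ (k, l) \<cdot>\<^sub>m E k l)" by simp
  also have "R ({..<n} \<times> {..<n}) = A" using A by (intro eq_matI) (auto simp: R_def)
  finally show ?thesis .
qed

end

lemma sum_pCons2: "(\<Sum>l\<in>S. [:a l, b l:]) = [:\<Sum>l\<in>S. a l, \<Sum>l\<in>S. b l:: 'r :: comm_monoid_add:]"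
  by (induction S rule: infinite_finite_induct) auto

lemma const_mat_lin:
  assumes "g \<in> carrier_mat n n" "A \<in> carrier_mat n n"
  shows "const_mat g * lin n A = mat n n (\<lambda>(i, j). [:g $$ (i, j), (g * A) $$ (i, j) :: 'r :: comm_ring_1:])"
proof (rule eq_matI)
  fix i j assume "i < dim_row (mat n n (\<lambda>(i, j). [:g $$ (i, j), (g * A) $$ (i, j):]))"
    "j < dim_col (mat n n (\<lambda>(i, j). [:g $$ (i, j), (g * A) $$ (i, j):]))"
  then have ij: "i < n" "j < n" by auto
  have "(const_mat g * lin n A) $$ (i, j) = (\<Sum>l<n. [:if l = j then g $$ (i, l) else 0, g $$ (i, l) * A $$ (l, j):])"
    using assms ij by (subst mult_mat_index[of _ n n _ n]) (auto simp: const_mat_def lin_def intro!: sum.cong)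
  also have "\<dots> = [:g $$ (i, j), (g * A) $$ (i, j):]"
    unfolding sum_pCons2 mult_mat_index[OF assms ij] using ij by simp
  finally show "(const_mat g * lin n A) $$ (i, j) = mat n n (\<lambda>(i, j). [:g $$ (i, j), (g * A) $$ (i, j):]) $$ (i, j)"
    using ij by simp
qed (use assms in \<open>auto simp: const_mat_def lin_def\<close>)

lemma lin_const_mat:
  assumes "g \<in> carrier_mat n n" "A \<in> carrier_mat n n"
  shows "lin n A * const_mat g = mat n n (\<lambda>(i, j). [:g $$ (i, j), (A * g) $$ (i, j) :: 'r :: comm_ring_1:])"
proof (rule eq_matI)
  fix i j assume "i < dim_row (mat n n (\<lambda>(i, j). [:g $$ (i, j), (A * g) $$ (i, j):]))"
    "j < dim_col (mat n n (\<lambda>(i, j). [:g $$ (i, j), (A * g) $$ (i, j):]))"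
  then have ij: "i < n" "j < n" by auto
  have "(lin n A * const_mat g) $$ (i, j) = (\<Sum>l<n. [:if i = l then g $$ (l, j) else 0, A $$ (i, l) * g $$ (l, j):])"
    using assms ij by (subst mult_mat_index[of _ n n _ n]) (auto simp: const_mat_def lin_def mult.commute intro!: sum.cong)
  also have "\<dots> = [:g $$ (i, j), (A * g) $$ (i, j):]"
    unfolding sum_pCons2 mult_mat_index[OF assms(2,1) ij] using ij by simp
  finally show "(lin n A * const_mat g) $$ (i, j) = mat n n (\<lambda>(i, j). [:g $$ (i, j), (A * g) $$ (i, j):]) $$ (i, j)"
    using ij by simp
qed (use assms in \<open>auto simp: const_mat_def lin_def\<close>)

lemma det_const_mat_nonzero:
  assumes "g \<in> GL n"
  shows "det (const_mat g) \<noteq> 0"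
proof
  assume "det (const_mat g) = 0"
  then have "poly (det (const_mat g)) 0 = 0" by simp
  then have "det (ev_mat 0 (const_mat g)) = 0" by (simp only: det_ev_mat)
  then show False using assms by (simp add: GL_iff_det)
qed

lemma poly_mat_eqI:
  fixes F G :: "'a :: field_char_0 poly mat"
  assumes "F \<in> carrier_mat k l" "G \<in> carrier_mat k l" "\<And>r. ev_mat (of_nat r) F = ev_mat (of_nat r) G"
  shows "F = G"
proof (rule eq_matI)
  fix a b assume ab: "a < dim_row G" "b < dim_col G"
  have "poly (F $$ (a, b) - G $$ (a, b)) (of_nat r) = 0" for r
  proof -
    have "ev_mat (of_nat r) F $$ (a, b) = ev_mat (of_nat r) G $$ (a, b)" by (simp only: assms(3))
    moreover have "a < dim_row F" "b < dim_col F" using ab assms(1,2) by auto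
    ultimately show ?thesis using ab by (simp add: ev_mat_def)
  qed
  then have "F $$ (a, b) - G $$ (a, b) = 0" by (rule poly_eq_0_if_nat_roots)
  then show "F $$ (a, b) = G $$ (a, b)" by simp
qed (use assms in auto)

lemma det_elementary:
  fixes c :: "'a :: field"
  assumes "i < n" "j < n" "i \<noteq> j \<or> 1 + c \<noteq> 0"
  shows "1\<^sub>m n + c \<cdot>\<^sub>m elem n i j \<in> GL n"
proof (cases "i \<le> j")
  case True
  have "det (1\<^sub>m n + c \<cdot>\<^sub>m elem n i j) = prod_list (diag_mat (1\<^sub>m n + c \<cdot>\<^sub>m elem n i j))"
    by (rule det_upper_triangular[of _ n]) (use True assms in \<open>auto simp: upper_triangular_def elem_def\<close>)
  also have "\<dots> \<noteq> 0"
    using assms by (auto simp: diag_mat_def elem_def prod_list_zero_iff split: if_splits)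
  finally show ?thesis by (simp add: GL_iff_det)
next
  case False
  have "det (1\<^sub>m n + c \<cdot>\<^sub>m elem n i j) = prod_list (diag_mat (1\<^sub>m n + c \<cdot>\<^sub>m elem n i j))"
    by (rule det_lower_triangular[of n]) (use False assms in \<open>auto simp: elem_def\<close>)
  also have "\<dots> \<noteq> 0"
    using assms by (auto simp: diag_mat_def elem_def prod_list_zero_iff split: if_splits)
  finally show ?thesis by (simp add: GL_iff_det)
qed

lemma elem_mult:
  assumes "i < n" "j < n" "k < n" "l < n"
  shows "elem n i j * elem n k l = (if j = k then elem n i l else (0\<^sub>m n n :: 'r :: comm_ring_1 mat))"
proof (rule eq_matI)
  let ?R = "if j = k then elem n i l else (0\<^sub>m n n :: 'r mat)"
  fix a b assume "a < dim_row ?R" "b < dim_col ?R"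
  then have ab: "a < n" "b < n" by (auto simp: elem_def split: if_splits)
  have "(elem n i j * elem n k l) $$ (a, b) = (\<Sum>c<n. (if c = j then if a = i \<and> j = k \<and> b = l then 1 else 0 else 0 :: 'r))"
    unfolding mult_mat_index[OF elem_carrier elem_carrier ab]
    using ab by (intro sum.cong refl) (auto simp: elem_def)
  then show "(elem n i j * elem n k l) $$ (a, b) = ?R $$ (a, b)" using ab assms by (auto simp: elem_def)
qed (auto simp: elem_def)

context polyrep begin

text \<open>Coefficient of s in the image of g (1 + s A) = (1 + s g A h) g, where \<open>h\<close>
  is the inverse of \<open>g\<close>.\<close>

lemma e_equivariant:
  assumes g: "g \<in> GL n" and h: "h \<in> carrier_mat n n" "h * g = 1\<^sub>m n" and A: "A \<in> carrier_mat n n"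
  shows "\<rho> g * e A = e (g * A * h) * \<rho> g"
proof -
  have gc: "g \<in> carrier_mat n n" using g by (simp add: GL_iff_det)
  let ?B = "g * A * h"
  have B: "?B \<in> carrier_mat n n" using gc A h by (auto intro!: mult_carrier_mat[of _ n n])
  have "?B * g = (g * A) * (h * g)" using gc A h by (intro assoc_mult_mat) auto
  then have Bg: "?B * g = g * A" using gc A h by simp
  have "const_mat g * lin n A = lin n ?B * const_mat g"
    by (simp only: const_mat_lin[OF gc A] lin_const_mat[OF gc B] Bg)
  then have "cext (const_mat g * lin n A) = cext (lin n ?B * const_mat g)" by simp
  also have "cext (const_mat g * lin n A) = cext (const_mat g) * cext (lin n A)"
    using gc by (intro cext_mult det_const_mat_nonzero[OF g] det_lin_nonzero A) auto
  also have "cext (lin n ?B * const_mat g) = cext (lin n ?B) * cext (const_mat g)"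
    using gc by (intro cext_mult det_const_mat_nonzero[OF g] det_lin_nonzero B) auto
  finally have eq: "const_mat (\<rho> g) * cext (lin n A) = cext (lin n ?B) * const_mat (\<rho> g)"
    by (simp only: cext_const[OF g])
  have c: "coeff_mat 0 (const_mat (\<rho> g)) = \<rho> g" "coeff_mat (Suc 0) (const_mat (\<rho> g)) = 0\<^sub>m m m"
    using \<rho>_carrier[OF g] by (auto simp: coeff_mat_def const_mat_def intro!: eq_matI)
  have "coeff_mat (Suc 0) (const_mat (\<rho> g) * cext (lin n A)) = \<rho> g * e A"
    using \<rho>_carrier[OF g] by (subst coeff_1_mult[of _ m m _ m])
      (auto simp: c e_def[symmetric] left_mult_zero_mat[of _ m m] right_add_zero_mat[of _ m m])
  moreover have "coeff_mat (Suc 0) (cext (lin n ?B) * const_mat (\<rho> g)) = e ?B * \<rho> g"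
    using \<rho>_carrier[OF g] by (subst coeff_1_mult[of _ m m _ m])
      (auto simp: c e_def[symmetric] right_mult_zero_mat[of _ m m] left_add_zero_mat[OF mult_carrier_mat[of _ m m _ m]])
  ultimately show ?thesis using eq by simp
qed

text \<open>Conjugating the elementary matrix (j, i) by g = 1 + s e_ij gives e_ji + s (e_ii - e_jj)
  - s^2 e_ij. Equivariance under g is thus an identity of polynomials in s, with \<open>G\<close> as
  the image of this conjugate, and its coefficient of s is the commutator relation.\<close>

lemma E_bracket:
  assumes ij: "i < n" "j < n" "i \<noteq> j"
  shows "E i j * E j i + E j j = E j i * E i j + E i i"
proof -
  define F where "F = cext (lin n (elem n i j))"
  define D where "D = e (elem n i i + (- 1) \<cdot>\<^sub>m elem n j j)"
  define G where "G = mat m m (\<lambda>(a, b). [:E j i $$ (a, b), D $$ (a, b), - E i j $$ (a, b):])"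
  have Fc: "F \<in> carrier_mat m m" and Gc: "G \<in> carrier_mat m m" and Dc: "D \<in> carrier_mat m m"
    by (auto simp: F_def G_def D_def)
  have "F * const_mat (E j i) = G * F"
  proof (rule poly_mat_eqI)
    fix r
    define s where "s = (of_nat r :: 'a)"
    define g where "g = 1\<^sub>m n + s \<cdot>\<^sub>m elem n i j"
    define h where "h = 1\<^sub>m n + (- s) \<cdot>\<^sub>m elem n i j"
    have g: "g \<in> GL n" unfolding g_def using ij by (intro det_elementary) auto
    have [simp]: "g \<in> carrier_mat n n" "h \<in> carrier_mat n n" by (auto simp: g_def h_def)
    have ij0: "elem n i j * elem n i j = (0\<^sub>m n n :: 'a mat)" using ij by (simp add: elem_mult)
    have gh: "h * g = 1\<^sub>m n"
    proof -
      have "h * g = 1\<^sub>m n * g + ((- s) \<cdot>\<^sub>m elem n i j) * g"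
        unfolding h_def by (rule add_mult_distrib_mat[of _ n n _ _ n]) (auto simp: g_def)
      also have "((- s) \<cdot>\<^sub>m elem n i j) * g = (- s) \<cdot>\<^sub>m (elem n i j * g)"
        by (rule mult_smult_assoc_mat[of _ n n _ n]) auto
      also have "elem n i j * g = elem n i j * 1\<^sub>m n + elem n i j * (s \<cdot>\<^sub>m elem n i j)"
        unfolding g_def by (rule mult_add_distrib_mat[of _ n n _ n]) auto
      also have "elem n i j * (s \<cdot>\<^sub>m elem n i j) = s \<cdot>\<^sub>m (elem n i j * elem n i j)"
        by (rule mult_smult_distrib[of _ n n _ n]) auto
      finally show ?thesis unfolding ij0 by (intro eq_matI) (auto simp: g_def elem_def)
    qed
    have gE: "g * elem n j i = elem n j i + s \<cdot>\<^sub>m elem n i i"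
    proof -
      have "g * elem n j i = 1\<^sub>m n * elem n j i + (s \<cdot>\<^sub>m elem n i j) * elem n j i"
        unfolding g_def by (rule add_mult_distrib_mat[of _ n n _ _ n]) auto
      also have "(s \<cdot>\<^sub>m elem n i j) * elem n j i = s \<cdot>\<^sub>m (elem n i j * elem n j i)"
        by (rule mult_smult_assoc_mat[of _ n n _ n]) auto
      finally show ?thesis using ij by (simp add: elem_mult left_mult_one_mat[OF elem_carrier])
    qed
    have "g * elem n j i * h = g * elem n j i * 1\<^sub>m n + g * elem n j i * ((- s) \<cdot>\<^sub>m elem n i j)"
      unfolding h_def by (rule mult_add_distrib_mat[of _ n n _ n]) (auto simp: gE)
    also have "g * elem n j i * ((- s) \<cdot>\<^sub>m elem n i j) = (- s) \<cdot>\<^sub>m (g * elem n j i * elem n i j)"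
      by (rule mult_smult_distrib[of _ n n _ n]) (auto simp: gE)
    also have "g * elem n j i * elem n i j = elem n j i * elem n i j + (s \<cdot>\<^sub>m elem n i i) * elem n i j"
      unfolding gE by (rule add_mult_distrib_mat[of _ n n _ _ n]) auto
    also have "(s \<cdot>\<^sub>m elem n i i) * elem n i j = s \<cdot>\<^sub>m (elem n i i * elem n i j)"
      by (rule mult_smult_assoc_mat[of _ n n _ n]) auto
    also have "elem n i i * elem n i j = (elem n i j :: 'a mat)" using ij by (simp add: elem_mult)
    also have "elem n j i * elem n i j = (elem n j j :: 'a mat)" using ij by (simp add: elem_mult)
    also have "g * elem n j i * 1\<^sub>m n = elem n j i + s \<cdot>\<^sub>m elem n i i"
      unfolding gE by (rule right_mult_one_mat) auto
    finally have "g * elem n j i * h = elem n j i + s \<cdot>\<^sub>m elem n i i + (- s) \<cdot>\<^sub>m (elem n j j + s \<cdot>\<^sub>m elem n i j)" .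
    also have "\<dots> = elem n j i + (s \<cdot>\<^sub>m (elem n i i + (- 1) \<cdot>\<^sub>m elem n j j) + (- s * s) \<cdot>\<^sub>m elem n i j)"
      by (auto simp: algebra_simps elem_def intro!: eq_matI)
    finally have ghE: "g * elem n j i * h = elem n j i + (s \<cdot>\<^sub>m (elem n i i + (- 1) \<cdot>\<^sub>m elem n j j) + (- s * s) \<cdot>\<^sub>m elem n i j)" .
    have "e (g * elem n j i * h) = E j i + (s \<cdot>\<^sub>m D + (- s * s) \<cdot>\<^sub>m E i j)"
      unfolding ghE D_def by (simp add: e_add e_smult)
    also have "\<dots> = ev_mat s G"
      using Dc by (intro eq_matI) (auto simp: G_def ev_mat_def algebra_simps)
    finally have "\<rho> g * E j i = ev_mat s G * \<rho> g"
      using e_equivariant[OF g _ gh, of "elem n j i"] by simp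
    moreover have "ev_mat s F = \<rho> g"
      unfolding F_def using g by (simp add: ev_cext lin_ev g_def ext_id)
    ultimately show "ev_mat (of_nat r) (F * const_mat (E j i)) = ev_mat (of_nat r) (G * F)"
      using Fc Gc by (simp add: ev_mat_mult[of _ m m _ m] s_def)
  next
    show "F * const_mat (E j i) \<in> carrier_mat m m" using Fc by (intro mult_carrier_mat[of _ m m]) auto
    show "G * F \<in> carrier_mat m m" using Fc Gc by (intro mult_carrier_mat[of _ m m]) auto
  qed
  then have "coeff_mat (Suc 0) (F * const_mat (E j i)) = coeff_mat (Suc 0) (G * F)" by simp
  moreover have "coeff_mat (Suc 0) (const_mat (E j i)) = 0\<^sub>m m m" "coeff_mat 0 (const_mat (E j i)) = E j i"
    "coeff_mat 0 G = E j i" "coeff_mat (Suc 0) G = D"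
    using Dc by (auto simp: coeff_mat_def const_mat_def G_def intro!: eq_matI)
  moreover have "coeff_mat 0 F = 1\<^sub>m m" "coeff_mat (Suc 0) F = E i j"
    by (auto simp: F_def coeff_0_lin e_def)
  ultimately have "E i j * E j i = E j i * E i j + D"
    using Fc Gc Dc by (simp add: coeff_1_mult[of _ m m _ m] left_add_zero_mat[OF mult_carrier_mat[of _ m m _ m]] right_mult_zero_mat[of _ m m])
  moreover have "D = E i i + (- 1) \<cdot>\<^sub>m E j j" by (simp add: D_def e_add e_smult)
  ultimately show ?thesis
    by (intro eq_matI) (auto simp del: index_mult_mat(1))
qed

end

section \<open>The Casimir operator\<close>

declare index_mult_mat(1) [simp del] index_mult_mat_vec [simp del]

definition tr :: "nat \<Rightarrow> 'r mat \<Rightarrow> 'r :: comm_ring_1" where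
  "tr m A = (\<Sum>a<m. A $$ (a, a))"

lemma tr_comm:
  assumes "A \<in> carrier_mat m m" "B \<in> carrier_mat m m"
  shows "tr m (A * B) = tr m (B * A)"
proof -
  have "tr m (A * B) = (\<Sum>a<m. \<Sum>l<m. A $$ (a, l) * B $$ (l, a))"
    unfolding tr_def using assms by (intro sum.cong refl) (subst mult_mat_index[of _ m m _ m], auto)
  also have "\<dots> = (\<Sum>l<m. \<Sum>a<m. A $$ (a, l) * B $$ (l, a))" by (rule sum.swap)
  also have "\<dots> = tr m (B * A)"
    unfolding tr_def using assms
    by (intro sum.cong refl) (subst mult_mat_index[of _ m m _ m], auto simp: mult.commute)
  finally show ?thesis .
qed

lemma tr_add: "A \<in> carrier_mat m m \<Longrightarrow> B \<in> carrier_mat m m \<Longrightarrow> tr m (A + B) = tr m A + tr m B"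
  by (simp add: tr_def sum.distrib)

lemma tr_smult: "A \<in> carrier_mat m m \<Longrightarrow> tr m (c \<cdot>\<^sub>m A) = c * tr m A"
  by (simp add: tr_def sum_distrib_left)

lemma tr_msum: "tr m (msum m S f) = (\<Sum>i\<in>S. tr m (f i))"
proof -
  have "tr m (msum m S f) = (\<Sum>a<m. \<Sum>i\<in>S. f i $$ (a, a))" by (simp add: tr_def msum_def)
  also have "\<dots> = (\<Sum>i\<in>S. tr m (f i))" unfolding tr_def by (rule sum.swap)
  finally show ?thesis .
qed

lemma msum_mult_vec:
  assumes "\<And>i. i \<in> S \<Longrightarrow> f i \<in> carrier_mat m m" "v \<in> carrier_vec m" "a < m"
  shows "(msum m S f *\<^sub>v v) $ a = (\<Sum>i\<in>S. (f i *\<^sub>v v) $ a :: 'r :: comm_ring_1)"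
proof -
  have "(msum m S f *\<^sub>v v) $ a = (\<Sum>l<m. \<Sum>i\<in>S. f i $$ (a, l) * v $ l)"
    using assms by (subst mult_mat_vec_index[of _ m m]) (auto simp: msum_def sum_distrib_right)
  also have "\<dots> = (\<Sum>i\<in>S. \<Sum>l<m. f i $$ (a, l) * v $ l)" by (rule sum.swap)
  also have "\<dots> = (\<Sum>i\<in>S. (f i *\<^sub>v v) $ a)"
    using assms by (intro sum.cong refl) (subst mult_mat_vec_index[of _ m m], auto)
  finally show ?thesis .
qed

lemma dg_mult:
  "dg n s * dg n t = dg n (\<lambda>i. s i * t i :: 'r :: comm_ring_1)"
proof (rule eq_matI)
  fix i j assume "i < dim_row (dg n (\<lambda>i. s i * t i))" "j < dim_col (dg n (\<lambda>i. s i * t i))"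
  then have ij: "i < n" "j < n" by (auto simp: dg_def)
  have "(dg n s * dg n t) $$ (i, j) = (\<Sum>l<n. if l = i then if i = j then s i * t i else 0 else 0)"
    unfolding mult_mat_index[OF dg_carrier dg_carrier ij] using ij by (intro sum.cong refl) (auto simp: dg_def)
  then show "(dg n s * dg n t) $$ (i, j) = dg n (\<lambda>i. s i * t i) $$ (i, j)" using ij by (simp add: dg_def)
qed (auto simp: dg_def)

lemma dg_one: "(\<And>i. i < n \<Longrightarrow> t i = 1) \<Longrightarrow> dg n t = (1\<^sub>m n :: 'r :: comm_ring_1 mat)"
  by (rule eq_matI) (auto simp: dg_def)

lemma dg_GL: "(\<And>i. i < n \<Longrightarrow> t i \<noteq> 0) \<Longrightarrow> dg n t \<in> GL n"
proof -
  assume t: "\<And>i. i < n \<Longrightarrow> t i \<noteq> 0"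
  have "det (dg n t) = prod_list (diag_mat (dg n t))"
    by (rule det_upper_triangular[of _ n]) (auto simp: upper_triangular_def dg_def)
  then show ?thesis using t by (auto simp: GL_iff_det diag_mat_def dg_def prod_list_zero_iff)
qed

lemma dg_conjugate_elem:
  fixes s t :: "nat \<Rightarrow> 'r :: comm_ring_1"
  assumes "i < n" "j < n"
  shows "dg n s * elem n i j * dg n t = (s i * t j) \<cdot>\<^sub>m elem n i j" 
proof (rule eq_matI)
  fix a b assume "a < dim_row ((s i * t j) \<cdot>\<^sub>m elem n i j)" "b < dim_col ((s i * t j) \<cdot>\<^sub>m elem n i j)"
  then have ab: "a < n" "b < n" by auto
  have 1: "(dg n s * elem n i j) $$ (a, l) = (if a = i \<and> l = j then s i else 0)" if "l < n" for l
  proof -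
    have "(dg n s * elem n i j) $$ (a, l) = (\<Sum>k<n. if k = a then if a = i \<and> l = j then s i else 0 else 0)"
      unfolding mult_mat_index[OF dg_carrier elem_carrier ab(1) that] using ab that
      by (intro sum.cong refl) (auto simp: dg_def elem_def)
    then show ?thesis using ab by simp
  qed
  have dgb: "dg n t $$ (k, b) = (if k = b then t b else 0)" if "k < n" for k
    using that ab by (simp add: dg_def)
  have "(dg n s * elem n i j * dg n t) $$ (a, b) = (\<Sum>k<n. if k = b then if a = i \<and> b = j then s i * t j else 0 else 0)"
    unfolding mult_mat_index[OF mult_carrier_mat[OF dg_carrier elem_carrier] dg_carrier ab] using ab
    by (intro sum.cong refl) (auto simp: 1 dgb)
  then show "(dg n s * elem n i j * dg n t) $$ (a, b) = ((s i * t j) \<cdot>\<^sub>m elem n i j) $$ (a, b)"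
    using ab by (simp add: elem_def)
qed (auto simp: dg_def)

lemma coeff_1_linear_power: "coeff ([:1, 1 :: 'r :: comm_ring_1:] ^ k) (Suc 0) = of_nat k"
proof (induction k)
  case (Suc k)
  have "coeff ([:1, 1 :: 'r:] ^ k) 0 = 1" by (simp add: poly_0_coeff_0[symmetric])
  with Suc show ?case by (simp add: coeff_mult)
qed simp

lemma subspace_vecI:
  assumes "U \<subseteq> carrier_vec m" "0\<^sub>v m \<in> U"
    "\<And>u w. u \<in> U \<Longrightarrow> w \<in> U \<Longrightarrow> u + w \<in> U" "\<And>c u. u \<in> U \<Longrightarrow> c \<cdot>\<^sub>v u \<in> U"
  shows "VectorSpace.subspace class_ring U (module_vec TYPE('a :: field) m)"
proof -
  interpret vec_space "TYPE('a)" m .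
  have "Module.module class_ring (module_vec TYPE('a) m)" by (rule module_axioms)
  moreover have "vectorspace class_ring (module_vec TYPE('a) m)" by (rule vectorspace_axioms)
  ultimately show ?thesis
    unfolding subspace_def submodule_def using assms by (auto simp: module_vec_simps)
qed

text \<open>\<open>L\<close> is the partition padded with zeros to a function on all indices, so
  that monotonicity can be used without a bound on the index.\<close>

locale hwrep = polyrep n m \<rho> P
  for n m :: nat and \<rho> :: "'a :: field_char_0 mat \<Rightarrow> 'a mat" and P +
  fixes v :: "'a vec" and L :: "nat \<Rightarrow> nat"
  assumes v: "v \<in> carrier_vec m" "v \<noteq> 0\<^sub>v m"
    and hw: "\<And>b. b \<in> GL n \<Longrightarrow> upper_triangular b \<Longrightarrow> \<rho> b *\<^sub>v v = (\<Prod>i<n. b $$ (i, i) ^ L i) \<cdot>\<^sub>v v"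
    and irr: "irreducible_representation n m \<rho>"
    and L0: "\<And>i. i \<ge> n \<Longrightarrow> L i = 0"
    and L_dec: "\<And>i j. i \<le> j \<Longrightarrow> L j \<le> L i"
begin

text \<open>For \<open>i \<le> j\<close> the matrix 1 + s e_ij is upper triangular, so the highest
  weight condition can be differentiated along it. At natural s the diagonal case stays invertible
  because 1 + s is nonzero.\<close>

lemma E_hw:
  assumes ij: "i \<le> j" "j < n"
  shows "E i j *\<^sub>v v = (if i = j then of_nat (L i) else 0) \<cdot>\<^sub>v v"
proof (rule eq_vecI)
  fix a assume "a < dim_vec ((if i = j then of_nat (L i) else 0) \<cdot>\<^sub>v v)"
  then have a: "a < m" using v by auto
  define F where "F = cext (lin n (elem n i j))"
  define p where "p = (\<Sum>b<m. F $$ (a, b) * [:v $ b:])"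
  define q where "q = (if i = j then [:1, 1:] ^ L i else 1) * [:v $ a:]"
  have "poly (p - q) (of_nat r) = 0" for r
  proof -
    define s where "s = (of_nat r :: 'a)"
    define g where "g = 1\<^sub>m n + s \<cdot>\<^sub>m elem n i j"
    have "of_nat (Suc r) \<noteq> (0 :: 'a)" by (rule of_nat_neq_0)
    then have s1: "1 + s \<noteq> 0" by (simp add: s_def)
    have g: "g \<in> GL n" unfolding g_def using ij s1 by (intro det_elementary) auto
    have "upper_triangular g" using ij by (auto simp: g_def upper_triangular_def elem_def)
    then have "\<rho> g *\<^sub>v v = (\<Prod>k<n. g $$ (k, k) ^ L k) \<cdot>\<^sub>v v" by (rule hw[OF g])
    also have "(\<Prod>k<n. g $$ (k, k) ^ L k) = (\<Prod>k<n. if k = i \<and> i = j then (1 + s) ^ L i else 1)"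
      using ij by (intro prod.cong refl) (auto simp: g_def elem_def)
    also have "\<dots> = (if i = j then (1 + s) ^ L i else 1)" using ij by simp
    finally have "(\<rho> g *\<^sub>v v) $ a = (if i = j then (1 + s) ^ L i else 1) * v $ a"
      using a v by simp
    moreover have "ev_mat s F = \<rho> g"
      unfolding F_def using g by (simp add: ev_cext lin_ev g_def ext_id)
    then have "poly (F $$ (a, b)) s = \<rho> g $$ (a, b)" if "b < m" for b
      using a that by (auto simp: F_def ev_mat_def dest!: arg_cong[of _ _ "\<lambda>A. A $$ (a, b)"])
    then have "poly p s = (\<rho> g *\<^sub>v v) $ a"
      using a v \<rho>_carrier[OF g] by (simp add: p_def poly_sum mult_mat_vec_index[of _ m m] mult.commute)
    moreover have "poly q s = (if i = j then (1 + s) ^ L i else 1) * v $ a"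
      by (simp add: q_def)
    ultimately show ?thesis by (simp add: s_def)
  qed
  then have "p - q = 0" by (rule poly_eq_0_if_nat_roots)
  then have "coeff p (Suc 0) = coeff q (Suc 0)" by simp
  moreover have "coeff p (Suc 0) = (E i j *\<^sub>v v) $ a"
    using a v by (simp add: mult_mat_vec_index[of _ m m] p_def coeff_sum e_def coeff_mat_def F_def mult.commute)
  moreover have "coeff q (Suc 0) = (if i = j then of_nat (L i) else 0) * v $ a"
    by (simp add: q_def coeff_1_linear_power)
  ultimately show "(E i j *\<^sub>v v) $ a = ((if i = j then of_nat (L i) else 0) \<cdot>\<^sub>v v) $ a"
    using a v by simp
qed (use v in auto)

text \<open>The Casimir element of the trace form, plus a multiple of the central element. The extra
  term makes up for the staircase being used in place of the half sum of the positive roots, from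
  which it differs by the constant vector (n - 1) / 2.\<close>

definition Cas :: "'a mat" where
  "Cas = msum m ({..<n} \<times> {..<n}) (\<lambda>(i, j). E i j * E j i) + of_nat (n - 1) \<cdot>\<^sub>m e (1\<^sub>m n)"

text \<open>Squared norm of the shifted highest weight minus that of the shift, the usual Casimir
  eigenvalue.\<close>

definition \<kappa> :: 'a where
  "\<kappa> = of_nat (\<Sum>i<n. (L i + staircase n i) ^ 2) - of_nat (\<Sum>i<n. staircase n i ^ 2)"

lemma Cas_carrier [simp]: "Cas \<in> carrier_mat m m"
  by (simp add: Cas_def)

lemma Cas_dim [simp]: "dim_row Cas = m" "dim_col Cas = m"
  using Cas_carrier by (auto simp del: Cas_carrier)

text \<open>The two factors run through bases that are dual for the trace form, which conjugation
  preserves: the coefficients produced by the first factor are exactly those that undo the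
  conjugation of the second.\<close>

lemma Cas_commute:
  assumes g: "g \<in> GL n"
  shows "\<rho> g * Cas = Cas * \<rho> g"
proof -
  obtain h where h: "h \<in> GL n" "g * h = 1\<^sub>m n" "h * g = 1\<^sub>m n" using GL_inverse[OF g] by blast
  have gc: "g \<in> carrier_mat n n" and hc: "h \<in> carrier_mat n n" using g h by (auto simp: GL_iff_det)
  have R: "\<rho> g \<in> carrier_mat m m" by (rule \<rho>_carrier[OF g])
  let ?I = "{..<n} \<times> {..<n}"
  have conj_entry: "(g * elem n i j * h) $$ (k, l) = g $$ (k, i) * h $$ (j, l)"
    if "g \<in> carrier_mat n n" "h \<in> carrier_mat n n" "i < n" "j < n" "k < n" "l < n" for g h :: "'a mat" and i j k l
  proof -
    have ge: "(g * elem n i j) $$ (k, b) = (if b = j then g $$ (k, i) else 0)" if "b < n" for b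
    proof -
      have "(g * elem n i j) $$ (k, b) = (\<Sum>c<n. if c = i then if b = j then g $$ (k, i) else 0 else 0)"
        unfolding mult_mat_index[OF \<open>g \<in> carrier_mat n n\<close> elem_carrier \<open>k < n\<close> that]
        using that \<open>k < n\<close> by (intro sum.cong refl) (auto simp: elem_def)
      then show ?thesis using \<open>i < n\<close> by simp
    qed
    have "(g * elem n i j * h) $$ (k, l) = (\<Sum>b<n. if b = j then g $$ (k, i) * h $$ (j, l) else 0)"
      unfolding mult_mat_index[OF mult_carrier_mat[OF \<open>g \<in> carrier_mat n n\<close> elem_carrier] \<open>h \<in> carrier_mat n n\<close> \<open>k < n\<close> \<open>l < n\<close>]
      by (intro sum.cong refl) (auto simp: ge)
    then show ?thesis using \<open>j < n\<close> by simp
  qed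
  have conj_c: "g * elem n i j * h \<in> carrier_mat n n" for i j
    using gc hc by (auto intro!: mult_carrier_mat[of _ n n])
  have conj_c': "h * elem n i j * g \<in> carrier_mat n n" for i j
    using gc hc by (auto intro!: mult_carrier_mat[of _ n n])
  have assoc: "A * B * C = A * (B * C)" if "A \<in> carrier_mat m m" "B \<in> carrier_mat m m" "C \<in> carrier_mat m m" for A B C :: "'a mat"
    using that by (rule assoc_mult_mat)
  have mc: "A * B \<in> carrier_mat m m" if "A \<in> carrier_mat m m" "B \<in> carrier_mat m m" for A B :: "'a mat"
    using that by (rule mult_carrier_mat)
  have "\<rho> g * msum m ?I (\<lambda>(i, j). E i j * E j i) = msum m ?I (\<lambda>(i, j). \<rho> g * (E i j * E j i))"
    using R by (subst mult_msum) (auto intro: mc simp: case_prod_unfold)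
  \<comment> \<open>Equivariance moves \<open>\<rho> g\<close> past \<open>E i j\<close>; entry (k,
    l) of the conjugate of the elementary matrix (i, j) is
    \<open>g $$ (k, i) * h $$ (j, l)\<close>.\<close>
  also have "\<dots> = msum m ?I (\<lambda>(i, j). msum m ?I (\<lambda>(k, l). (g $$ (k, i) * h $$ (j, l)) \<cdot>\<^sub>m (E k l * (\<rho> g * E j i))))"
  proof (rule msum_cong, unfold split_paired_all prod.case)
    fix i j assume "(i, j) \<in> ?I"
    then have ij: "i \<in> {..<n}" "j \<in> {..<n}" by auto
    have "\<rho> g * (E i j * E j i) = (\<rho> g * E i j) * E j i" using R by (simp add: assoc)
    also have "\<rho> g * E i j = e (g * elem n i j * h) * \<rho> g" by (rule e_equivariant[OF g hc h(3)]) simp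
    also have "e (g * elem n i j * h) = msum m ?I (\<lambda>(k, l). (g $$ (k, i) * h $$ (j, l)) \<cdot>\<^sub>m E k l)"
      unfolding e_expand[OF conj_c] using ij gc hc by (intro msum_cong) (auto simp: conj_entry)
    also have "\<dots> * \<rho> g * E j i = \<dots> * (\<rho> g * E j i)" using R by (intro assoc) auto
    also have "\<dots> = msum m ?I (\<lambda>p. (case p of (k, l) \<Rightarrow> (g $$ (k, i) * h $$ (j, l)) \<cdot>\<^sub>m E k l) * (\<rho> g * E j i))"
      using R by (intro msum_mult mc) auto
    also have "\<dots> = msum m ?I (\<lambda>(k, l). (g $$ (k, i) * h $$ (j, l)) \<cdot>\<^sub>m (E k l * (\<rho> g * E j i)))"
      using R by (intro msum_cong) (auto simp: mult_smult_assoc_mat[of _ m m _ m] mc)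
    finally show "\<rho> g * (E i j * E j i) = msum m ?I (\<lambda>(k, l). (g $$ (k, i) * h $$ (j, l)) \<cdot>\<^sub>m (E k l * (\<rho> g * E j i)))" .
  qed
  also have "\<dots> = msum m ?I (\<lambda>(k, l). msum m ?I (\<lambda>(i, j). (g $$ (k, i) * h $$ (j, l)) \<cdot>\<^sub>m (E k l * (\<rho> g * E j i))))"
    unfolding case_prod_unfold by (rule msum_swap)
  also have "\<dots> = msum m ?I (\<lambda>(k, l). (E k l * E l k) * \<rho> g)"
  proof (rule msum_cong, unfold split_paired_all prod.case)
    fix k l assume "(k, l) \<in> ?I"
    then have kl: "k \<in> {..<n}" "l \<in> {..<n}" by auto
    \<comment> \<open>For fixed (k, l) the same coefficients sum up the second factors to the
      inverse conjugate of the elementary matrix (l, k), and moving \<open>\<rho> g\<close> past it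
      restores \<open>E l k\<close>.\<close>
    have "e (h * elem n l k * g) = msum m ?I (\<lambda>(j, i). (h $$ (j, l) * g $$ (k, i)) \<cdot>\<^sub>m E j i)"
      unfolding e_expand[OF conj_c'] using kl gc hc by (intro msum_cong) (auto simp: conj_entry)
    also have "\<dots> = msum m ?I (\<lambda>(i, j). (g $$ (k, i) * h $$ (j, l)) \<cdot>\<^sub>m E j i)"
      unfolding msum_def case_prod_unfold
      by (intro arg_cong[where f = "mat m m"] ext sum.reindex_bij_witness[of _ prod.swap prod.swap]) (auto simp: mult.commute)
    finally have eh: "e (h * elem n l k * g) = msum m ?I (\<lambda>(i, j). (g $$ (k, i) * h $$ (j, l)) \<cdot>\<^sub>m E j i)" .
    have "msum m ?I (\<lambda>(i, j). (g $$ (k, i) * h $$ (j, l)) \<cdot>\<^sub>m (E k l * (\<rho> g * E j i))) =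
        msum m ?I (\<lambda>p. (E k l * \<rho> g) * (case p of (i, j) \<Rightarrow> (g $$ (k, i) * h $$ (j, l)) \<cdot>\<^sub>m E j i))"
      using R by (intro msum_cong) (auto simp: mult_smult_distrib[of _ m m _ m] mc assoc)
    also have "\<dots> = (E k l * \<rho> g) * e (h * elem n l k * g)"
      unfolding eh using R by (intro mult_msum[symmetric] mc) auto
    also have "\<dots> = E k l * (\<rho> g * e (h * elem n l k * g))" using R by (intro assoc) auto
    also have "\<rho> g * e (h * elem n l k * g) = e (g * (h * elem n l k * g) * h) * \<rho> g"
      by (rule e_equivariant[OF g hc h(3) conj_c'])
    also have "g * (h * elem n l k * g) * h = elem n l k"
    proof -
      have "g * (h * elem n l k * g) = (g * h) * (elem n l k * g)"
      proof -
        have "h * elem n l k * g = h * (elem n l k * g)" using gc hc by (intro assoc_mult_mat) auto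
        moreover have "g * h * (elem n l k * g) = g * (h * (elem n l k * g))"
          using gc hc by (intro assoc_mult_mat) (auto intro!: mult_carrier_mat[of _ n n])
        ultimately show ?thesis by simp
      qed
      also have "\<dots> = elem n l k * g"
        unfolding h(2) by (rule left_mult_one_mat[OF mult_carrier_mat[OF elem_carrier gc]])
      finally have "g * (h * elem n l k * g) * h = elem n l k * (g * h)"
        using gc hc by (simp add: assoc_mult_mat[of _ n n _ n _ n])
      then show ?thesis unfolding h(2) by (simp add: right_mult_one_mat[OF elem_carrier])
    qed
    also have "E k l * (E l k * \<rho> g) = E k l * E l k * \<rho> g" using R by (simp add: assoc)
    finally show "msum m ?I (\<lambda>(i, j). (g $$ (k, i) * h $$ (j, l)) \<cdot>\<^sub>m (E k l * (\<rho> g * E j i))) = (E k l * E l k) * \<rho> g" .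
  qed
  also have "\<dots> = msum m ?I (\<lambda>(i, j). E i j * E j i) * \<rho> g"
    using R by (subst msum_mult) (auto intro: mc simp: case_prod_unfold)
  finally have 1: "\<rho> g * msum m ?I (\<lambda>(i, j). E i j * E j i) = msum m ?I (\<lambda>(i, j). E i j * E j i) * \<rho> g" .
  have "\<rho> g * e (1\<^sub>m n) = e (g * 1\<^sub>m n * h) * \<rho> g" by (rule e_equivariant[OF g hc h(3)]) simp
  also have "g * 1\<^sub>m n * h = 1\<^sub>m n" using gc h(2) by simp
  finally have 2: "\<rho> g * e (1\<^sub>m n) = e (1\<^sub>m n) * \<rho> g" .
  show ?thesis
    unfolding Cas_def using R
    by (subst mult_add_distrib_mat[of _ m m _ m], simp_all)
      (subst add_mult_distrib_mat[of _ m m _ _ m],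
        simp_all add: 1 2 mult_smult_distrib[of _ m m _ m] mult_smult_assoc_mat[of _ m m _ m])
qed

text \<open>There are n - 1 - i indices above \<open>i\<close> and \<open>i\<close> below it. Their
  difference plus n - 1 is twice \<open>staircase n i\<close>, the cross term in the square of L +
  staircase.\<close>

lemma kappa_eq:
  "(\<Sum>i<n. \<Sum>j<n. if i = j then of_nat (L i) ^ 2 else if i < j then of_nat (L i) - of_nat (L j) else 0) +
    of_nat (n - 1) * (\<Sum>i<n. of_nat (L i)) = \<kappa>"
proof -
  have 1: "(\<Sum>i<n. \<Sum>j<n. if i = j then of_nat (L i) ^ 2 else if i < j then of_nat (L i) - of_nat (L j) else 0) =
      (\<Sum>i<n. of_nat (L i) ^ 2) + (\<Sum>i<n. \<Sum>j<n. if i < j then of_nat (L i) else 0)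
       - (\<Sum>i<n. \<Sum>j<n. if i < j then of_nat (L j) else (0 :: 'a))"
  proof -
    have "(if i = j then of_nat (L i) ^ 2 else if i < j then of_nat (L i) - of_nat (L j) else 0) =
      (if i = j then of_nat (L i) ^ 2 else 0) + (if i < j then of_nat (L i) else 0) - (if i < j then of_nat (L j) else (0 :: 'a))"
      for i j by auto
    then show ?thesis by (simp add: sum.distrib sum_subtractf)
  qed
  have 2: "(\<Sum>j<n. if i < j then x else (0 :: 'a)) = of_nat (staircase n i) * x" if "i < n" for i x
  proof -
    have "(\<Sum>j<n. if i < j then x else 0) = (\<Sum>j\<in>{i<..<n}. x)"
      by (intro sum.mono_neutral_cong_right) auto
    then show ?thesis by (simp add: staircase_def)
  qed
  have 3: "(\<Sum>i<n. \<Sum>j<n. if i < j then of_nat (L j) else (0 :: 'a)) = (\<Sum>j<n. of_nat j * of_nat (L j))"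
  proof -
    have "(\<Sum>i<n. if i < j then of_nat (L j) else (0 :: 'a)) = of_nat j * of_nat (L j)" if "j < n" for j
    proof -
      have "(\<Sum>i<n. if i < j then of_nat (L j) else (0 :: 'a)) = (\<Sum>i<j. of_nat (L j))"
        using that by (intro sum.mono_neutral_cong_right) auto
      then show ?thesis by simp
    qed
    then show ?thesis by (subst sum.swap) simp
  qed
  have "\<kappa> = (\<Sum>i<n. of_nat (L i) ^ 2 + 2 * of_nat (staircase n i) * of_nat (L i))"
    unfolding \<kappa>_def of_nat_sum sum_subtractf[symmetric]
    by (intro sum.cong refl) (simp add: power2_eq_square algebra_simps)
  also have "\<dots> = (\<Sum>i<n. of_nat (L i) ^ 2 + of_nat (staircase n i) * of_nat (L i) - of_nat i * of_nat (L i)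
      + of_nat (n - 1) * of_nat (L i))"
  proof (rule sum.cong)
    fix i assume "i \<in> {..<n}"
    then have "of_nat (n - 1) = (of_nat (staircase n i) + of_nat i :: 'a)"
      by (simp add: staircase_def of_nat_add[symmetric] del: of_nat_add)
    then show "of_nat (L i) ^ 2 + 2 * of_nat (staircase n i) * of_nat (L i) =
      (of_nat (L i) ^ 2 + of_nat (staircase n i) * of_nat (L i) - of_nat i * of_nat (L i)
      + of_nat (n - 1) * of_nat (L i) :: 'a)" by (simp add: algebra_simps)
  qed simp
  finally show ?thesis
    unfolding 1 3 by (simp add: 2 sum.distrib sum_subtractf sum_distrib_left)
qed

text \<open>Raising operators kill \<open>v\<close>. For \<open>i < j\<close> the product
  \<open>E i j * E j i\<close> therefore acts as the commutator, by \<open>L i - L j\<close>; for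
  \<open>j < i\<close> the factor applied first already gives 0.\<close>

lemma Cas_hw: "Cas *\<^sub>v v = \<kappa> \<cdot>\<^sub>v v"
proof (rule eq_vecI)
  fix a assume "a < dim_vec (\<kappa> \<cdot>\<^sub>v v)"
  then have a: "a < m" using v by auto
  have mc: "A * B \<in> carrier_mat m m" if "A \<in> carrier_mat m m" "B \<in> carrier_mat m m" for A B :: "'a mat"
    using that by (rule mult_carrier_mat)
  have vec: "(A * B) *\<^sub>v v = A *\<^sub>v (B *\<^sub>v v)" if "A \<in> carrier_mat m m" "B \<in> carrier_mat m m" for A B
    using that v by (intro assoc_mult_mat_vec) auto
  have smul: "E i j *\<^sub>v (c \<cdot>\<^sub>v v) = c \<cdot>\<^sub>v (E i j *\<^sub>v v)" for i j c
    using v by (intro mult_mat_vec[of _ m m]) auto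
  have pair: "((E i j * E j i) *\<^sub>v v) $ a =
      (if i = j then of_nat (L i) ^ 2 else if i < j then of_nat (L i) - of_nat (L j) else 0) * v $ a"
    if ij: "i < n" "j < n" for i j
  proof -
    consider "i = j" | "i < j" | "j < i" by linarith
    then show ?thesis
    proof cases
      case 1
      then show ?thesis using a v ij by (simp add: vec E_hw smul power2_eq_square mult.assoc)
    next
      case 2
      have z: "E i j *\<^sub>v v = 0 \<cdot>\<^sub>v v" using E_hw[of i j] 2 ij by simp
      have "((E i j * E j i + E j j) *\<^sub>v v) $ a = ((E j i * E i j + E i i) *\<^sub>v v) $ a"
        using ij 2 by (simp only: E_bracket)
      then have "((E i j * E j i) *\<^sub>v v) $ a + (E j j *\<^sub>v v) $ a = (E j i *\<^sub>v (E i j *\<^sub>v v)) $ a + (E i i *\<^sub>v v) $ a"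
        using v a by (simp add: add_mult_distrib_mat_vec[of _ m m] mc vec[symmetric] del: index_mult_mat_vec)
      moreover have "(E j i *\<^sub>v (E i j *\<^sub>v v)) $ a = 0" unfolding z smul using a by simp
      ultimately show ?thesis using 2 ij E_hw[of i i] E_hw[of j j] a v by (simp add: algebra_simps del: index_mult_mat_vec)
    next
      case 3
      have z: "E j i *\<^sub>v v = 0 \<cdot>\<^sub>v v" using E_hw[of j i] 3 ij by simp
      show ?thesis unfolding vec[OF e_carrier e_carrier] z smul using 3 a by simp
    qed
  qed
  have one: "(e (1\<^sub>m n) *\<^sub>v v) $ a = (\<Sum>i<n. of_nat (L i)) * v $ a"
  proof -
    have "(e (1\<^sub>m n) *\<^sub>v v) $ a = (\<Sum>p\<in>{..<n} \<times> {..<n}. ((case p of (k, l) \<Rightarrow> (1\<^sub>m n :: 'a mat) $$ (k, l) \<cdot>\<^sub>m E k l) *\<^sub>v v) $ a)"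
      unfolding e_expand[OF one_carrier_mat] using a v by (intro msum_mult_vec) auto
    also have "\<dots> = (\<Sum>(k, l)\<in>{..<n} \<times> {..<n}. if k = l then of_nat (L k) * v $ a else 0)"
    proof (rule sum.cong, rule refl, unfold split_paired_all prod.case)
      fix k l assume "(k, l) \<in> {..<n} \<times> {..<n}"
      then have kl: "k \<in> {..<n}" "l \<in> {..<n}" by auto
      have "(E k k *\<^sub>v v) $ a = of_nat (L k) * v $ a" using E_hw[of k k] kl a v by simp
      moreover have "(c \<cdot>\<^sub>m E k l *\<^sub>v v) $ a = c * (E k l *\<^sub>v v) $ a" for c
        using a v by (simp add: mult_mat_vec_index[of _ m m] sum_distrib_left mult_ac del: index_mult_mat_vec)
      ultimately show "((1\<^sub>m n :: 'a mat) $$ (k, l) \<cdot>\<^sub>m E k l *\<^sub>v v) $ a = (if k = l then of_nat (L k) * v $ a else 0)"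
        using kl by (cases "k = l") simp_all
    qed
    also have "\<dots> = (\<Sum>k<n. \<Sum>l<n. if k = l then of_nat (L k) * v $ a else 0)" by (rule sum.cartesian_product[symmetric])
    finally show ?thesis by (simp add: sum_distrib_right)
  qed
  have "(Cas *\<^sub>v v) $ a = (msum m ({..<n} \<times> {..<n}) (\<lambda>(i, j). E i j * E j i) *\<^sub>v v) $ a +
      ((of_nat (n - 1) \<cdot>\<^sub>m e (1\<^sub>m n)) *\<^sub>v v) $ a"
    unfolding Cas_def using a v
    by (subst add_mult_distrib_mat_vec[of _ m m]) (auto simp del: index_mult_mat_vec)
  also have "(msum m ({..<n} \<times> {..<n}) (\<lambda>(i, j). E i j * E j i) *\<^sub>v v) $ a =
      (\<Sum>p\<in>{..<n} \<times> {..<n}. ((case p of (i, j) \<Rightarrow> E i j * E j i) *\<^sub>v v) $ a)"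
    using a v by (intro msum_mult_vec) (auto intro: mc)
  also have "\<dots> = (\<Sum>(i, j)\<in>{..<n} \<times> {..<n}.
      (if i = j then of_nat (L i) ^ 2 else if i < j then of_nat (L i) - of_nat (L j) else 0) * v $ a)"
    by (intro sum.cong refl) (auto simp: pair simp del: index_mult_mat_vec)
  also have "\<dots> = (\<Sum>i<n. \<Sum>j<n.
      (if i = j then of_nat (L i) ^ 2 else if i < j then of_nat (L i) - of_nat (L j) else 0) * v $ a)"
    by (rule sum.cartesian_product[symmetric])
  also have "((of_nat (n - 1) \<cdot>\<^sub>m e (1\<^sub>m n)) *\<^sub>v v) $ a = of_nat (n - 1) * (e (1\<^sub>m n) *\<^sub>v v) $ a"
    using a v by (simp add: mult_mat_vec_index[of _ m m] sum_distrib_left mult_ac del: index_mult_mat_vec)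
  finally show "(Cas *\<^sub>v v) $ a = (\<kappa> \<cdot>\<^sub>v v) $ a"
    unfolding one kappa_eq[symmetric] using a v
    by (simp add: sum_distrib_right distrib_right mult.assoc del: index_mult_mat_vec)
qed (use v in auto)

text \<open>The vector \<open>v\<close> supplies an eigenvalue in the base field. Its eigenspace is
  invariant because \<open>Cas\<close> commutes with the group, and irreducibility makes it
  everything.\<close>

lemma Cas_scalar: "Cas = \<kappa> \<cdot>\<^sub>m 1\<^sub>m m"
proof -
  define U where "U = {u \<in> carrier_vec m. Cas *\<^sub>v u = \<kappa> \<cdot>\<^sub>v u}"
  have "VectorSpace.subspace class_ring U (module_vec TYPE('a) m)"
  proof (rule subspace_vecI)
    show "0\<^sub>v m \<in> U" by (auto simp: U_def mult_mat_vec_index[of _ m m] intro!: eq_vecI)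
    show "u + w \<in> U" if "u \<in> U" "w \<in> U" for u w
      using that by (auto simp: U_def mult_add_distrib_mat_vec[of _ m m] smult_add_distrib_vec[of _ m])
    show "c \<cdot>\<^sub>v u \<in> U" if "u \<in> U" for c u
      using that by (auto simp: U_def mult_mat_vec[of _ m m] smult_smult_assoc mult.commute)
  qed (auto simp: U_def)
  moreover have "\<rho> g *\<^sub>v u \<in> U" if "g \<in> GL n" "u \<in> U" for g u
  proof -
    have u: "u \<in> carrier_vec m" "Cas *\<^sub>v u = \<kappa> \<cdot>\<^sub>v u" using that by (auto simp: U_def)
    have "Cas *\<^sub>v (\<rho> g *\<^sub>v u) = (Cas * \<rho> g) *\<^sub>v u"
      using \<rho>_carrier[OF that(1)] u by (intro assoc_mult_mat_vec[symmetric]) auto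
    also have "\<dots> = \<rho> g *\<^sub>v (Cas *\<^sub>v u)"
      unfolding Cas_commute[OF that(1), symmetric]
      using \<rho>_carrier[OF that(1)] u by (intro assoc_mult_mat_vec) auto
    also have "\<dots> = \<kappa> \<cdot>\<^sub>v (\<rho> g *\<^sub>v u)"
      unfolding u(2) using \<rho>_carrier[OF that(1)] u by (intro mult_mat_vec) auto
    finally show ?thesis using \<rho>_carrier[OF that(1)] u by (auto simp: U_def)
  qed
  ultimately have "U = {0\<^sub>v m} \<or> U = carrier_vec m"
    using irr by (auto simp: irreducible_representation_def)
  moreover have "v \<in> U" using v Cas_hw by (simp add: U_def)
  ultimately have U: "U = carrier_vec m" using v by auto
  show ?thesis
  proof (rule eq_matI)
    fix a b assume "a < dim_row (\<kappa> \<cdot>\<^sub>m 1\<^sub>m m)" "b < dim_col (\<kappa> \<cdot>\<^sub>m 1\<^sub>m m)"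
    then have ab: "a < m" "b < m" by auto
    have "unit_vec m b \<in> U" using U by simp
    then have "(Cas *\<^sub>v unit_vec m b) $ a = (\<kappa> \<cdot>\<^sub>v unit_vec m b) $ a" by (simp add: U_def)
    moreover have "(Cas *\<^sub>v unit_vec m b) $ a = Cas $$ (a, b)"
    proof -
      have "(Cas *\<^sub>v unit_vec m b) $ a = (\<Sum>l<m. if l = b then Cas $$ (a, b) else 0)"
        unfolding mult_mat_vec_index[OF Cas_carrier unit_vec_carrier ab(1)]
        using ab by (intro sum.cong refl) auto
      then show ?thesis using ab by simp
    qed
    ultimately show "Cas $$ (a, b) = (\<kappa> \<cdot>\<^sub>m 1\<^sub>m m) $$ (a, b)" using ab by auto
  qed auto
qed

end

section \<open>Weight spaces of the diagonal torus\<close>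

definition wmon :: "nat \<Rightarrow> (nat \<Rightarrow> 'r) \<Rightarrow> (nat \<Rightarrow> nat) \<Rightarrow> 'r :: comm_monoid_mult" where
  "wmon n x \<nu> = (\<Prod>i<n. x i ^ \<nu> i)"

lemma wmon_mult: "wmon n (\<lambda>i. s i * t i) \<nu> = wmon n s \<nu> * wmon n t \<nu>"
  by (simp add: wmon_def power_mult_distrib prod.distrib)

lemma wmon_add: "wmon n t (\<lambda>i. \<mu> i + \<nu> i) = wmon n t \<mu> * wmon n t \<nu>"
  by (simp add: wmon_def power_add prod.distrib)

lemma tr_mult3: "A \<in> carrier_mat m m \<Longrightarrow> B \<in> carrier_mat m m \<Longrightarrow> C \<in> carrier_mat m m \<Longrightarrow>
    tr m (A * B * C) = tr m (B * (C * A))"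
  using tr_comm[of A m "B * C"] assoc_mult_mat[of A m m B m C m] assoc_mult_mat[of B m m C m A m] by auto

lemma smult_smult_mat: "c \<cdot>\<^sub>m (d \<cdot>\<^sub>m A) = (c * d :: 'r :: comm_ring_1) \<cdot>\<^sub>m A"
  by (rule eq_matI) (auto simp: mult.assoc)

lemma perm_matrix_carrier [simp]: "perm_matrix n w \<in> carrier_mat n n"
  by (simp add: perm_matrix_def)

lemma perm_matrix_mult:
  assumes "u permutes {..<n}"
  shows "perm_matrix n w * perm_matrix n u = (perm_matrix n (w \<circ> u) :: 'r :: comm_ring_1 mat)"
proof (rule eq_matI)
  fix i j assume "i < dim_row (perm_matrix n (w \<circ> u) :: 'r mat)" "j < dim_col (perm_matrix n (w \<circ> u) :: 'r mat)"
  then have ij: "i < n" "j < n" by (auto simp: perm_matrix_def)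
  have uj: "u j < n" using permutes_in_image[OF assms, of j] ij by simp
  have "(perm_matrix n w * perm_matrix n u) $$ (i, j) = (\<Sum>l<n. if l = u j then if i = w l then 1 else 0 else (0 :: 'r))"
    unfolding mult_mat_index[OF perm_matrix_carrier perm_matrix_carrier ij] using ij
    by (intro sum.cong refl) (auto simp: perm_matrix_def)
  then show "(perm_matrix n w * perm_matrix n u) $$ (i, j) = (perm_matrix n (w \<circ> u) :: 'r mat) $$ (i, j)"
    using ij uj by (simp add: perm_matrix_def)
qed (auto simp: perm_matrix_def)

lemma perm_matrix_id: "perm_matrix n id = (1\<^sub>m n :: 'r :: comm_ring_1 mat)"
  by (rule eq_matI) (auto simp: perm_matrix_def)

lemma perm_matrix_GL:
  assumes "w permutes {..<n}"
  shows "perm_matrix n w \<in> GL n"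
proof -
  have "perm_matrix n w * perm_matrix n (Hilbert_Choice.inv w) = (1\<^sub>m n :: 'a mat)"
    using perm_matrix_mult[OF permutes_inv[OF assms], of w] permutes_inv_o(1)[OF assms] by (simp add: perm_matrix_id)
  then have "det (perm_matrix n w :: 'a mat) * det (perm_matrix n (Hilbert_Choice.inv w) :: 'a mat) = 1"
    using det_mult[of "perm_matrix n w" n "perm_matrix n (Hilbert_Choice.inv w) :: 'a mat"] by simp
  then show ?thesis by (auto simp: GL_iff_det)
qed

lemma dg_perm_matrix:
  assumes "\<sigma> permutes {..<n}"
  shows "dg n t * perm_matrix n \<sigma> = perm_matrix n \<sigma> * dg n (\<lambda>i. t (\<sigma> i) :: 'r :: comm_ring_1)"
proof (rule eq_matI)
  let ?R = "perm_matrix n \<sigma> * dg n (\<lambda>i. t (\<sigma> i))"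
  fix i j assume "i < dim_row ?R" "j < dim_col ?R"
  then have ij: "i < n" "j < n" by (auto simp: perm_matrix_def dg_def)
  have "(dg n t * perm_matrix n \<sigma>) $$ (i, j) = (\<Sum>l<n. if l = i then if i = \<sigma> j then t i else 0 else 0)"
    unfolding mult_mat_index[OF dg_carrier perm_matrix_carrier ij] using ij
    by (intro sum.cong refl) (auto simp: perm_matrix_def dg_def)
  moreover have "?R $$ (i, j) = (\<Sum>l<n. if l = j then if i = \<sigma> j then t i else 0 else 0)"
    unfolding mult_mat_index[OF perm_matrix_carrier dg_carrier ij] using ij
    by (intro sum.cong refl) (auto simp: perm_matrix_def dg_def)
  ultimately show "(dg n t * perm_matrix n \<sigma>) $$ (i, j) = ?R $$ (i, j)" using ij by simp
qed (auto simp: perm_matrix_def dg_def)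

context polyrep begin

definition diagw :: "(nat \<times> nat \<Rightarrow>\<^sub>0 nat) \<Rightarrow> nat \<Rightarrow> nat" where
  "diagw \<alpha> = (\<lambda>i. if i < n then Poly_Mapping.lookup \<alpha> (i, i) else 0)"

definition W :: "(nat \<Rightarrow> nat) set" where
  "W = (\<Union>a<m. \<Union>b<m. diagw ` Poly_Mapping.keys (P a b))"

text \<open>The coefficient of the monomial with exponent \<open>\<nu>\<close> in
  \<open>\<rho> (dg n t)\<close>, that is, the projection to the weight space. Monomials with an
  off-diagonal variable vanish on diagonal matrices and contribute 0.\<close>

definition Pw :: "(nat \<Rightarrow> nat) \<Rightarrow> 'a mat" where
  "Pw \<nu> = mat m m (\<lambda>(a, b). \<Sum>\<alpha>\<in>{\<alpha> \<in> Poly_Mapping.keys (P a b). diagw \<alpha> = \<nu>}.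
     if Poly_Mapping.keys \<alpha> \<subseteq> (\<lambda>i. (i, i)) ` {..<n} then Poly_Mapping.lookup (P a b) \<alpha> else 0)"

text \<open>The multiplicity of the weight, as the trace of the projection.\<close>

definition wt_mult :: "(nat \<Rightarrow> nat) \<Rightarrow> 'a" where "wt_mult \<nu> = tr m (Pw \<nu>)"

lemma Pw_carrier [simp]: "Pw \<nu> \<in> carrier_mat m m" by (simp add: Pw_def)
lemma Pw_dim [simp]: "dim_row (Pw \<nu>) = m" "dim_col (Pw \<nu>) = m" by (simp_all add: Pw_def)
lemma finite_W [simp]: "finite W" by (simp add: W_def)
lemma W_supp: "\<nu> \<in> W \<Longrightarrow> i \<ge> n \<Longrightarrow> \<nu> i = 0" by (auto simp: W_def diagw_def)

lemma Pw_notin: "\<nu> \<notin> W \<Longrightarrow> Pw \<nu> = 0\<^sub>m m m"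
  by (rule eq_matI) (auto simp: Pw_def W_def intro!: sum.neutral)

lemma wt_mult_notin: "\<nu> \<notin> W \<Longrightarrow> wt_mult \<nu> = 0"
  by (simp add: wt_mult_def Pw_notin tr_def)

lemma mp_mon_dg:
  "mp_mon (mat_vars n (dg n x)) \<alpha> =
    (if Poly_Mapping.keys \<alpha> \<subseteq> (\<lambda>i. (i, i)) ` {..<n} then wmon n x (diagw \<alpha>) else (0 :: 'r :: comm_ring_1))"
proof (cases "Poly_Mapping.keys \<alpha> \<subseteq> (\<lambda>i. (i, i)) ` {..<n}")
  case True
  then have "mp_mon (mat_vars n (dg n x)) \<alpha> =
      (\<Prod>v\<in>(\<lambda>i. (i, i)) ` {..<n}. mat_vars n (dg n x) v ^ Poly_Mapping.lookup \<alpha> v)"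
    by (intro mp_mon_superset) auto
  also have "\<dots> = (\<Prod>i<n. mat_vars n (dg n x) (i, i) ^ Poly_Mapping.lookup \<alpha> (i, i))"
    by (subst prod.reindex) (auto simp: inj_on_def)
  also have "\<dots> = wmon n x (diagw \<alpha>)"
    by (auto simp: wmon_def diagw_def mat_vars_def dg_def intro!: prod.cong)
  finally show ?thesis using True by simp
next
  case False
  then obtain i j where ij: "(i, j) \<in> Poly_Mapping.keys \<alpha>" "(i, j) \<notin> (\<lambda>i. (i, i)) ` {..<n}" by auto
  then have "mat_vars n (dg n x) (i, j) = 0" by (auto simp: mat_vars_def dg_def)
  moreover have "Poly_Mapping.lookup \<alpha> (i, j) > 0" using ij by (simp add: in_keys_iff)
  ultimately have "mp_mon (mat_vars n (dg n x)) \<alpha> = 0"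
    unfolding mp_mon_def using ij(1) by (intro prod_zero) (auto simp: power_0_left intro!: bexI[of _ "(i, j)"])
  then show ?thesis using False by simp
qed

lemma ext_dg:
  fixes \<phi> :: "'a \<Rightarrow> 'r :: comm_ring_1"
  assumes "comm_ring_hom \<phi>" "a < m" "b < m"
  shows "ext \<phi> (dg n x) $$ (a, b) = (\<Sum>\<nu>\<in>W. \<phi> (Pw \<nu> $$ (a, b)) * wmon n x \<nu>)"
proof -
  interpret \<phi>: comm_ring_hom \<phi> by fact
  let ?K = "Poly_Mapping.keys (P a b)"
  let ?c = "\<lambda>\<alpha>. if Poly_Mapping.keys \<alpha> \<subseteq> (\<lambda>i. (i, i)) ` {..<n} then Poly_Mapping.lookup (P a b) \<alpha> else 0"
  have "ext \<phi> (dg n x) $$ (a, b) = (\<Sum>\<alpha>\<in>?K. \<phi> (?c \<alpha>) * wmon n x (diagw \<alpha>))"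
    using assms by (auto simp: ext_def mp_ev_def mp_mon_dg intro!: sum.cong)
  also have "\<dots> = (\<Sum>\<nu>\<in>W. \<Sum>\<alpha>\<in>{\<alpha> \<in> ?K. diagw \<alpha> = \<nu>}. \<phi> (?c \<alpha>) * wmon n x (diagw \<alpha>))"
    by (rule sum.group[symmetric]) (use assms in \<open>auto simp: W_def\<close>)
  also have "\<dots> = (\<Sum>\<nu>\<in>W. \<phi> (Pw \<nu> $$ (a, b)) * wmon n x \<nu>)"
    using assms by (intro sum.cong refl) (auto simp: Pw_def \<phi>.hom_sum sum_distrib_right intro!: sum.cong)
  finally show ?thesis .
qed

lemma id_comm_ring_hom: "comm_ring_hom (\<lambda>c :: 'a. c)" by unfold_locales auto

lemma \<rho>_dg:
  assumes "\<And>i. i < n \<Longrightarrow> t i \<noteq> 0"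
  shows "\<rho> (dg n t) = msum m W (\<lambda>\<nu>. wmon n t \<nu> \<cdot>\<^sub>m Pw \<nu>)"
  using ext_dg[OF id_comm_ring_hom, of _ _ t] \<rho>_carrier[OF dg_GL, of t] assms
  by (intro eq_matI) (auto simp: msum_def ext_id[OF dg_GL] mult.commute)

text \<open>Comparison of the coefficients of the monomials in x on both sides of \<open>\<rho> (dg
  n t) * \<rho> (dg n x) = \<rho> (dg n (\<lambda>i. t i * x i))\<close>.\<close>

lemma \<rho>_dg_Pw:
  assumes t: "\<And>i. i < n \<Longrightarrow> t i \<noteq> 0" and \<nu>: "\<nu> \<in> W"
  shows "\<rho> (dg n t) * Pw \<nu> = wmon n t \<nu> \<cdot>\<^sub>m Pw \<nu>"
proof -
  have R: "\<rho> (dg n t) \<in> carrier_mat m m" by (rule \<rho>_carrier[OF dg_GL[of n t, OF t]])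
  show ?thesis
proof (rule eq_matI)
  fix a b assume "a < dim_row (wmon n t \<nu> \<cdot>\<^sub>m Pw \<nu>)" "b < dim_col (wmon n t \<nu> \<cdot>\<^sub>m Pw \<nu>)"
  then have ab: "a < m" "b < m" by auto
  have "(\<rho> (dg n t) * Pw \<nu>) $$ (a, b) - wmon n t \<nu> * Pw \<nu> $$ (a, b) = 0"
  proof (rule monomials_independent[where n = n and W = W and \<nu> = \<nu>
        and c = "\<lambda>\<nu>. (\<rho> (dg n t) * Pw \<nu>) $$ (a, b) - wmon n t \<nu> * Pw \<nu> $$ (a, b)"])
    fix x :: "nat \<Rightarrow> 'a" assume x: "\<And>i. i < n \<Longrightarrow> x i \<noteq> 0"
    have "\<rho> (dg n t) * \<rho> (dg n x) = \<rho> (dg n (\<lambda>i. t i * x i))"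
      using \<rho>_mult[OF dg_GL[of n t, OF t] dg_GL[of n x, OF x]] by (simp add: dg_mult)
    also have "\<dots> = msum m W (\<lambda>\<nu>. wmon n (\<lambda>i. t i * x i) \<nu> \<cdot>\<^sub>m Pw \<nu>)"
      using t x by (intro \<rho>_dg) auto
    also have "\<rho> (dg n t) * \<rho> (dg n x) = msum m W (\<lambda>\<nu>. wmon n x \<nu> \<cdot>\<^sub>m (\<rho> (dg n t) * Pw \<nu>))"
      using R by (subst \<rho>_dg[of x], use x in simp, subst mult_msum) (auto intro!: msum_cong mult_smult_distrib[of _ m m])
    finally have "msum m W (\<lambda>\<nu>. wmon n x \<nu> \<cdot>\<^sub>m (\<rho> (dg n t) * Pw \<nu>)) $$ (a, b) =
        msum m W (\<lambda>\<nu>. wmon n (\<lambda>i. t i * x i) \<nu> \<cdot>\<^sub>m Pw \<nu>) $$ (a, b)" by simp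
    then show "(\<Sum>\<nu>\<in>W. ((\<rho> (dg n t) * Pw \<nu>) $$ (a, b) - wmon n t \<nu> * Pw \<nu> $$ (a, b)) * (\<Prod>i<n. x i ^ \<nu> i)) = 0"
      using ab R by (simp add: msum_def wmon_mult wmon_def[of n x, symmetric] right_diff_distrib sum_subtractf mult_ac)
  qed (use W_supp \<nu> in auto)
  then show "(\<rho> (dg n t) * Pw \<nu>) $$ (a, b) = (wmon n t \<nu> \<cdot>\<^sub>m Pw \<nu>) $$ (a, b)"
    using ab by simp
qed (use R in auto)
qed

text \<open>Differentiation of \<open>\<rho>_dg_Pw\<close> along the torus element with 1 + s in
  place \<open>i\<close> and 1 elsewhere.\<close>

lemma E_Pw:
  assumes i: "i < n" and \<nu>: "\<nu> \<in> W"
  shows "E i i * Pw \<nu> = of_nat (\<nu> i) \<cdot>\<^sub>m Pw \<nu>"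
proof -
  define F where "F = cext (lin n (elem n i i))"
  have Fc: "F \<in> carrier_mat m m" by (simp add: F_def)
  have "F * const_mat (Pw \<nu>) = [:1, 1:] ^ \<nu> i \<cdot>\<^sub>m const_mat (Pw \<nu>)"
  proof (rule poly_mat_eqI)
    fix r
    define s where "s = (of_nat r :: 'a)"
    have "of_nat (Suc r) \<noteq> (0 :: 'a)" by (rule of_nat_neq_0)
    then have s1: "1 + s \<noteq> 0" by (simp add: s_def)
    define t where "t = (\<lambda>k. if k = i then 1 + s else 1)"
    have t: "t k \<noteq> 0" for k using s1 by (simp add: t_def)
    have "ev_mat s F = ext (\<lambda>c. c) (1\<^sub>m n + s \<cdot>\<^sub>m elem n i i)"
      unfolding F_def by (simp add: ev_cext lin_ev)
    also have "1\<^sub>m n + s \<cdot>\<^sub>m elem n i i = dg n t"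
      by (rule eq_matI) (auto simp: dg_def elem_def t_def)
    finally have "ev_mat s F = \<rho> (dg n t)" by (simp add: ext_id[OF dg_GL] t)
    then have "ev_mat s (F * const_mat (Pw \<nu>)) = wmon n t \<nu> \<cdot>\<^sub>m Pw \<nu>"
      using Fc \<nu> by (simp add: ev_mat_mult[of _ m m _ m] \<rho>_dg_Pw t)
    also have "wmon n t \<nu> = (\<Prod>k<n. if k = i then (1 + s) ^ \<nu> i else 1)"
      unfolding wmon_def by (intro prod.cong) (auto simp: t_def)
    also have "\<dots> = (1 + s) ^ \<nu> i" using i by simp
    also have "\<dots> \<cdot>\<^sub>m Pw \<nu> = ev_mat s ([:1, 1:] ^ \<nu> i \<cdot>\<^sub>m const_mat (Pw \<nu>))"
      by (rule eq_matI) (auto simp: ev_mat_def const_mat_def)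
    finally show "ev_mat (of_nat r) (F * const_mat (Pw \<nu>)) = ev_mat (of_nat r) ([:1, 1:] ^ \<nu> i \<cdot>\<^sub>m const_mat (Pw \<nu>))"
      by (simp add: s_def)
  next
    show "F * const_mat (Pw \<nu>) \<in> carrier_mat m m" using Fc by (intro mult_carrier_mat[of _ m m]) auto
    show "[:1, 1:] ^ \<nu> i \<cdot>\<^sub>m const_mat (Pw \<nu>) \<in> carrier_mat m m" by (intro smult_carrier_mat) simp
  qed
  then have "coeff_mat (Suc 0) (F * const_mat (Pw \<nu>)) = coeff_mat (Suc 0) ([:1, 1:] ^ \<nu> i \<cdot>\<^sub>m const_mat (Pw \<nu>))"
    by simp
  also have "coeff_mat (Suc 0) (F * const_mat (Pw \<nu>)) = E i i * Pw \<nu>"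
  proof -
    have "coeff_mat (Suc 0) (const_mat (Pw \<nu>)) = 0\<^sub>m m m" "coeff_mat 0 (const_mat (Pw \<nu>)) = Pw \<nu>"
      by (auto simp: coeff_mat_def const_mat_def intro!: eq_matI)
    moreover have "coeff_mat 0 F = 1\<^sub>m m" "coeff_mat (Suc 0) F = E i i"
      by (auto simp: F_def coeff_0_lin e_def)
    ultimately show ?thesis using Fc
      by (simp add: coeff_1_mult[of _ m m _ m] right_mult_zero_mat[of _ m m] left_add_zero_mat[OF mult_carrier_mat[of _ m m _ m]])
  qed
  also have "coeff_mat (Suc 0) ([:1, 1:] ^ \<nu> i \<cdot>\<^sub>m const_mat (Pw \<nu>)) = of_nat (\<nu> i) \<cdot>\<^sub>m Pw \<nu>"
    by (rule eq_matI) (auto simp: coeff_mat_def const_mat_def coeff_1_linear_power)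
  finally show ?thesis .
qed

lemma tr_\<rho>_dg:
  assumes "\<And>i. i < n \<Longrightarrow> t i \<noteq> 0"
  shows "tr m (\<rho> (dg n t)) = (\<Sum>\<nu>\<in>W. wt_mult \<nu> * wmon n t \<nu>)"
  by (simp add: \<rho>_dg[of t, OF assms] tr_msum tr_smult wt_mult_def mult.commute)

lemma E_\<rho>_dg:
  assumes "\<And>i. i < n \<Longrightarrow> t i \<noteq> 0" "i < n"
  shows "E i i * \<rho> (dg n t) = msum m W (\<lambda>\<nu>. (wmon n t \<nu> * of_nat (\<nu> i)) \<cdot>\<^sub>m Pw \<nu>)"
  using assms
  by (subst \<rho>_dg[of t], simp, subst mult_msum)
    (auto intro!: msum_cong simp: mult_smult_distrib[OF e_carrier Pw_carrier] E_Pw smult_smult_mat)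

lemma tr_E_\<rho>_dg:
  assumes "\<And>i. i < n \<Longrightarrow> t i \<noteq> 0" "i < n"
  shows "tr m (E i i * \<rho> (dg n t)) = (\<Sum>\<nu>\<in>W. of_nat (\<nu> i) * wt_mult \<nu> * wmon n t \<nu>)"
  by (subst E_\<rho>_dg[of t]) (use assms in \<open>simp_all add: tr_msum tr_smult wt_mult_def mult_ac\<close>)

lemma tr_E_E_\<rho>_dg:
  assumes "\<And>i. i < n \<Longrightarrow> t i \<noteq> 0" "i < n"
  shows "tr m (E i i * E i i * \<rho> (dg n t)) = (\<Sum>\<nu>\<in>W. of_nat (\<nu> i) ^ 2 * wt_mult \<nu> * wmon n t \<nu>)"
proof -
  have "E i i * E i i * \<rho> (dg n t) = E i i * (E i i * \<rho> (dg n t))"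
    using \<rho>_carrier[OF dg_GL[of n t, OF assms(1)]] by (intro assoc_mult_mat) auto
  also have "\<dots> = msum m W (\<lambda>\<nu>. (wmon n t \<nu> * of_nat (\<nu> i) * of_nat (\<nu> i)) \<cdot>\<^sub>m Pw \<nu>)"
    using assms
    by (subst E_\<rho>_dg[of t], simp, simp, subst mult_msum)
      (auto intro!: msum_cong simp: mult_smult_distrib[OF e_carrier Pw_carrier] E_Pw smult_smult_mat)
  finally show ?thesis by (simp add: tr_msum tr_smult wt_mult_def mult_ac power2_eq_square)
qed

lemma tr_conj:
  assumes "g \<in> GL n" "p \<in> GL n" "q \<in> GL n" "q * p = 1\<^sub>m n"
  shows "tr m (\<rho> (p * g * q)) = tr m (\<rho> g)"
proof -
  have c: "g \<in> carrier_mat n n" "p \<in> carrier_mat n n" "q \<in> carrier_mat n n" using assms by (auto simp: GL_iff_det)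
  have "tr m (\<rho> (p * g * q)) = tr m (\<rho> (p * g) * \<rho> q)" using assms by (simp add: \<rho>_mult GL_mult)
  also have "\<dots> = tr m (\<rho> q * \<rho> (p * g))"
    using assms by (intro tr_comm \<rho>_carrier GL_mult)
  also have "\<rho> q * \<rho> (p * g) = \<rho> (q * (p * g))" using assms by (simp add: \<rho>_mult GL_mult)
  also have "q * (p * g) = (q * p) * g" using c by (intro assoc_mult_mat[symmetric]) auto
  finally show ?thesis using assms(4) c by simp
qed

text \<open>Conjugation by a permutation matrix permutes the entries of a diagonal matrix and
  preserves the trace; the coefficients of the two expansions are then compared.\<close>

lemma wt_mult_symmetric:
  assumes \<sigma>: "\<sigma> permutes {..<n}"
  shows "wt_mult (\<lambda>i. \<nu> (\<sigma> i)) = wt_mult \<nu>"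
proof -
  define f where "f \<nu> = (\<lambda>i :: nat. \<nu> (Hilbert_Choice.inv \<sigma> i) :: nat)" for \<nu>
  define g where "g \<nu> = (\<lambda>i :: nat. \<nu> (\<sigma> i) :: nat)" for \<nu>
  have fg: "f (g \<nu>) = \<nu>" "g (f \<nu>) = \<nu>" for \<nu>
    using permutes_inverses[OF \<sigma>] by (simp_all add: f_def g_def)
  have supp: "f \<nu> i = 0" if "\<nu> \<in> W" "i \<ge> n" for \<nu> i
  proof -
    have "Hilbert_Choice.inv \<sigma> i = i" using permutes_not_in[OF permutes_inv[OF \<sigma>], of i] that by simp
    then show ?thesis using W_supp that by (simp add: f_def)
  qed
  \<comment> \<open>\<open>W\<close> is read off from the chosen polynomials and need not be stable
    under permutations. \<open>V\<close> contains the exponents of both expansions.\<close>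
  define V where "V = W \<union> f ` W"
  have V: "finite V" "\<And>\<nu> i. \<nu> \<in> V \<Longrightarrow> i \<ge> n \<Longrightarrow> \<nu> i = 0" using W_supp supp by (auto simp: V_def)
  have eq: "wt_mult (g \<mu>) - wt_mult \<mu> = 0" if "\<mu> \<in> V" for \<mu>
  proof (rule monomials_independent[where n = n and W = V and c = "\<lambda>\<mu>. wt_mult (g \<mu>) - wt_mult \<mu>"])
    fix x :: "nat \<Rightarrow> 'a" assume x: "\<And>i. i < n \<Longrightarrow> x i \<noteq> 0"
    have x': "x (\<sigma> i) \<noteq> 0" if "i < n" for i using x permutes_in_image[OF \<sigma>, of i] that by simp
    have P: "perm_matrix n \<sigma> \<in> GL n" "perm_matrix n (Hilbert_Choice.inv \<sigma>) \<in> GL n" "dg n (\<lambda>i. x (\<sigma> i)) \<in> GL n"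
      by (auto intro: perm_matrix_GL \<sigma> permutes_inv) (rule dg_GL, rule x')
    have inv: "perm_matrix n (Hilbert_Choice.inv \<sigma>) * perm_matrix n \<sigma> = (1\<^sub>m n :: 'a mat)" "perm_matrix n \<sigma> * perm_matrix n (Hilbert_Choice.inv \<sigma>) = (1\<^sub>m n :: 'a mat)"
      using perm_matrix_mult[OF \<sigma>, of "Hilbert_Choice.inv \<sigma>"] perm_matrix_mult[OF permutes_inv[OF \<sigma>], of \<sigma>] permutes_inv_o[OF \<sigma>]
      by (simp_all add: perm_matrix_id)
    have "perm_matrix n \<sigma> * dg n (\<lambda>i. x (\<sigma> i)) * perm_matrix n (Hilbert_Choice.inv \<sigma>) = dg n x * perm_matrix n \<sigma> * perm_matrix n (Hilbert_Choice.inv \<sigma>)"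
      by (simp add: dg_perm_matrix[OF \<sigma>])
    also have "\<dots> = dg n x * (perm_matrix n \<sigma> * perm_matrix n (Hilbert_Choice.inv \<sigma>))" by (rule assoc_mult_mat[of _ n n _ n _ n]) auto
    also have "\<dots> = dg n x" using inv(2) by (simp add: right_mult_one_mat[OF dg_carrier])
    finally have "tr m (\<rho> (dg n x)) = tr m (\<rho> (dg n (\<lambda>i. x (\<sigma> i))))"
      using tr_conj[OF P(3,1,2) inv(1)] by simp
    also have "\<dots> = (\<Sum>\<nu>\<in>W. wt_mult \<nu> * wmon n (\<lambda>i. x (\<sigma> i)) \<nu>)" by (rule tr_\<rho>_dg) (rule x')
    also have "\<dots> = (\<Sum>\<nu>\<in>W. wt_mult (g (f \<nu>)) * wmon n x (f \<nu>))"
    proof (rule sum.cong)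
      fix \<nu>
      have "wmon n (\<lambda>i. x (\<sigma> i)) \<nu> = (\<Prod>i<n. x (\<sigma> i) ^ f \<nu> (\<sigma> i))"
        by (simp add: wmon_def f_def permutes_inverses[OF \<sigma>])
      also have "\<dots> = wmon n x (f \<nu>)"
        unfolding wmon_def using prod.permute[OF \<sigma>, of "\<lambda>i. x i ^ f \<nu> i"] by (simp add: o_def)
      finally show "wt_mult \<nu> * wmon n (\<lambda>i. x (\<sigma> i)) \<nu> = wt_mult (g (f \<nu>)) * wmon n x (f \<nu>)" by (simp add: fg)
    qed simp
    also have "\<dots> = (\<Sum>\<mu>\<in>f ` W. wt_mult (g \<mu>) * wmon n x \<mu>)"
      by (rule sum.reindex[symmetric, unfolded o_def]) (metis fg(2) inj_onI)
    also have "\<dots> = (\<Sum>\<mu>\<in>V. wt_mult (g \<mu>) * wmon n x \<mu>)"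
    proof (rule sum.mono_neutral_left)
      show "\<forall>\<mu>\<in>V - f ` W. wt_mult (g \<mu>) * wmon n x \<mu> = 0"
      proof
        fix \<mu> assume "\<mu> \<in> V - f ` W"
        then have "g \<mu> \<notin> W" using fg(1)[of \<mu>] by (metis DiffE image_eqI)
        then show "wt_mult (g \<mu>) * wmon n x \<mu> = 0" by (simp add: wt_mult_notin)
      qed
    qed (use V in \<open>auto simp: V_def\<close>)
    also have "tr m (\<rho> (dg n x)) = (\<Sum>\<mu>\<in>W. wt_mult \<mu> * wmon n x \<mu>)" by (rule tr_\<rho>_dg) (rule x)
    also have "\<dots> = (\<Sum>\<mu>\<in>V. wt_mult \<mu> * wmon n x \<mu>)"
      using V by (intro sum.mono_neutral_left) (auto simp: V_def wt_mult_notin)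
    finally show "(\<Sum>\<mu>\<in>V. (wt_mult (g \<mu>) - wt_mult \<mu>) * (\<Prod>i<n. x i ^ \<mu> i)) = 0"
      by (simp add: wmon_def left_diff_distrib sum_subtractf)
  qed (use V that in auto)
  show ?thesis
  proof (cases "\<nu> \<in> V")
    case True
    then show ?thesis using eq[of \<nu>] by (simp add: g_def)
  next
    case False
    then have "\<nu> \<notin> W" "g \<nu> \<notin> W" using fg(1)[of \<nu>] by (auto simp: V_def) (metis image_eqI)
    then show ?thesis by (simp add: wt_mult_notin g_def[symmetric])
  qed
qed

end

section \<open>Weights and the character\<close>

context hwrep begin

text \<open>The Euler derivative of the character: \<open>t i\<close> times the partial derivative
  by the i-th variable.\<close>

abbreviation dwt :: "(nat \<Rightarrow> 'a) \<Rightarrow> nat \<Rightarrow> 'a" where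
  "dwt t i \<equiv> \<Sum>\<nu>\<in>W. of_nat (\<nu> i) * wt_mult \<nu> * wmon n t \<nu>"

text \<open>Cyclicity of the trace moves \<open>E i j\<close> past the torus element and gives X =
  (t i / t j) Y for the traces X and Y of the two orders; the bracket gives X - Y as a difference of
  Euler derivatives. As \<open>t i \<noteq> t j\<close>, the two equations determine X.\<close>

lemma tr_E_E:
  assumes t: "\<And>i. i < n \<Longrightarrow> t i \<noteq> 0" and ij: "i < n" "j < n" "i \<noteq> j" "t i \<noteq> t j"
  shows "tr m (E i j * E j i * \<rho> (dg n t)) = t i / (t i - t j) * (dwt t i - dwt t j)"
proof -
  define R where "R = \<rho> (dg n t)"
  have tG: "dg n t \<in> GL n" by (rule dg_GL) (rule t)
  have R: "R \<in> carrier_mat m m" unfolding R_def by (rule \<rho>_carrier[OF tG])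
  have mc: "A * B \<in> carrier_mat m m" if "A \<in> carrier_mat m m" "B \<in> carrier_mat m m" for A B :: "'a mat"
    using that by (rule mult_carrier_mat)
  have RE: "R * E i j = (t i / t j) \<cdot>\<^sub>m (E i j * R)"
  proof -
    have "dg n (\<lambda>i. 1 / t i) * dg n t = 1\<^sub>m n"
      unfolding dg_mult using t by (intro dg_one) auto
    then have "R * E i j = e (dg n t * elem n i j * dg n (\<lambda>i. 1 / t i)) * R"
      unfolding R_def by (intro e_equivariant[OF tG]) auto
    also have "dg n t * elem n i j * dg n (\<lambda>i. 1 / t i) = (t i / t j) \<cdot>\<^sub>m elem n i j"
      using ij by (simp add: dg_conjugate_elem)
    also have "e \<dots> * R = (t i / t j) \<cdot>\<^sub>m (E i j * R)"
      using R by (simp add: e_smult mult_smult_assoc_mat[OF e_carrier R])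
    finally show ?thesis .
  qed
  have "tr m (E i j * E j i * R) = tr m (E j i * (R * E i j))"
    using R by (intro tr_mult3) auto
  also have "\<dots> = t i / t j * tr m (E j i * (E i j * R))"
    unfolding RE using R by (simp add: mult_smult_distrib[OF e_carrier mc[OF e_carrier R]] tr_smult mc)
  also have "E j i * (E i j * R) = E j i * E i j * R"
    using R by (simp add: assoc_mult_mat[of _ m m _ m _ m])
  finally have y: "tr m (E i j * E j i * R) = t i / t j * tr m (E j i * E i j * R)" .
  have "tr m ((E i j * E j i + E j j) * R) = tr m ((E j i * E i j + E i i) * R)"
    using ij by (simp only: E_bracket)
  then have "tr m (E i j * E j i * R) + tr m (E j j * R) = tr m (E j i * E i j * R) + tr m (E i i * R)"
    using R by (simp add: add_mult_distrib_mat[OF mc[OF e_carrier e_carrier] e_carrier R] tr_add mc)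
  moreover have "tr m (E i i * R) = dwt t i" "tr m (E j j * R) = dwt t j"
    unfolding R_def using t ij by (auto intro: tr_E_\<rho>_dg)
  ultimately have b: "tr m (E i j * E j i * R) - tr m (E j i * E i j * R) = dwt t i - dwt t j"
    by (simp add: algebra_simps)
  have "t i \<noteq> 0" "t j \<noteq> 0" using t ij by auto
  define Y where "Y = tr m (E j i * E i j * R)"
  have "Y * (t i - t j) = t j * (dwt t i - dwt t j)"
    unfolding b[symmetric] y Y_def[symmetric] using \<open>t j \<noteq> 0\<close> by (simp add: field_simps)
  then have "Y = t j / (t i - t j) * (dwt t i - dwt t j)" using ij(4) by (simp add: field_simps)
  then show ?thesis
    unfolding R_def[symmetric] y Y_def[symmetric] using \<open>t j \<noteq> 0\<close> by simp
qed

text \<open>Both sides are the trace of the Casimir operator composed with \<open>\<rho> (diag t)\<close>: the off-diagonal part of the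
  right-hand one comes from moving \<open>E\<^sub>k\<^sub>l\<close> cyclically past the torus element.\<close>

lemma radial:
  assumes t: "\<And>i. i < n \<Longrightarrow> t i \<noteq> 0" and inj: "inj_on t {..<n}"
  shows "\<kappa> * (\<Sum>\<nu>\<in>W. wt_mult \<nu> * wmon n t \<nu>) =
    (\<Sum>i<n. \<Sum>\<nu>\<in>W. of_nat (\<nu> i) ^ 2 * wt_mult \<nu> * wmon n t \<nu>) +
    2 * (\<Sum>i<n. (\<Sum>j\<in>{..<n} - {i}. t i / (t i - t j)) * dwt t i)"
proof -
  define R where "R = \<rho> (dg n t)"
  have tG: "dg n t \<in> GL n" by (rule dg_GL) (rule t)
  have R: "R \<in> carrier_mat m m" unfolding R_def by (rule \<rho>_carrier[OF tG])
  have mc: "A * B \<in> carrier_mat m m" if "A \<in> carrier_mat m m" "B \<in> carrier_mat m m" for A B :: "'a mat"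
    using that by (rule mult_carrier_mat)
  have ne: "t i - t j \<noteq> 0" if "i < n" "j < n" "i \<noteq> j" for i j
    using inj that by (auto simp: inj_on_def)
  define d where "d = dwt t"
  define q where "q i j = t i / (t i - t j)" for i j
  define D2 where "D2 i = (\<Sum>\<nu>\<in>W. of_nat (\<nu> i) ^ 2 * wt_mult \<nu> * wmon n t \<nu>)" for i
  let ?I = "{..<n} \<times> {..<n}"
  have trE: "tr m (E k k * R) = d k" if "k < n" for k
    unfolding R_def d_def by (rule tr_E_\<rho>_dg) (use t that in auto)
  have trEE: "tr m (E i j * E j i * R) = (if i = j then D2 i else q i j * (d i - d j))" if ij: "i < n" "j < n" for i j
  proof (cases "i = j")
    case True
    have "tr m (E i i * E i i * R) = D2 i"
      unfolding R_def D2_def by (rule tr_E_E_\<rho>_dg) (use t ij in auto)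
    then show ?thesis using True by simp
  next
    case False
    then have "t i \<noteq> t j" using ne[OF ij False] by simp
    then have "tr m (E i j * E j i * R) = q i j * (d i - d j)"
      unfolding R_def q_def d_def by (intro tr_E_E) (use t ij False in auto)
    then show ?thesis using False by simp
  qed
  have "tr m (e (1\<^sub>m n) * R) = (\<Sum>i<n. d i)"
  proof -
    have "e (1\<^sub>m n) * R = msum m ?I (\<lambda>p. (case p of (k, l) \<Rightarrow> (1\<^sub>m n :: 'a mat) $$ (k, l) \<cdot>\<^sub>m E k l) * R)"
      unfolding e_expand[OF one_carrier_mat] using R by (intro msum_mult) auto
    also have "tr m \<dots> = (\<Sum>(k, l)\<in>?I. if k = l then d k else 0)"
      unfolding tr_msum
    proof (rule sum.cong, rule refl, unfold split_paired_all prod.case)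
      fix k l assume "(k, l) \<in> ?I"
      then have kl: "k < n" "l < n" by auto
      have "tr m (c \<cdot>\<^sub>m E k l * R) = c * tr m (E k l * R)" for c
        unfolding mult_smult_assoc_mat[OF e_carrier R] by (rule tr_smult[OF mc[OF e_carrier R]])
      then show "tr m ((1\<^sub>m n :: 'a mat) $$ (k, l) \<cdot>\<^sub>m E k l * R) = (if k = l then d k else 0)"
        using kl trE[of k] by (cases "k = l") simp_all
    qed
    also have "\<dots> = (\<Sum>k<n. \<Sum>l<n. if k = l then d k else 0)" by (simp only: sum.cartesian_product)
    finally show ?thesis by simp
  qed
  moreover have "tr m (msum m ?I (\<lambda>(i, j). E i j * E j i) * R) =
      (\<Sum>i<n. \<Sum>j<n. if i = j then D2 i else q i j * (d i - d j))"
  proof -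
    have *: "msum m ?I (\<lambda>(i, j). E i j * E j i) * R = msum m ?I (\<lambda>p. (case p of (i, j) \<Rightarrow> E i j * E j i) * R)"
    proof (rule msum_mult[OF R])
      fix p assume "p \<in> ?I"
      obtain i j where p: "p = (i, j)" by force
      show "(case p of (i, j) \<Rightarrow> E i j * E j i) \<in> carrier_mat m m"
        unfolding p prod.case by (rule mc[OF e_carrier e_carrier])
    qed
    have "tr m (msum m ?I (\<lambda>(i, j). E i j * E j i) * R) = (\<Sum>(i, j)\<in>?I. if i = j then D2 i else q i j * (d i - d j))"
      unfolding * tr_msum
    proof (rule sum.cong)
      fix p assume "p \<in> ?I"
      then obtain i j where p: "p = (i, j)" "i < n" "j < n" by auto
      show "tr m ((case p of (i, j) \<Rightarrow> E i j * E j i) * R) = (case p of (i, j) \<Rightarrow> if i = j then D2 i else q i j * (d i - d j))"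
        unfolding p prod.case by (rule trEE[OF p(2,3)])
    qed (rule refl)
    also have "\<dots> = (\<Sum>i<n. \<Sum>j<n. if i = j then D2 i else q i j * (d i - d j))"
      by (simp only: sum.cartesian_product)
    finally show ?thesis .
  qed
  moreover have "tr m (Cas * R) = tr m (msum m ?I (\<lambda>(i, j). E i j * E j i) * R) + of_nat (n - 1) * tr m (e (1\<^sub>m n) * R)"
    unfolding Cas_def using R
    by (subst add_mult_distrib_mat[of _ m m _ _ m])
      (simp_all add: tr_add mc mult_smult_assoc_mat[OF e_carrier R] tr_smult)
  moreover have "tr m (Cas * R) = \<kappa> * (\<Sum>\<nu>\<in>W. wt_mult \<nu> * wmon n t \<nu>)"
  proof -
    have "Cas * R = \<kappa> \<cdot>\<^sub>m R"
      unfolding Cas_scalar using R by (simp add: mult_smult_assoc_mat[of _ m m _ m])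
    moreover have "tr m R = (\<Sum>\<nu>\<in>W. wt_mult \<nu> * wmon n t \<nu>)"
      unfolding R_def by (rule tr_\<rho>_dg) (rule t)
    ultimately show ?thesis using R by (simp add: tr_smult)
  qed
  ultimately have eq: "\<kappa> * (\<Sum>\<nu>\<in>W. wt_mult \<nu> * wmon n t \<nu>) =
      (\<Sum>i<n. \<Sum>j<n. if i = j then D2 i else q i j * (d i - d j)) + of_nat (n - 1) * (\<Sum>i<n. d i)"
    by (simp only:)
  have split: "(\<Sum>j<n. if i = j then x else f j) = x + (\<Sum>j\<in>{..<n} - {i}. f j)" if "i < n" for i x and f :: "nat \<Rightarrow> 'a"
    using that by (subst sum.remove[of _ i]) (auto intro!: sum.cong)
  \<comment> \<open>The identity \<open>q j i = 1 - q i j\<close> doubles the first-order term; the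
    summand with \<open>n - 1\<close> cancels against the central term of
    \<open>Cas\<close>.\<close>
  have off: "(\<Sum>i<n. \<Sum>j\<in>{..<n} - {i}. q i j * d j) =
      (\<Sum>i<n. of_nat (n - 1) * d i) - (\<Sum>i<n. (\<Sum>j\<in>{..<n} - {i}. q i j) * d i)"
  proof -
    have "(\<Sum>i<n. \<Sum>j\<in>{..<n} - {i}. q i j * d j) = (\<Sum>(i, j)\<in>Sigma {..<n} (\<lambda>i. {..<n} - {i}). q i j * d j)"
      by (rule sum.Sigma) auto
    also have "\<dots> = (\<Sum>(i, j)\<in>Sigma {..<n} (\<lambda>i. {..<n} - {i}). q j i * d i)"
      by (rule sum.reindex_bij_witness[of _ prod.swap prod.swap]) auto
    also have "\<dots> = (\<Sum>i<n. \<Sum>j\<in>{..<n} - {i}. q j i * d i)"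
      by (rule sum.Sigma[symmetric]) auto
    also have "\<dots> = (\<Sum>i<n. \<Sum>j\<in>{..<n} - {i}. d i - q i j * d i)"
    proof (intro sum.cong refl)
      fix i j assume "i \<in> {..<n}" "j \<in> {..<n} - {i}"
      then have "t i - t j \<noteq> 0" "t j - t i \<noteq> 0" using ne[of i j] ne[of j i] by auto
      then have "q j i = 1 - q i j" by (simp add: q_def field_simps)
      then show "q j i * d i = d i - q i j * d i" by (simp add: left_diff_distrib)
    qed
    also have "\<dots> = (\<Sum>i<n. of_nat (n - 1) * d i - (\<Sum>j\<in>{..<n} - {i}. q i j) * d i)"
      by (intro sum.cong refl) (simp add: sum_subtractf sum_distrib_right)
    finally show ?thesis by (simp add: sum_subtractf)
  qed
  have "(\<Sum>i<n. \<Sum>j<n. if i = j then D2 i else q i j * (d i - d j)) =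
      (\<Sum>i<n. D2 i + (\<Sum>j\<in>{..<n} - {i}. q i j * (d i - d j)))"
    by (intro sum.cong refl split) simp
  also have "\<dots> = (\<Sum>i<n. D2 i) + (\<Sum>i<n. (\<Sum>j\<in>{..<n} - {i}. q i j) * d i) -
      (\<Sum>i<n. \<Sum>j\<in>{..<n} - {i}. q i j * d j)"
    by (simp add: sum.distrib sum_subtractf right_diff_distrib sum_distrib_right)
  finally have "\<kappa> * (\<Sum>\<nu>\<in>W. wt_mult \<nu> * wmon n t \<nu>) =
      (\<Sum>i<n. D2 i) + 2 * (\<Sum>i<n. (\<Sum>j\<in>{..<n} - {i}. q i j) * d i)"
    unfolding eq off by (simp add: sum_distrib_left)
  then show ?thesis by (simp only: D2_def d_def q_def)
qed

abbreviation S :: "(nat \<Rightarrow> nat) set" where "S \<equiv> {\<sigma>. \<sigma> permutes {..<n}}"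

text \<open>The exponent arising from the term of \<open>\<sigma>\<close> in the Vandermonde
  determinant and the weight \<open>\<nu>\<close>.\<close>

definition shift :: "(nat \<Rightarrow> nat) \<Rightarrow> (nat \<Rightarrow> nat) \<Rightarrow> nat \<Rightarrow> nat" where
  "shift \<sigma> \<nu> i = staircase n (\<sigma> i) + \<nu> i"

definition sqn :: "(nat \<Rightarrow> nat) \<Rightarrow> nat" where "sqn \<mu> = (\<Sum>i<n. \<mu> i ^ 2)"

definition Ld :: "nat \<Rightarrow> nat" where "Ld i = L i + staircase n i"

text \<open>After multiplication by the Vandermonde determinant, the denominators of
  \<open>radial\<close> become Euler derivatives of that determinant, and the first-order term
  becomes the cross term that completes the square in
  \<open>sqn (shift \<sigma> \<nu>)\<close>.\<close>

lemma casimir_coefficients: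
  assumes t: "\<And>i. i < n \<Longrightarrow> t i \<noteq> 0" and inj: "inj_on t {..<n}"
  shows "(\<Sum>(\<sigma>, \<nu>)\<in>S \<times> W. of_int (sign \<sigma>) * wt_mult \<nu> * (of_nat (sqn (shift \<sigma> \<nu>)) - of_nat (sqn Ld)) *
    wmon n t (shift \<sigma> \<nu>)) = 0"
proof -
  define D where "D = alternant n t (staircase n)"
  define Chi where "Chi = (\<Sum>\<nu>\<in>W. wt_mult \<nu> * wmon n t \<nu>)"
  define a where "a \<sigma> = of_int (sign \<sigma>) * wmon n t (\<lambda>i. staircase n (\<sigma> i))" for \<sigma>
  define b where "b \<nu> = wt_mult \<nu> * wmon n t \<nu>" for \<nu>
  have D: "D = (\<Sum>\<sigma>\<in>S. a \<sigma>)" by (simp add: D_def alternant_altdef a_def wmon_def)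
  have Chi: "Chi = (\<Sum>\<nu>\<in>W. b \<nu>)" by (simp add: Chi_def b_def)
  have euler: "D * (\<Sum>j\<in>{..<n} - {i}. t i / (t i - t j)) = (\<Sum>\<sigma>\<in>S. of_nat (staircase n (\<sigma> i)) * a \<sigma>)" if "i < n" for i
    unfolding D_def using Vandermonde_euler_derivative[OF inj that] by (simp add: a_def wmon_def mult_ac)
  have sq\<sigma>: "sqn (\<lambda>i. staircase n (\<sigma> i)) = sqn (staircase n)" if "\<sigma> \<in> S" for \<sigma>
    unfolding sqn_def using that sum.permute[of \<sigma> "{..<n}" "\<lambda>i. staircase n i ^ 2"] by (simp add: o_def)
  have rad: "D * (\<kappa> * Chi) = D * (\<Sum>i<n. \<Sum>\<nu>\<in>W. of_nat (\<nu> i) ^ 2 * b \<nu>) +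
      2 * (\<Sum>i<n. (D * (\<Sum>j\<in>{..<n} - {i}. t i / (t i - t j))) * (\<Sum>\<nu>\<in>W. of_nat (\<nu> i) * b \<nu>))"
  proof -
    have r: "\<kappa> * Chi = (\<Sum>i<n. \<Sum>\<nu>\<in>W. of_nat (\<nu> i) ^ 2 * b \<nu>) +
        2 * (\<Sum>i<n. (\<Sum>j\<in>{..<n} - {i}. t i / (t i - t j)) * (\<Sum>\<nu>\<in>W. of_nat (\<nu> i) * b \<nu>))"
      using radial[of t, OF t inj] by (simp only: Chi_def b_def mult.assoc)
    have "D * (x + 2 * (\<Sum>i<n. y i * z i)) = D * x + 2 * (\<Sum>i<n. (D * y i) * z i)" for x y z
      by (simp add: distrib_left sum_distrib_left mult_ac)
    then show ?thesis unfolding r by simp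
  qed
  have swap: "(\<Sum>i<n. \<Sum>\<nu>\<in>W. of_nat (\<nu> i) ^ 2 * b \<nu>) = (\<Sum>\<nu>\<in>W. of_nat (sqn \<nu>) * b \<nu>)"
    by (subst sum.swap) (simp add: sqn_def sum_distrib_right)
  have cross: "(\<Sum>i<n. (D * (\<Sum>j\<in>{..<n} - {i}. t i / (t i - t j))) * (\<Sum>\<nu>\<in>W. of_nat (\<nu> i) * b \<nu>)) =
      (\<Sum>(\<sigma>, \<nu>)\<in>S \<times> W. of_nat (\<Sum>i<n. staircase n (\<sigma> i) * \<nu> i) * (a \<sigma> * b \<nu>))"
  proof -
    have "(D * (\<Sum>j\<in>{..<n} - {i}. t i / (t i - t j))) * (\<Sum>\<nu>\<in>W. of_nat (\<nu> i) * b \<nu>) =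
        (\<Sum>p\<in>S \<times> W. of_nat (staircase n (fst p i) * snd p i) * (a (fst p) * b (snd p)))" if "i < n" for i
      unfolding euler[OF that] sum_product sum.cartesian_product by (intro sum.cong refl) auto
    then have "(\<Sum>i<n. (D * (\<Sum>j\<in>{..<n} - {i}. t i / (t i - t j))) * (\<Sum>\<nu>\<in>W. of_nat (\<nu> i) * b \<nu>)) =
        (\<Sum>i<n. \<Sum>p\<in>S \<times> W. of_nat (staircase n (fst p i) * snd p i) * (a (fst p) * b (snd p)))"
      by (intro sum.cong refl) auto
    also have "\<dots> = (\<Sum>p\<in>S \<times> W. \<Sum>i<n. of_nat (staircase n (fst p i) * snd p i) * (a (fst p) * b (snd p)))"
      by (rule sum.swap)
    finally show ?thesis by (simp only: case_prod_unfold of_nat_sum sum_distrib_right)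
  qed
  have sq: "D * (\<Sum>\<nu>\<in>W. of_nat (sqn \<nu>) * b \<nu>) = (\<Sum>(\<sigma>, \<nu>)\<in>S \<times> W. of_nat (sqn \<nu>) * (a \<sigma> * b \<nu>))"
    unfolding D sum_product sum.cartesian_product by (intro sum.cong refl) auto
  have 1: "D * (\<kappa> * Chi) = (\<Sum>(\<sigma>, \<nu>)\<in>S \<times> W. of_nat (sqn \<nu>) * (a \<sigma> * b \<nu>)) +
      2 * (\<Sum>(\<sigma>, \<nu>)\<in>S \<times> W. of_nat (\<Sum>i<n. staircase n (\<sigma> i) * \<nu> i) * (a \<sigma> * b \<nu>))"
    unfolding rad swap cross sq ..
  have DX: "D * Chi = (\<Sum>(\<sigma>, \<nu>)\<in>S \<times> W. a \<sigma> * b \<nu>)"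
    unfolding D Chi sum_product sum.cartesian_product ..
  have \<kappa>: "\<kappa> = of_nat (sqn Ld) - of_nat (sqn (staircase n))"
    by (simp add: \<kappa>_def sqn_def Ld_def)
  have "(\<Sum>(\<sigma>, \<nu>)\<in>S \<times> W. of_nat (sqn (shift \<sigma> \<nu>)) * (a \<sigma> * b \<nu>)) =
      (\<Sum>(\<sigma>, \<nu>)\<in>S \<times> W. of_nat (sqn (staircase n)) * (a \<sigma> * b \<nu>) + (of_nat (sqn \<nu>) * (a \<sigma> * b \<nu>) +
        2 * (of_nat (\<Sum>i<n. staircase n (\<sigma> i) * \<nu> i) * (a \<sigma> * b \<nu>))))"
  proof (rule sum.cong, rule refl, unfold split_paired_all prod.case)
    fix \<sigma> \<nu> assume "(\<sigma>, \<nu>) \<in> S \<times> W"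
    then have "sqn (\<lambda>i. staircase n (\<sigma> i)) = sqn (staircase n)" by (intro sq\<sigma>) simp
    then have "sqn (shift \<sigma> \<nu>) = sqn (staircase n) + (sqn \<nu> + 2 * (\<Sum>i<n. staircase n (\<sigma> i) * \<nu> i))"
      by (simp add: sqn_def shift_def power2_sum sum.distrib sum_distrib_left mult.assoc)
    then show "of_nat (sqn (shift \<sigma> \<nu>)) * (a \<sigma> * b \<nu>) = of_nat (sqn (staircase n)) * (a \<sigma> * b \<nu>) + (of_nat (sqn \<nu>) * (a \<sigma> * b \<nu>) +
        2 * (of_nat (\<Sum>i<n. staircase n (\<sigma> i) * \<nu> i) * (a \<sigma> * b \<nu>)))"
      by (simp add: distrib_right mult.assoc del: of_nat_sum)
  qed
  also have "\<dots> = of_nat (sqn (staircase n)) * (D * Chi) + D * (\<kappa> * Chi)"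
    unfolding 1 DX by (simp add: case_prod_unfold sum.distrib sum_distrib_left)
  also have "\<dots> = of_nat (sqn Ld) * (D * Chi)" unfolding \<kappa> by (simp add: algebra_simps)
  also have "\<dots> = (\<Sum>(\<sigma>, \<nu>)\<in>S \<times> W. of_nat (sqn Ld) * (a \<sigma> * b \<nu>))"
    unfolding DX by (simp add: case_prod_unfold sum_distrib_left)
  finally have "(\<Sum>(\<sigma>, \<nu>)\<in>S \<times> W. of_nat (sqn (shift \<sigma> \<nu>)) * (a \<sigma> * b \<nu>) - of_nat (sqn Ld) * (a \<sigma> * b \<nu>)) = 0"
    by (simp add: case_prod_unfold sum_subtractf)
  also have "(\<Sum>(\<sigma>, \<nu>)\<in>S \<times> W. of_nat (sqn (shift \<sigma> \<nu>)) * (a \<sigma> * b \<nu>) - of_nat (sqn Ld) * (a \<sigma> * b \<nu>)) =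
    (\<Sum>(\<sigma>, \<nu>)\<in>S \<times> W. of_int (sign \<sigma>) * wt_mult \<nu> * (of_nat (sqn (shift \<sigma> \<nu>)) - of_nat (sqn Ld)) *
    wmon n t (shift \<sigma> \<nu>))"
    by (intro sum.cong refl) (auto simp: a_def b_def shift_def[abs_def] wmon_add algebra_simps)
  finally show ?thesis .
qed

end

section \<open>Rearrangement and sorting\<close>

lemma staircase_card:
  assumes "\<sigma> permutes {..<n}" "i < n"
  shows "staircase n (\<sigma> i) = (\<Sum>j<n. if \<sigma> i < \<sigma> j then 1 else 0)"
proof -
  have "\<sigma> i < n" using permutes_in_image[OF assms(1), of i] assms(2) by simp
  have "(\<Sum>j<n. if \<sigma> i < \<sigma> j then 1 else 0 :: nat) = (\<Sum>j<n. if \<sigma> i < j then 1 else 0)"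
    using sum.permute[OF assms(1), of "\<lambda>j. if \<sigma> i < j then 1 else 0 :: nat"] by (simp add: o_def)
  also have "\<dots> = (\<Sum>j\<in>{\<sigma> i<..<n}. 1)"
    by (intro sum.mono_neutral_cong_right) auto
  finally show ?thesis using \<open>\<sigma> i < n\<close> by (simp add: staircase_def)
qed

lemma sum_pairs:
  fixes g :: "nat \<Rightarrow> nat \<Rightarrow> nat"
  assumes "\<And>i. g i i = 0"
  shows "(\<Sum>i<n. \<Sum>j<n. g i j) = (\<Sum>i<n. \<Sum>j<n. if i < j then g i j + g j i else 0)"
proof -
  have "(\<Sum>i<n. \<Sum>j<n. g i j) = (\<Sum>i<n. \<Sum>j<n. (if i < j then g i j else 0) + (if j < i then g i j else 0))"
    using assms by (intro sum.cong refl) (metis add.right_neutral add_0 linorder_neqE_nat order_less_asym)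
  also have "\<dots> = (\<Sum>i<n. \<Sum>j<n. if i < j then g i j else 0) + (\<Sum>i<n. \<Sum>j<n. if j < i then g i j else 0)"
    by (simp add: sum.distrib)
  also have "(\<Sum>i<n. \<Sum>j<n. if j < i then g i j else 0) = (\<Sum>i<n. \<Sum>j<n. if i < j then g j i else 0)"
    by (rule sum.swap)
  also have "(\<Sum>i<n. \<Sum>j<n. if i < j then g i j else 0) + (\<Sum>i<n. \<Sum>j<n. if i < j then g j i else 0) =
      (\<Sum>i<n. \<Sum>j<n. if i < j then g i j + g j i else 0)"
    unfolding sum.distrib[symmetric] by (intro sum.cong refl) auto
  finally show ?thesis .
qed

text \<open>An entry of the staircase counts the larger indices. The pairing thus becomes a sum over
  pairs, in which an inversion of \<open>\<sigma>\<close> replaces the earlier value by the later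
  one.\<close>

lemma rearrangement_eq:
  assumes \<sigma>: "\<sigma> permutes {..<n}"
  shows "(\<Sum>i<n. \<kappa> i * staircase n (\<sigma> i)) = (\<Sum>i<n. \<Sum>j<n. if i < j then if \<sigma> i < \<sigma> j then \<kappa> i else \<kappa> j else 0)"
proof -
  have "(\<Sum>i<n. \<kappa> i * staircase n (\<sigma> i)) = (\<Sum>i<n. \<Sum>j<n. if \<sigma> i < \<sigma> j then \<kappa> i else 0)"
    using \<sigma> by (intro sum.cong refl) (auto simp: staircase_card sum_distrib_left intro!: sum.cong)
  also have "\<dots> = (\<Sum>i<n. \<Sum>j<n. if i < j then (if \<sigma> i < \<sigma> j then \<kappa> i else 0) + (if \<sigma> j < \<sigma> i then \<kappa> j else 0) else 0)"
    by (rule sum_pairs) simp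
  also have "\<dots> = (\<Sum>i<n. \<Sum>j<n. if i < j then if \<sigma> i < \<sigma> j then \<kappa> i else \<kappa> j else 0)"
  proof (intro sum.cong refl)
    fix i j
    have "i = j" if "\<sigma> i = \<sigma> j" using permutes_inj[OF \<sigma>] that by (simp add: inj_eq)
    then show "(if i < j then (if \<sigma> i < \<sigma> j then \<kappa> i else 0) + (if \<sigma> j < \<sigma> i then \<kappa> j else 0) else 0) =
        (if i < j then if \<sigma> i < \<sigma> j then \<kappa> i else \<kappa> j else 0)" by auto
  qed
  finally show ?thesis .
qed

lemma rearrangement:
  assumes \<sigma>: "\<sigma> permutes {..<n}" and dec: "\<And>i j. i \<le> j \<Longrightarrow> \<kappa> j \<le> \<kappa> i"
  shows "(\<Sum>i<n. \<kappa> i * staircase n (\<sigma> i)) \<le> (\<Sum>i<n. \<kappa> i * staircase n i)"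
  using rearrangement_eq[OF \<sigma>, of \<kappa>] rearrangement_eq[OF permutes_id, of \<kappa> n] dec
  by (auto intro!: sum_mono)

text \<open>Equality of the sums forces equality for every pair, so \<open>\<sigma>\<close> has no
  inversion, and an increasing permutation is the identity.\<close>

lemma rearrangement_strict:
  assumes \<sigma>: "\<sigma> permutes {..<n}" and dec: "\<And>i j. i < j \<Longrightarrow> j < n \<Longrightarrow> \<kappa> j < \<kappa> i"
    and eq: "(\<Sum>i<n. \<kappa> i * staircase n (\<sigma> i)) = (\<Sum>i<n. \<kappa> i * staircase n i)"
  shows "\<sigma> = id"
proof -
  have le: "(if i < j then if \<sigma> i < \<sigma> j then \<kappa> i else \<kappa> j else 0) \<le> (if i < j then \<kappa> i else 0)" if "j < n" for i j
    using dec[of i j] that by auto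
  have e: "(\<Sum>i<n. \<Sum>j<n. if i < j then if \<sigma> i < \<sigma> j then \<kappa> i else \<kappa> j else 0) = (\<Sum>i<n. \<Sum>j<n. if i < j then \<kappa> i else 0)"
    using rearrangement_eq[OF \<sigma>, of \<kappa>] rearrangement_eq[OF permutes_id, of \<kappa> n] eq by (simp cong: if_cong)
  have mono: "\<sigma> i < \<sigma> j" if "i < j" "j < n" for i j
  proof (rule ccontr)
    assume "\<not> \<sigma> i < \<sigma> j"
    then have "(if i < j then if \<sigma> i < \<sigma> j then \<kappa> i else \<kappa> j else 0) < (if i < j then \<kappa> i else 0)"
      using that dec[of i j] by simp
    then have "(\<Sum>j<n. if i < j then if \<sigma> i < \<sigma> j then \<kappa> i else \<kappa> j else 0) < (\<Sum>j<n. if i < j then \<kappa> i else 0)"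
      using that le by (intro sum_strict_mono_ex1 bexI[of _ j]) auto
    moreover have "i \<in> {..<n}" using that by simp
    ultimately have "(\<Sum>i<n. \<Sum>j<n. if i < j then if \<sigma> i < \<sigma> j then \<kappa> i else \<kappa> j else 0) < (\<Sum>i<n. \<Sum>j<n. if i < j then \<kappa> i else 0)"
      using le by (intro sum_strict_mono_ex1) (auto intro: sum_mono)
    then show False using e by simp
  qed
  have "\<sigma> i = i" for i
  proof (cases "i < n")
    case True
    have "strict_mono_on {..<n} \<sigma>" using mono by (auto simp: strict_mono_on_def)
    moreover have "\<sigma> i < n" if "i < n" for i using permutes_in_image[OF \<sigma>, of i] that by simp
    ultimately show ?thesis using strict_mono_on_bounded_id[of n \<sigma> i] True by simp
  next
    case False
    then show ?thesis using permutes_not_in[OF \<sigma>] by simp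
  qed
  then show ?thesis by auto
qed

lemma sorting_permutation:
  fixes \<mu> :: "nat \<Rightarrow> nat"
  obtains \<tau> where "\<tau> permutes {..<n}" "\<And>i j. i \<le> j \<Longrightarrow> j < n \<Longrightarrow> \<mu> (\<tau> j) \<le> \<mu> (\<tau> i)"
proof -
  define xs where "xs = map \<mu> [0..<n]"
  have len: "length xs = n" by (simp add: xs_def)
  have "mset (rev (sort xs)) = mset xs" by simp
  then obtain p where p: "p permutes {..<length xs}" "permute_list p xs = rev (sort xs)"
    using mset_eq_permutation by metis
  have nth: "rev (sort xs) ! i = \<mu> (p i)" if "i < n" for i
    using that permutes_in_image[OF p(1), of i] unfolding p(2)[symmetric]
    by (simp add: permute_list_nth[OF p(1)] len) (simp add: xs_def)
  have "\<mu> (p j) \<le> \<mu> (p i)" if "i \<le> j" "j < n" for i j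
  proof -
    have "sorted (rev (rev (sort xs)))" by simp
    then have "rev (sort xs) ! j \<le> rev (sort xs) ! i"
      using that len by (intro sorted_rev_nth_mono) auto
    then show ?thesis using nth that by simp
  qed
  with p(1) len show ?thesis using that[of p] by simp
qed

lemma upper_triangular_GL_diag:
  assumes "b \<in> GL n" "upper_triangular b"
  shows "(\<Prod>i<n. b $$ (i, i) ^ L i) \<noteq> (0 :: 'a :: field)"
proof -
  have "det b = prod_list (diag_mat b)"
    using assms by (intro det_upper_triangular[of _ n]) (auto simp: GL_iff_det)
  then have "0 \<notin> set (diag_mat b)" using assms by (auto simp: GL_iff_det prod_list_zero_iff)
  then have "b $$ (i, i) \<noteq> 0" if "i < n" for i
    using that assms by (force simp: diag_mat_def GL_iff_det)
  then show ?thesis by auto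
qed

text \<open>Elimination of one row at a time: the set of products of a lower unitriangular and an upper
  triangular matrix is dense.\<close>

lemma LU_density:
  fixes f :: "'a :: field_char_0 mat \<Rightarrow> 'a"
  assumes line: "\<And>g k. g \<in> carrier_mat n n \<Longrightarrow> k < n \<Longrightarrow> \<exists>p. \<forall>r. f (g + r \<cdot>\<^sub>m elem n k k) = poly p r"
    and equi: "\<And>g b. g \<in> GL n \<Longrightarrow> b \<in> GL n \<Longrightarrow> upper_triangular b \<Longrightarrow> f (g * b) = 0 \<Longrightarrow> f g = 0"
    and unip: "\<And>u. u \<in> carrier_mat n n \<Longrightarrow> (\<And>i j. i < j \<Longrightarrow> j < n \<Longrightarrow> u $$ (i, j) = 0) \<Longrightarrow>
      (\<And>i. i < n \<Longrightarrow> u $$ (i, i) = 1) \<Longrightarrow> f u = 0"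
    and g: "g \<in> GL n"
  shows "f g = 0"
proof -
  \<comment> \<open>\<open>Q k g\<close>: the first \<open>k\<close> rows of \<open>g\<close>
    already have lower unitriangular shape.\<close>
  define Q where "Q k g \<longleftrightarrow> g \<in> GL n \<and> (\<forall>i<k. \<forall>j<n. (i < j \<longrightarrow> g $$ (i, j) = 0) \<and> (i = j \<longrightarrow> g $$ (i, j) = 1))" for k and g :: "'a mat"
  have "\<forall>g. Q 0 g \<longrightarrow> f g = 0"
  proof (rule inc_induct[of 0 n])
    show "\<forall>g. Q n g \<longrightarrow> f g = 0" using unip by (auto simp: Q_def GL_iff_det)
    fix k assume k: "k < n" and IH: "\<forall>g. Q (Suc k) g \<longrightarrow> f g = 0"
    have A: "f g = 0" if g: "Q k g" and gk: "g $$ (k, k) \<noteq> 0" for g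
    proof -
      have gG: "g \<in> GL n" and gc: "g \<in> carrier_mat n n" using g by (auto simp: Q_def GL_iff_det)
      \<comment> \<open>The column operation that scales the pivot in row \<open>k\<close> to 1 and
        clears the entries to its right; earlier rows are unaffected, since they vanish in column
        \<open>k\<close>.\<close>
      define b where "b = mat n n (\<lambda>(i, j). if i = k then if j = k then 1 / g $$ (k, k) else if k < j then - g $$ (k, j) / g $$ (k, k) else 0
        else if i = j then 1 else 0)"
      have bc: "b \<in> carrier_mat n n" by (simp add: b_def)
      have ut: "upper_triangular b" by (auto simp: upper_triangular_def b_def)
      have "det b = prod_list (diag_mat b)" by (rule det_upper_triangular[OF ut bc])
      also have "\<dots> \<noteq> 0" using gk by (auto simp: diag_mat_def b_def prod_list_zero_iff)
      finally have bG: "b \<in> GL n" using bc by (simp add: GL_iff_det)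
      have gb: "(g * b) $$ (i, j) = (if j = k then 0 else g $$ (i, j)) + g $$ (i, k) * b $$ (k, j)" if ij: "i < n" "j < n" for i j
      proof -
        have "(g * b) $$ (i, j) = (\<Sum>l<n. (if l = j then if j = k then 0 else g $$ (i, j) else 0) + (if l = k then g $$ (i, k) * b $$ (k, j) else 0))"
          unfolding mult_mat_index[OF gc bc ij] using ij k
          by (intro sum.cong refl) (auto simp: b_def)
        then show ?thesis using ij k by (simp add: sum.distrib)
      qed
      have "Q (Suc k) (g * b)"
        unfolding Q_def
      proof (intro conjI GL_mult gG bG allI impI)
        fix i j assume ij: "i < Suc k" "j < n"
        then have i: "i < n" using k by simp
        have gik: "g $$ (i, k) = 0" if "i \<noteq> k" using g ij that k by (auto simp: Q_def)
        show "(g * b) $$ (i, j) = 0" if "i < j"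
        proof (cases "i = k")
          case True
          then show ?thesis using gb[OF i ij(2)] that ij k gk by (simp add: b_def)
        next
          case False
          then have "g $$ (i, j) = 0" using g ij that by (auto simp: Q_def)
          then show ?thesis using gb[OF i ij(2)] gik[OF False] by simp
        qed
        show "(g * b) $$ (i, j) = 1" if "i = j"
        proof (cases "i = k")
          case True
          then show ?thesis using gb[OF i ij(2)] that k gk by (simp add: b_def)
        next
          case False
          then have "i < k" using ij by simp
          then have "g $$ (i, j) = 1" using g ij that by (auto simp: Q_def)
          then show ?thesis using gb[OF i ij(2)] gik[OF False] False that by simp
        qed
      qed
      then have "f (g * b) = 0" using IH by simp
      then show ?thesis by (rule equi[OF gG bG ut])
    qed
    show "\<forall>g. Q k g \<longrightarrow> f g = 0"
    proof (intro allI impI)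
      fix g assume g: "Q k g"
      show "f g = 0"
      proof (cases "g $$ (k, k) = 0")
        case False
        then show ?thesis using A g by simp
      next
        case True
        have gG: "g \<in> GL n" and gc: "g \<in> carrier_mat n n" using g by (auto simp: Q_def GL_iff_det)
        obtain p where p: "\<And>r. f (g + r \<cdot>\<^sub>m elem n k k) = poly p r" using line[OF gc k] by auto
        define \<gamma> where "\<gamma> = mat n n (\<lambda>(i, j). [:g $$ (i, j), elem n k k $$ (i, j):])"
        have ev: "ev_mat r \<gamma> = g + r \<cdot>\<^sub>m elem n k k" for r
          using gc by (intro eq_matI) (auto simp: ev_mat_def \<gamma>_def)
        have [simp]: "\<gamma> \<in> carrier_mat n n" by (simp add: \<gamma>_def)
        have z: "g + 0 \<cdot>\<^sub>m elem n k k = g" using gc by (intro eq_matI) auto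
        \<comment> \<open>A zero pivot is perturbed along a line. The factor
          \<open>det \<gamma>\<close> covers the singular parameters and \<open>[:0, 1:]\<close> the
          parameter 0; both cancel, so \<open>p\<close> is zero and its value at 0 is the
          claim.\<close>
        have "poly (p * det \<gamma> * [:0, 1:]) r = 0" for r
        proof (cases "r = 0 \<or> poly (det \<gamma>) r = 0")
          case False
          have "Q k (g + r \<cdot>\<^sub>m elem n k k)"
            using g False gc k by (auto simp: Q_def GL_iff_det ev[symmetric] det_ev_mat) (auto simp: ev elem_def)
          moreover have "(g + r \<cdot>\<^sub>m elem n k k) $$ (k, k) \<noteq> 0" using gc k True False by (simp add: elem_def)
          ultimately have "f (g + r \<cdot>\<^sub>m elem n k k) = 0" by (rule A)
          then show ?thesis by (simp add: p)
        qed auto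
        then have "p * det \<gamma> * [:0, 1:] = 0" using poly_all_0_iff_0 by blast
        moreover have "det \<gamma> \<noteq> 0"
        proof
          assume "det \<gamma> = 0"
          then have "poly (det \<gamma>) 0 = 0" by simp
          then have "det g = 0" by (simp only: det_ev_mat[symmetric] ev z)
          then show False using gG by (simp add: GL_iff_det)
        qed
        ultimately have "p = 0" by simp
        then show ?thesis using p[of 0] z by simp
      qed
    qed
  qed simp
  moreover have "Q 0 g" using g by (simp add: Q_def)
  ultimately show ?thesis by simp
qed

section \<open>Highest weight: upper bound and multiplicity one\<close>

context hwrep begin

definition pair :: "(nat \<Rightarrow> 'a) \<Rightarrow> 'a vec \<Rightarrow> 'a" where "pair y u = (\<Sum>c<m. y c * u $ c)"

definition lower_unitri :: "'a mat \<Rightarrow> bool" where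
  "lower_unitri u \<longleftrightarrow> u \<in> carrier_mat n n \<and> (\<forall>i j. i < j \<longrightarrow> j < n \<longrightarrow> u $$ (i, j) = 0) \<and> (\<forall>i<n. u $$ (i, i) = 1)"

lemma lower_unitri_GL:
  assumes "lower_unitri u"
  shows "u \<in> GL n"
proof -
  have "det u = prod_list (diag_mat u)"
    using assms by (intro det_lower_triangular[of n]) (auto simp: lower_unitri_def)
  also have "diag_mat u = map (\<lambda>_. 1) [0..<n]"
    using assms by (auto simp: diag_mat_def lower_unitri_def)
  finally show ?thesis using assms by (simp add: GL_iff_det lower_unitri_def map_replicate_const)
qed

lemma poly_pair_cext:
  assumes "\<gamma> \<in> carrier_mat n n"
  shows "pair y (ext (\<lambda>c. c) (ev_mat r \<gamma>) *\<^sub>v v) = poly (\<Sum>c<m. [:y c:] * (\<Sum>d<m. cext \<gamma> $$ (c, d) * [:v $ d:])) r"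
proof -
  have "ext (\<lambda>c. c) (ev_mat r \<gamma>) $$ (c, d) = poly (cext \<gamma> $$ (c, d)) r" if "c < m" "d < m" for c d
  proof -
    have "ev_mat r (cext \<gamma>) $$ (c, d) = poly (cext \<gamma> $$ (c, d)) r" using that by (simp add: ev_mat_def)
    then show ?thesis unfolding ev_cext[OF assms] .
  qed
  then show ?thesis
    using v by (simp add: pair_def poly_sum mult_mat_vec_index[OF ext_carrier v(1)] mult.commute)
qed

text \<open>Stated dually, for a functional \<open>y\<close>. Upper triangular matrices only scale
  \<open>v\<close>, so \<open>y\<close> vanishes on the images of \<open>v\<close> under products of
  lower unitriangular and upper triangular matrices, and by density on the whole orbit;
  irreducibility then makes the orbit span the space.\<close>

lemma orbit_of_lower_spans:
  assumes y: "\<And>u. lower_unitri u \<Longrightarrow> pair y (\<rho> u *\<^sub>v v) = 0" and c: "c < m"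
  shows "y c = 0"
proof -
  have GL0: "pair y (\<rho> g *\<^sub>v v) = 0" if g: "g \<in> GL n" for g
  proof -
    have "pair y (ext (\<lambda>c. c) g *\<^sub>v v) = 0"
    proof (rule LU_density[where f = "\<lambda>g. pair y (ext (\<lambda>c. c) g *\<^sub>v v)", OF _ _ _ g])
      fix g :: "'a mat" and k assume gc: "g \<in> carrier_mat n n"
      define \<gamma> where "\<gamma> = mat n n (\<lambda>(i, j). [:g $$ (i, j), elem n k k $$ (i, j):])"
      have ev: "ev_mat r \<gamma> = g + r \<cdot>\<^sub>m elem n k k" for r
        using gc by (intro eq_matI) (auto simp: ev_mat_def \<gamma>_def)
      have "\<gamma> \<in> carrier_mat n n" by (simp add: \<gamma>_def)
      from poly_pair_cext[OF this, of y]
      show "\<exists>p. \<forall>r. pair y (ext (\<lambda>c. c) (g + r \<cdot>\<^sub>m elem n k k) *\<^sub>v v) = poly p r"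
        unfolding ev by blast
    next
      fix g b :: "'a mat" assume *: "g \<in> GL n" "b \<in> GL n" "upper_triangular b"
      assume z: "pair y (ext (\<lambda>c. c) (g * b) *\<^sub>v v) = 0"
      let ?z = "\<Prod>i<n. b $$ (i, i) ^ L i"
      have "\<rho> (g * b) *\<^sub>v v = \<rho> g *\<^sub>v (\<rho> b *\<^sub>v v)"
        using * v by (simp add: \<rho>_mult \<rho>_carrier assoc_mult_mat_vec[of _ m m _ m])
      also have "\<dots> = ?z \<cdot>\<^sub>v (\<rho> g *\<^sub>v v)"
        unfolding hw[OF *(2,3)] using v \<rho>_carrier[OF *(1)] by (intro mult_mat_vec) auto
      finally have "pair y (\<rho> (g * b) *\<^sub>v v) = ?z * pair y (\<rho> g *\<^sub>v v)"
        using \<rho>_carrier[OF *(1)] by (auto simp: pair_def sum_distrib_left intro!: sum.cong)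
      moreover have "pair y (\<rho> (g * b) *\<^sub>v v) = 0" using z * by (simp add: ext_id GL_mult)
      ultimately show "pair y (ext (\<lambda>c. c) g *\<^sub>v v) = 0"
        using upper_triangular_GL_diag[OF *(2,3), of L] * by (simp add: ext_id)
    next
      fix u :: "'a mat" assume "u \<in> carrier_mat n n" "\<And>i j. i < j \<Longrightarrow> j < n \<Longrightarrow> u $$ (i, j) = 0" "\<And>i. i < n \<Longrightarrow> u $$ (i, i) = 1"
      then have "lower_unitri u" by (simp add: lower_unitri_def)
      then show "pair y (ext (\<lambda>c. c) u *\<^sub>v v) = 0" using y by (simp add: ext_id lower_unitri_GL)
    qed
    then show ?thesis by (simp add: ext_id[OF g])
  qed
  \<comment> \<open>The largest invariant subspace inside the kernel of \<open>y\<close>.\<close>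
  define U where "U = {u \<in> carrier_vec m. \<forall>g\<in>GL n. pair y (\<rho> g *\<^sub>v u) = 0}"
  have pair_add: "pair y (u + w) = pair y u + pair y w" if "u \<in> carrier_vec m" "w \<in> carrier_vec m" for u w
    using that by (simp add: pair_def distrib_left sum.distrib)
  have pair_smult: "pair y (k \<cdot>\<^sub>v u) = k * pair y u" if "u \<in> carrier_vec m" for u k
    using that by (simp add: pair_def sum_distrib_left mult_ac)
  have "VectorSpace.subspace class_ring U (module_vec TYPE('a) m)"
  proof (rule subspace_vecI)
    have "\<rho> g *\<^sub>v 0\<^sub>v m = 0\<^sub>v m" if "g \<in> GL n" for g
      using \<rho>_carrier[OF that] by (auto simp: mult_mat_vec_index[of _ m m] intro!: eq_vecI)
    then show "0\<^sub>v m \<in> U" by (auto simp: U_def pair_def)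
    show "u + w \<in> U" if "u \<in> U" "w \<in> U" for u w
      using that \<rho>_carrier
      by (auto simp: U_def mult_add_distrib_mat_vec[of _ m m] pair_add mult_mat_vec_carrier[of _ m m])
    show "k \<cdot>\<^sub>v u \<in> U" if "u \<in> U" for k u
      using that \<rho>_carrier by (auto simp: U_def mult_mat_vec[of _ m m] pair_smult mult_mat_vec_carrier[of _ m m])
  qed (auto simp: U_def)
  moreover have "\<rho> g *\<^sub>v u \<in> U" if g: "g \<in> GL n" and u: "u \<in> U" for g u
  proof -
    have "\<rho> h *\<^sub>v (\<rho> g *\<^sub>v u) = \<rho> (h * g) *\<^sub>v u" if "h \<in> GL n" for h
      using that g u by (simp add: U_def \<rho>_mult \<rho>_carrier assoc_mult_mat_vec[of _ m m _ m])
    then show ?thesis using g u by (auto simp: U_def GL_mult intro: mult_mat_vec_carrier[OF \<rho>_carrier])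
  qed
  ultimately have "U = {0\<^sub>v m} \<or> U = carrier_vec m"
    using irr by (auto simp: irreducible_representation_def)
  moreover have "v \<in> U" using v GL0 by (simp add: U_def)
  ultimately have "U = carrier_vec m" using v by auto
  then have "unit_vec m c \<in> U" by simp
  then have "pair y (1\<^sub>m m *\<^sub>v unit_vec m c) = 0"
    using GL_one[of n] \<rho>_one by (force simp: U_def)
  moreover have "pair y (1\<^sub>m m *\<^sub>v unit_vec m c) = (\<Sum>d<m. if d = c then y c else 0)"
    unfolding pair_def using c by (intro sum.cong) auto
  ultimately show ?thesis using c by simp
qed

lemma Pw_\<rho>_dg:
  assumes t: "\<And>i. i < n \<Longrightarrow> t i \<noteq> 0" and \<nu>: "\<nu> \<in> W"
  shows "Pw \<nu> * \<rho> (dg n t) = wmon n t \<nu> \<cdot>\<^sub>m Pw \<nu>"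
proof -
  have R: "\<rho> (dg n t) \<in> carrier_mat m m" by (rule \<rho>_carrier[OF dg_GL]) (rule t)
  show ?thesis
  proof (rule eq_matI)
    fix a b assume "a < dim_row (wmon n t \<nu> \<cdot>\<^sub>m Pw \<nu>)" "b < dim_col (wmon n t \<nu> \<cdot>\<^sub>m Pw \<nu>)"
    then have ab: "a < m" "b < m" by auto
    have "(Pw \<nu> * \<rho> (dg n t)) $$ (a, b) - wmon n t \<nu> * Pw \<nu> $$ (a, b) = 0"
    proof (rule monomials_independent[where n = n and W = W and \<nu> = \<nu>
          and c = "\<lambda>\<nu>. (Pw \<nu> * \<rho> (dg n t)) $$ (a, b) - wmon n t \<nu> * Pw \<nu> $$ (a, b)"])
      fix x :: "nat \<Rightarrow> 'a" assume x: "\<And>i. i < n \<Longrightarrow> x i \<noteq> 0"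
      have xG: "dg n x \<in> GL n" "dg n t \<in> GL n" by (rule dg_GL, rule x, assumption) (rule dg_GL, rule t, assumption)
      have 1: "\<rho> (dg n x) * \<rho> (dg n t) = msum m W (\<lambda>\<nu>. wmon n (\<lambda>i. x i * t i) \<nu> \<cdot>\<^sub>m Pw \<nu>)"
        unfolding \<rho>_mult[OF xG, symmetric] dg_mult using t x by (intro \<rho>_dg) auto
      have 2: "\<rho> (dg n x) = msum m W (\<lambda>\<nu>. wmon n x \<nu> \<cdot>\<^sub>m Pw \<nu>)" using x by (intro \<rho>_dg) auto
      have "\<rho> (dg n x) * \<rho> (dg n t) = msum m W (\<lambda>\<nu>. wmon n x \<nu> \<cdot>\<^sub>m (Pw \<nu> * \<rho> (dg n t)))"
        unfolding 2 using R
        by (subst msum_mult) (auto intro!: msum_cong mult_smult_assoc_mat[of _ m m])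
      then have "msum m W (\<lambda>\<nu>. wmon n x \<nu> \<cdot>\<^sub>m (Pw \<nu> * \<rho> (dg n t))) $$ (a, b) =
          msum m W (\<lambda>\<nu>. wmon n (\<lambda>i. x i * t i) \<nu> \<cdot>\<^sub>m Pw \<nu>) $$ (a, b)" using 1 by simp
      then show "(\<Sum>\<nu>\<in>W. ((Pw \<nu> * \<rho> (dg n t)) $$ (a, b) - wmon n t \<nu> * Pw \<nu> $$ (a, b)) * (\<Prod>i<n. x i ^ \<nu> i)) = 0"
        using ab R by (simp add: msum_def wmon_mult wmon_def[of n x, symmetric] right_diff_distrib sum_subtractf mult_ac)
    qed (use W_supp \<nu> in auto)
    then show "(Pw \<nu> * \<rho> (dg n t)) $$ (a, b) = (wmon n t \<nu> \<cdot>\<^sub>m Pw \<nu>) $$ (a, b)"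
      using ab by simp
  qed (use R in auto)
qed

lemma \<rho>_dg_hw:
  assumes t: "\<And>i. i < n \<Longrightarrow> t i \<noteq> 0"
  shows "\<rho> (dg n t) *\<^sub>v v = wmon n t L \<cdot>\<^sub>v v"
proof -
  have "\<rho> (dg n t) *\<^sub>v v = (\<Prod>i<n. dg n t $$ (i, i) ^ L i) \<cdot>\<^sub>v v"
    by (rule hw[OF dg_GL]) (use t in \<open>auto simp: upper_triangular_def dg_def\<close>)
  also have "(\<Prod>i<n. dg n t $$ (i, i) ^ L i) = wmon n t L" by (simp add: wmon_def dg_def)
  finally show ?thesis .
qed

text \<open>The conjugate of \<open>u\<close> by the torus element with entries r^(- w i), with r as
  the variable. For a lower triangular \<open>u\<close> and decreasing \<open>w\<close> the
  exponents are nonnegative, so this stays a polynomial and may be evaluated at r = 0.\<close>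

definition contract :: "(nat \<Rightarrow> nat) \<Rightarrow> 'a mat \<Rightarrow> 'a poly mat" where
  "contract w u = mat n n (\<lambda>(i, j). if j \<le> i then monom (u $$ (i, j)) (w j - w i) else 0)"

text \<open>On the two sides of the conjugated matrix the torus is absorbed: by
  \<open>Pw \<nu>\<close> as r to minus the pairing of \<open>w\<close> with \<open>\<nu>\<close>,
  and by \<open>v\<close> as r to the pairing of \<open>w\<close> with \<open>L\<close>. Multiplying
  by the first power clears the denominator.\<close>

lemma contract_scaling:
  assumes dec: "\<And>i j. i \<le> j \<Longrightarrow> w j \<le> w i" and u: "lower_unitri u" and \<nu>: "\<nu> \<in> W" and a: "a < m"
  shows "(\<Sum>c<m. [:Pw \<nu> $$ (a, c):] * (\<Sum>d<m. cext (contract w u) $$ (c, d) * [:v $ d:])) * monom 1 (\<Sum>i<n. w i * \<nu> i) =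
    monom (pair (\<lambda>c. Pw \<nu> $$ (a, c)) (\<rho> u *\<^sub>v v)) (\<Sum>i<n. w i * L i)"
proof -
  let ?y = "\<lambda>c. Pw \<nu> $$ (a, c)"
  define p where "p = (\<Sum>c<m. [:?y c:] * (\<Sum>d<m. cext (contract w u) $$ (c, d) * [:v $ d:]))"
  have cc: "contract w u \<in> carrier_mat n n" by (simp add: contract_def)
  have uc: "u \<in> carrier_mat n n" using u by (simp add: lower_unitri_def)
  have uG: "u \<in> GL n" by (rule lower_unitri_GL[OF u])
  have "p * monom 1 (\<Sum>i<n. w i * \<nu> i) - monom (pair ?y (\<rho> u *\<^sub>v v)) (\<Sum>i<n. w i * L i) = 0"
  proof (rule poly_eq_0_if_nat_roots[of 1])
    fix k :: nat assume "1 \<le> k"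
    define r where "r = (of_nat k :: 'a)"
    have r: "r \<noteq> 0" using \<open>1 \<le> k\<close> by (simp add: r_def)
    define t where "t i = (1 / r) ^ w i" for i
    define t' where "t' i = r ^ w i" for i
    have t: "t i \<noteq> 0" "t' i \<noteq> 0" for i using r by (simp_all add: t_def t'_def)
    have tG: "dg n t \<in> GL n" "dg n t' \<in> GL n" by (simp_all add: dg_GL t)
    have "ev_mat r (contract w u) = dg n t * u * dg n t'"
    proof (rule eq_matI)
      fix i j assume "i < dim_row (dg n t * u * dg n t')" "j < dim_col (dg n t * u * dg n t')"
      then have ij: "i < n" "j < n" by (auto simp: dg_def)
      have 1: "(dg n t * u) $$ (i, l) = t i * u $$ (i, l)" if "l < n" for l
      proof -
        have "(dg n t * u) $$ (i, l) = (\<Sum>k<n. if k = i then t i * u $$ (i, l) else 0)"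
          unfolding mult_mat_index[OF dg_carrier uc ij(1) that] using ij by (intro sum.cong) (auto simp: dg_def)
        then show ?thesis using ij by simp
      qed
      have dgl: "dg n t' $$ (l, j) = (if l = j then t' j else 0)" if "l < n" for l
        using that ij by (simp add: dg_def)
      have "(dg n t * u * dg n t') $$ (i, j) = (\<Sum>l<n. if l = j then t i * u $$ (i, j) * t' j else 0)"
        unfolding mult_mat_index[OF mult_carrier_mat[OF dg_carrier uc] dg_carrier ij] using ij
        by (intro sum.cong) (auto simp: 1 dgl)
      then have e: "(dg n t * u * dg n t') $$ (i, j) = t i * u $$ (i, j) * t' j" using ij by simp
      show "ev_mat r (contract w u) $$ (i, j) = (dg n t * u * dg n t') $$ (i, j)"
      proof (cases "j \<le> i")
        case True
        have "r ^ w j = r ^ (w j - w i) * r ^ w i" using dec[OF True] by (simp add: power_add[symmetric])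
        then have "t i * t' j = r ^ (w j - w i)" using r by (simp add: t_def t'_def power_one_over field_simps)
        then have eq: "t i * u $$ (i, j) * t' j = u $$ (i, j) * r ^ (w j - w i)" by (metis mult.assoc mult.commute)
        show ?thesis
          unfolding e eq using True ij by (simp add: ev_mat_def contract_def poly_monom)
      next
        case False
        then have "u $$ (i, j) = 0" using u ij by (simp add: lower_unitri_def)
        then show ?thesis unfolding e using False ij by (simp add: ev_mat_def contract_def)
      qed
    qed (auto simp: contract_def ev_mat_def dg_def)
    then have "poly p r = pair ?y (ext (\<lambda>c. c) (dg n t * u * dg n t') *\<^sub>v v)"
      using poly_pair_cext[OF cc, of ?y r] by (simp add: p_def)
    also have "ext (\<lambda>c. c) (dg n t * u * dg n t') = \<rho> (dg n t) * \<rho> u * \<rho> (dg n t')"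
      using tG uG by (simp add: ext_id GL_mult \<rho>_mult)
    also have "\<dots> *\<^sub>v v = wmon n t' L \<cdot>\<^sub>v (\<rho> (dg n t) *\<^sub>v (\<rho> u *\<^sub>v v))"
    proof -
      have c: "\<rho> (dg n t) \<in> carrier_mat m m" "\<rho> u \<in> carrier_mat m m" "\<rho> (dg n t') \<in> carrier_mat m m"
        using tG uG by (auto intro: \<rho>_carrier)
      have c2: "\<rho> (dg n t) * \<rho> u \<in> carrier_mat m m" using c(1,2) by (rule mult_carrier_mat)
      have "\<rho> (dg n t) * \<rho> u * \<rho> (dg n t') *\<^sub>v v = (\<rho> (dg n t) * \<rho> u) *\<^sub>v (\<rho> (dg n t') *\<^sub>v v)"
        using c2 c(3) v(1) by (rule assoc_mult_mat_vec)
      also have "\<rho> (dg n t') *\<^sub>v v = wmon n t' L \<cdot>\<^sub>v v" by (rule \<rho>_dg_hw) (rule t)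
      also have "(\<rho> (dg n t) * \<rho> u) *\<^sub>v (wmon n t' L \<cdot>\<^sub>v v) = wmon n t' L \<cdot>\<^sub>v ((\<rho> (dg n t) * \<rho> u) *\<^sub>v v)"
        using c2 v(1) by (rule mult_mat_vec)
      also have "(\<rho> (dg n t) * \<rho> u) *\<^sub>v v = \<rho> (dg n t) *\<^sub>v (\<rho> u *\<^sub>v v)"
        using c(1,2) v(1) by (rule assoc_mult_mat_vec)
      finally show ?thesis .
    qed
    also have "pair ?y \<dots> = wmon n t' L * (wmon n t \<nu> * pair ?y (\<rho> u *\<^sub>v v))"
    proof -
      define z where "z = \<rho> u *\<^sub>v v"
      have z: "z \<in> carrier_vec m" unfolding z_def by (rule mult_mat_vec_carrier[OF \<rho>_carrier[OF uG] v(1)])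
      have pz: "pair ?y z' = (Pw \<nu> *\<^sub>v z') $ a" if "z' \<in> carrier_vec m" for z'
        unfolding mult_mat_vec_index[OF Pw_carrier that a] pair_def ..
      have Rz: "\<rho> (dg n t) *\<^sub>v z \<in> carrier_vec m" by (rule mult_mat_vec_carrier[OF \<rho>_carrier[OF tG(1)] z])
      have "pair ?y (wmon n t' L \<cdot>\<^sub>v (\<rho> (dg n t) *\<^sub>v z)) = wmon n t' L * pair ?y (\<rho> (dg n t) *\<^sub>v z)"
        using carrier_vecD[OF Rz] by (simp add: pair_def sum_distrib_left mult_ac del: dim_mult_mat_vec)
      also have "pair ?y (\<rho> (dg n t) *\<^sub>v z) = ((Pw \<nu> * \<rho> (dg n t)) *\<^sub>v z) $ a"
        unfolding pz[OF Rz] by (subst assoc_mult_mat_vec[OF Pw_carrier \<rho>_carrier[OF tG(1)] z]) simp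
      also have "Pw \<nu> * \<rho> (dg n t) = wmon n t \<nu> \<cdot>\<^sub>m Pw \<nu>" by (rule Pw_\<rho>_dg[OF _ \<nu>]) (rule t)
      also have "(wmon n t \<nu> \<cdot>\<^sub>m Pw \<nu> *\<^sub>v z) $ a = wmon n t \<nu> * pair ?y z"
        using a by (subst mult_mat_vec_index[of _ m m]) (auto simp: z pair_def sum_distrib_left mult_ac)
      finally show ?thesis by (simp add: z_def)
    qed
    finally have "poly p r * r ^ (\<Sum>i<n. w i * \<nu> i) =
        wmon n t' L * (wmon n t \<nu> * r ^ (\<Sum>i<n. w i * \<nu> i)) * pair ?y (\<rho> u *\<^sub>v v)" by (simp add: mult_ac)
    also have "wmon n t' L = r ^ (\<Sum>i<n. w i * L i)" by (simp add: wmon_def t'_def power_mult power_sum)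
    also have "wmon n t \<nu> = (1 / r) ^ (\<Sum>i<n. w i * \<nu> i)" by (simp add: wmon_def t_def power_mult power_sum)
    also have "(1 / r) ^ (\<Sum>i<n. w i * \<nu> i) * r ^ (\<Sum>i<n. w i * \<nu> i) = 1" using r by (simp add: power_one_over)
    finally show "poly (p * monom 1 (\<Sum>i<n. w i * \<nu> i) - monom (pair ?y (\<rho> u *\<^sub>v v)) (\<Sum>i<n. w i * L i)) (of_nat k) = 0"
      by (simp add: poly_monom r_def mult.commute)
  qed
  then show ?thesis unfolding p_def by simp
qed

text \<open>If the pairing with \<open>\<nu>\<close> were larger, the left-hand side of
  \<open>contract_scaling\<close> would be divisible by a higher power of the variable than the
  monomial on the right, which must then be 0 for every \<open>u\<close>. The rows of
  \<open>Pw \<nu>\<close> would vanish on a spanning orbit.\<close>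

lemma weight_le:
  assumes dec: "\<And>i j. i \<le> j \<Longrightarrow> w j \<le> w i" and \<nu>: "wt_mult \<nu> \<noteq> 0"
  shows "(\<Sum>i<n. w i * \<nu> i) \<le> (\<Sum>i<n. w i * L i)"
proof (rule ccontr)
  assume less: "\<not> (\<Sum>i<n. w i * \<nu> i) \<le> (\<Sum>i<n. w i * L i)"
  have W: "\<nu> \<in> W" using \<nu> wt_mult_notin by blast
  have "Pw \<nu> $$ (a, c) = 0" if ac: "a < m" "c < m" for a c
  proof (rule orbit_of_lower_spans[OF _ ac(2), of "\<lambda>c. Pw \<nu> $$ (a, c)"])
    fix u assume u: "lower_unitri u"
    define p where "p = (\<Sum>c<m. [:Pw \<nu> $$ (a, c):] * (\<Sum>d<m. cext (contract w u) $$ (c, d) * [:v $ d:]))"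
    have "p * monom 1 (\<Sum>i<n. w i * \<nu> i) = monom (pair (\<lambda>c. Pw \<nu> $$ (a, c)) (\<rho> u *\<^sub>v v)) (\<Sum>i<n. w i * L i)"
      unfolding p_def by (rule contract_scaling[OF dec u W ac(1)])
    from arg_cong[OF this, of "\<lambda>p. coeff p (\<Sum>i<n. w i * L i)"]
    show "pair (\<lambda>c. Pw \<nu> $$ (a, c)) (\<rho> u *\<^sub>v v) = 0"
      using less by (simp add: coeff_monom_mult mult.commute[of p])
  qed
  then show False using \<nu> by (simp add: wt_mult_def tr_def)
qed

lemma Pw_hw: "Pw L *\<^sub>v v = v"
proof (rule eq_vecI)
  fix a assume "a < dim_vec v"
  then have a: "a < m" using v by simp
  \<comment> \<open>The trivial condition makes this the instance at \<open>L\<close> of the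
    coefficient function given below, which runs over \<open>insert L W\<close> because membership
    of \<open>L\<close> in \<open>W\<close> is not yet known.\<close>
  have "(Pw L *\<^sub>v v) $ a - (if L = L then v $ a else 0) = 0"
  proof (rule monomials_independent[where n = n and W = "insert L W" and \<nu> = L
        and c = "\<lambda>\<nu>. (Pw \<nu> *\<^sub>v v) $ a - (if \<nu> = L then v $ a else 0)"])
    fix x :: "nat \<Rightarrow> 'a" assume x: "\<And>i. i < n \<Longrightarrow> x i \<noteq> 0"
    have "(\<rho> (dg n x) *\<^sub>v v) $ a = (msum m W (\<lambda>\<nu>. wmon n x \<nu> \<cdot>\<^sub>m Pw \<nu>) *\<^sub>v v) $ a"
      using \<rho>_dg[of x] x by simp
    also have "\<dots> = (\<Sum>\<nu>\<in>W. (wmon n x \<nu> \<cdot>\<^sub>m Pw \<nu> *\<^sub>v v) $ a)"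
      using a v by (intro msum_mult_vec) auto
    also have "\<dots> = (\<Sum>\<nu>\<in>W. wmon n x \<nu> * (Pw \<nu> *\<^sub>v v) $ a)"
      using a v by (intro sum.cong refl) (simp add: mult_mat_vec_index[of _ m m] sum_distrib_left mult_ac)
    also have "\<dots> = (\<Sum>\<nu>\<in>insert L W. wmon n x \<nu> * (Pw \<nu> *\<^sub>v v) $ a)"
    proof (rule sum.mono_neutral_left)
      show "\<forall>\<nu>\<in>insert L W - W. wmon n x \<nu> * (Pw \<nu> *\<^sub>v v) $ a = 0"
        using a v by (auto simp: Pw_notin mult_mat_vec_index[of _ m m])
    qed auto
    finally have "(\<Sum>\<nu>\<in>insert L W. wmon n x \<nu> * (Pw \<nu> *\<^sub>v v) $ a) = wmon n x L * v $ a"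
      using \<rho>_dg_hw[of x] x a v by simp
    moreover have "(\<Sum>\<nu>\<in>insert L W. (if \<nu> = L then v $ a else 0) * wmon n x \<nu>) = (\<Sum>\<nu>\<in>insert L W. if \<nu> = L then wmon n x L * v $ a else 0)"
      by (intro sum.cong) auto
    ultimately show "(\<Sum>\<nu>\<in>insert L W. ((Pw \<nu> *\<^sub>v v) $ a - (if \<nu> = L then v $ a else 0)) * (\<Prod>i<n. x i ^ \<nu> i)) = 0"
      by (simp add: wmon_def[of n x, symmetric] right_diff_distrib sum_subtractf mult.commute del: sum.insert)
  qed (use W_supp L0 in auto)
  then show "(Pw L *\<^sub>v v) $ a = v $ a" by simp
qed (use v in auto)

text \<open>Both pairings in \<open>contract_scaling\<close> agree for \<open>\<nu> = L\<close>, so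
  the value at r = 1 equals the one at r = 0, where \<open>u\<close> has contracted to the identity.
  Hence \<open>Pw L\<close> maps the whole lower unitriangular orbit to \<open>v\<close>; it has
  rank one and fixes \<open>v\<close>, so its trace is 1.\<close>

lemma wt_mult_hw: "wt_mult L = 1"
proof -
  obtain b where b: "b < m" "v $ b \<noteq> 0"
    using v by (metis carrier_vecD eq_vecI index_zero_vec(1) index_zero_vec(2))
  have LW: "L \<in> W"
  proof (rule ccontr)
    assume "L \<notin> W"
    then have "(Pw L *\<^sub>v v) $ b = 0" using b v by (simp add: Pw_notin mult_mat_vec_index[of _ m m])
    then show False using Pw_hw b by simp
  qed
  have const: "pair (\<lambda>c. Pw L $$ (a, c)) (\<rho> u *\<^sub>v v) = v $ a" if u: "lower_unitri u" and a: "a < m" for u a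
  proof -
    let ?y = "\<lambda>c. Pw L $$ (a, c)"
    \<comment> \<open>The staircase is strictly decreasing on the indices below \<open>n\<close>, so
      every entry of \<open>contract w u\<close> below the diagonal carries a positive power of the
      variable and vanishes at 0.\<close>
    define w where "w = staircase n"
    have dec: "w j \<le> w i" if "i \<le> j" for i j using that by (simp add: w_def staircase_def)
    define p where "p = (\<Sum>c<m. [:?y c:] * (\<Sum>d<m. cext (contract w u) $$ (c, d) * [:v $ d:]))"
    have cc: "contract w u \<in> carrier_mat n n" by (simp add: contract_def)
    let ?k = "\<Sum>i<n. w i * L i"
    have "p * monom 1 ?k = monom (pair ?y (\<rho> u *\<^sub>v v)) ?k"
      unfolding p_def by (rule contract_scaling[OF dec u LW a])
    from arg_cong[OF this, of "\<lambda>p. coeff p ?k"] have "coeff p 0 = pair ?y (\<rho> u *\<^sub>v v)"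
      by (simp add: coeff_monom_mult mult.commute[of p])
    moreover have "coeff p 0 = pair ?y (ext (\<lambda>c. c) (ev_mat 0 (contract w u)) *\<^sub>v v)"
      unfolding poly_pair_cext[OF cc] p_def by (simp only: poly_0_coeff_0)
    moreover have "ev_mat 0 (contract w u) = 1\<^sub>m n"
      using u by (intro eq_matI)
        (auto simp: ev_mat_def contract_def poly_monom lower_unitri_def w_def staircase_def power_0_left)
    moreover have "ext (\<lambda>c. c) (1\<^sub>m n) = (1\<^sub>m m :: 'a mat)" by (simp add: ext_id GL_one \<rho>_one)
    moreover have "pair ?y v = (Pw L *\<^sub>v v) $ a"
      unfolding mult_mat_vec_index[OF Pw_carrier v(1) a] pair_def ..
    ultimately show ?thesis using v(1) Pw_hw by simp
  qed
  have rank1: "v $ b * Pw L $$ (a, c) - v $ a * Pw L $$ (b, c) = 0" if ac: "a < m" "c < m" for a c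
  proof (rule orbit_of_lower_spans[OF _ ac(2), of "\<lambda>c. v $ b * Pw L $$ (a, c) - v $ a * Pw L $$ (b, c)"])
    fix u assume u: "lower_unitri u"
    have "pair (\<lambda>c. v $ b * Pw L $$ (a, c) - v $ a * Pw L $$ (b, c)) (\<rho> u *\<^sub>v v) =
        v $ b * pair (\<lambda>c. Pw L $$ (a, c)) (\<rho> u *\<^sub>v v) - v $ a * pair (\<lambda>c. Pw L $$ (b, c)) (\<rho> u *\<^sub>v v)"
      by (simp add: pair_def left_diff_distrib sum_subtractf sum_distrib_left mult.assoc)
    then show "pair (\<lambda>c. v $ b * Pw L $$ (a, c) - v $ a * Pw L $$ (b, c)) (\<rho> u *\<^sub>v v) = 0"
      by (simp add: const u ac b)
  qed
  have "v $ b * wt_mult L = (\<Sum>a<m. v $ b * Pw L $$ (a, a))" by (simp add: wt_mult_def tr_def sum_distrib_left)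
  also have "\<dots> = (\<Sum>a<m. Pw L $$ (b, a) * v $ a)" using rank1 by (intro sum.cong) (auto simp: mult.commute)
  also have "\<dots> = (Pw L *\<^sub>v v) $ b" by (simp add: mult_mat_vec_index[OF Pw_carrier v(1) b(1)])
  also have "\<dots> = v $ b" by (simp add: Pw_hw)
  finally show ?thesis using b by simp
qed

end

section \<open>Weyl's character formula on the diagonal torus\<close>

lemma fps_geo_map:
  assumes "comm_ring_hom \<psi>"
  shows "fps_map \<psi> (geo a) = geo (\<psi> a)"
proof -
  interpret comm_ring_hom \<psi> by fact
  show ?thesis by (rule fps_ext) (simp add: geo_def hom_power)
qed

lemma chs_hom:
  assumes "comm_ring_hom \<psi>"
  shows "\<psi> (chs n x d) = chs n (\<lambda>i. \<psi> (x i)) d"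
proof -
  interpret comm_ring_hom \<psi> by fact
  interpret F: comm_ring_hom "fps_map \<psi>" by (rule fps_map_comm_ring_hom[OF assms])
  have "fps_map \<psi> (\<Prod>i<n. geo (x i)) = (\<Prod>i<n. geo (\<psi> (x i)))"
    by (simp add: F.hom_prod fps_geo_map[OF assms])
  from arg_cong[OF this, of "\<lambda>f. fps_nth f (nat d)"] show ?thesis by (simp add: chs_def)
qed

context polyrep begin

lemma tr_ext_natural:
  assumes "comm_ring_hom \<psi>" "g \<in> carrier_mat n n"
  shows "\<psi> (tr m (ext \<phi> g)) = tr m (ext (\<lambda>c. \<psi> (\<phi> c)) (map_mat \<psi> g))"
proof -
  interpret comm_ring_hom \<psi> by fact
  have "\<psi> (tr m (ext \<phi> g)) = tr m (map_mat \<psi> (ext \<phi> g))"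
    by (simp add: tr_def hom_sum)
  then show ?thesis by (simp add: ext_natural[OF assms])
qed

lemma tr_ext_dg:
  assumes "comm_ring_hom \<phi>"
  shows "tr m (ext \<phi> (dg n x)) = (\<Sum>\<nu>\<in>W. \<phi> (wt_mult \<nu>) * wmon n x \<nu>)"
proof -
  interpret comm_ring_hom \<phi> by fact
  have "tr m (ext \<phi> (dg n x)) = (\<Sum>a<m. \<Sum>\<nu>\<in>W. \<phi> (Pw \<nu> $$ (a, a)) * wmon n x \<nu>)"
    unfolding tr_def by (intro sum.cong refl ext_dg[OF assms]) auto
  also have "\<dots> = (\<Sum>\<nu>\<in>W. \<Sum>a<m. \<phi> (Pw \<nu> $$ (a, a)) * wmon n x \<nu>)" by (rule sum.swap)
  finally show ?thesis by (simp add: wt_mult_def tr_def hom_sum sum_distrib_right)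
qed

end

context hwrep begin

text \<open>The coefficient at \<open>\<mu>\<close> of the product of the Vandermonde determinant
  and the character; the condition guards against truncated subtraction.\<close>

definition fc :: "(nat \<Rightarrow> nat) \<Rightarrow> 'a" where
  "fc \<mu> = (\<Sum>\<sigma>\<in>S. of_int (sign \<sigma>) *
     (if \<forall>i. staircase n (\<sigma> i) \<le> \<mu> i then wt_mult (\<lambda>i. \<mu> i - staircase n (\<sigma> i)) else 0))"

definition M :: "(nat \<Rightarrow> nat) set" where "M = (\<lambda>(\<sigma>, \<nu>). shift \<sigma> \<nu>) ` (S \<times> W)"

lemma finite_S [simp]: "finite S" by (rule finite_permutations) simp

lemma finite_M [simp]: "finite M" by (simp add: M_def)

lemma M_supp: "\<mu> \<in> M \<Longrightarrow> i \<ge> n \<Longrightarrow> \<mu> i = 0"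
  using W_supp by (auto simp: M_def shift_def staircase_def permutes_not_in)

lemma shift_diff: "(\<forall>i. staircase n (\<sigma> i) \<le> \<mu> i) \<Longrightarrow> shift \<sigma> (\<lambda>i. \<mu> i - staircase n (\<sigma> i)) = \<mu>"
  by (auto simp: shift_def fun_eq_iff)

lemma fc_nonzero:
  assumes "fc \<mu> \<noteq> 0"
  obtains \<sigma> \<nu> where "\<sigma> \<in> S" "wt_mult \<nu> \<noteq> 0" "\<mu> = shift \<sigma> \<nu>"
proof -
  obtain \<sigma> where \<sigma>: "\<sigma> \<in> S" "of_int (sign \<sigma>) *
     (if \<forall>i. staircase n (\<sigma> i) \<le> \<mu> i then wt_mult (\<lambda>i. \<mu> i - staircase n (\<sigma> i)) else 0) \<noteq> 0"
    using assms unfolding fc_def by (meson sum.neutral)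
  then have le: "\<forall>i. staircase n (\<sigma> i) \<le> \<mu> i" and "wt_mult (\<lambda>i. \<mu> i - staircase n (\<sigma> i)) \<noteq> 0"
    by (auto split: if_splits)
  then show ?thesis using that[OF \<sigma>(1), of "\<lambda>i. \<mu> i - staircase n (\<sigma> i)"] shift_diff[OF le] by simp
qed

lemma fc_in_M: "fc \<mu> \<noteq> 0 \<Longrightarrow> \<mu> \<in> M"
  by (erule fc_nonzero) (use wt_mult_notin in \<open>force simp: M_def\<close>)

text \<open>\<open>G\<close> and \<open>\<phi>\<close> are arbitrary because the regrouping serves
  twice: for the Casimir identity, with a norm factor in \<open>G\<close>, and for the character
  over another ring.\<close>

lemma group_by_weight:
  fixes \<phi> :: "'a \<Rightarrow> 'r :: comm_ring_1"
  assumes "comm_ring_hom \<phi>"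
  shows "(\<Sum>(\<sigma>, \<nu>)\<in>S \<times> W. of_int (sign \<sigma>) * \<phi> (wt_mult \<nu>) * G (shift \<sigma> \<nu>)) = (\<Sum>\<mu>\<in>M. \<phi> (fc \<mu>) * G \<mu>)"
proof -
  interpret \<phi>: comm_ring_hom \<phi> by fact
  define c where "c \<sigma> \<mu> = (if \<forall>i. staircase n (\<sigma> i) \<le> \<mu> i then wt_mult (\<lambda>i. \<mu> i - staircase n (\<sigma> i)) else 0)" for \<sigma> \<mu>
  have c_shift: "c \<sigma> (shift \<sigma> \<nu>) = wt_mult \<nu>" for \<sigma> \<nu> by (simp add: c_def shift_def)
  have inner: "(\<Sum>\<nu>\<in>W. \<phi> (wt_mult \<nu>) * G (shift \<sigma> \<nu>)) = (\<Sum>\<mu>\<in>M. \<phi> (c \<sigma> \<mu>) * G \<mu>)" if \<sigma>: "\<sigma> \<in> S" for \<sigma>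
  proof -
    have "inj_on (shift \<sigma>) W" by (auto simp: inj_on_def shift_def fun_eq_iff)
    then have "(\<Sum>\<nu>\<in>W. \<phi> (wt_mult \<nu>) * G (shift \<sigma> \<nu>)) = (\<Sum>\<mu>\<in>shift \<sigma> ` W. \<phi> (c \<sigma> \<mu>) * G \<mu>)"
      by (simp add: sum.reindex c_shift)
    also have "\<dots> = (\<Sum>\<mu>\<in>M. \<phi> (c \<sigma> \<mu>) * G \<mu>)"
    proof (rule sum.mono_neutral_left)
      show "\<forall>\<mu>\<in>M - shift \<sigma> ` W. \<phi> (c \<sigma> \<mu>) * G \<mu> = 0"
      proof
        fix \<mu> assume \<mu>: "\<mu> \<in> M - shift \<sigma> ` W"
        have "c \<sigma> \<mu> = 0"
        proof (cases "\<forall>i. staircase n (\<sigma> i) \<le> \<mu> i")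
          case True
          then have "(\<lambda>i. \<mu> i - staircase n (\<sigma> i)) \<notin> W" using \<mu> shift_diff[OF True] by (metis DiffE image_eqI)
          then show ?thesis by (simp add: c_def wt_mult_notin)
        qed (auto simp: c_def)
        then show "\<phi> (c \<sigma> \<mu>) * G \<mu> = 0" by simp
      qed
    qed (use \<sigma> in \<open>auto simp: M_def\<close>)
    finally show ?thesis .
  qed
  have "(\<Sum>(\<sigma>, \<nu>)\<in>S \<times> W. of_int (sign \<sigma>) * \<phi> (wt_mult \<nu>) * G (shift \<sigma> \<nu>)) =
      (\<Sum>\<sigma>\<in>S. \<Sum>\<nu>\<in>W. of_int (sign \<sigma>) * \<phi> (wt_mult \<nu>) * G (shift \<sigma> \<nu>))"
    by (simp only: sum.cartesian_product)
  also have "\<dots> = (\<Sum>\<sigma>\<in>S. of_int (sign \<sigma>) * (\<Sum>\<nu>\<in>W. \<phi> (wt_mult \<nu>) * G (shift \<sigma> \<nu>)))"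
    by (simp add: sum_distrib_left mult.assoc)
  also have "\<dots> = (\<Sum>\<sigma>\<in>S. of_int (sign \<sigma>) * (\<Sum>\<mu>\<in>M. \<phi> (c \<sigma> \<mu>) * G \<mu>))"
    by (intro sum.cong refl) (simp only: inner)
  also have "\<dots> = (\<Sum>\<sigma>\<in>S. \<Sum>\<mu>\<in>M. of_int (sign \<sigma>) * \<phi> (c \<sigma> \<mu>) * G \<mu>)"
    by (simp add: sum_distrib_left mult.assoc)
  also have "\<dots> = (\<Sum>\<mu>\<in>M. \<Sum>\<sigma>\<in>S. of_int (sign \<sigma>) * \<phi> (c \<sigma> \<mu>) * G \<mu>)" by (rule sum.swap)
  also have "\<dots> = (\<Sum>\<mu>\<in>M. \<phi> (fc \<mu>) * G \<mu>)"
    by (intro sum.cong refl) (simp add: fc_def c_def[symmetric] \<phi>.hom_sum \<phi>.hom_mult \<phi>.hom_of_int sum_distrib_right)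
  finally show ?thesis .
qed

text \<open>The Casimir identity holds at all points with distinct nonzero coordinates, hence
  coefficient by coefficient.\<close>

lemma fc_sqn:
  assumes "fc \<mu> \<noteq> 0"
  shows "sqn \<mu> = sqn Ld"
proof -
  have "fc \<mu> * (of_nat (sqn \<mu>) - of_nat (sqn Ld)) = 0"
  proof (rule monomials_independent[where n = n and W = M and c = "\<lambda>\<mu>. fc \<mu> * (of_nat (sqn \<mu>) - of_nat (sqn Ld))" and \<nu> = \<mu>])
    fix t :: "nat \<Rightarrow> 'a" assume t: "\<And>i. i < n \<Longrightarrow> t i \<noteq> 0" and inj: "inj_on t {..<n}"
    have "(\<Sum>(\<sigma>, \<nu>)\<in>S \<times> W. of_int (sign \<sigma>) * wt_mult \<nu> * ((of_nat (sqn (shift \<sigma> \<nu>)) - of_nat (sqn Ld)) *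
        wmon n t (shift \<sigma> \<nu>))) = 0"
      using casimir_coefficients[of t, OF t inj] by (simp only: mult.assoc)
    then have "(\<Sum>\<mu>\<in>M. fc \<mu> * ((of_nat (sqn \<mu>) - of_nat (sqn Ld)) * wmon n t \<mu>)) = 0"
      by (subst (asm) group_by_weight[OF id_comm_ring_hom])
    then show "(\<Sum>\<mu>\<in>M. fc \<mu> * (of_nat (sqn \<mu>) - of_nat (sqn Ld)) * (\<Prod>i<n. t i ^ \<mu> i)) = 0"
      by (simp only: wmon_def mult.assoc)
  qed (use M_supp fc_in_M assms in auto)
  then show ?thesis using assms by simp
qed

text \<open>The weights are symmetric and the Vandermonde determinant is alternating; composing
  \<open>\<sigma>\<close> with \<open>\<tau>\<close> in the sum transfers the sign.\<close>

lemma fc_perm: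
  assumes \<tau>: "\<tau> \<in> S"
  shows "fc (\<lambda>i. \<mu> (\<tau> i)) = of_int (sign \<tau>) * fc \<mu>"
proof -
  have perm: "permutation \<sigma>" if "\<sigma> \<in> S" for \<sigma> using that by (auto simp: permutation_permutes)
  let ?f = "\<lambda>\<mu> \<sigma>. of_int (sign \<sigma>) *
     (if \<forall>i. staircase n (\<sigma> i) \<le> \<mu> i then wt_mult (\<lambda>i. \<mu> i - staircase n (\<sigma> i)) else 0)"
  have "fc (\<lambda>i. \<mu> (\<tau> i)) = (\<Sum>\<sigma>\<in>S. ?f (\<lambda>i. \<mu> (\<tau> i)) (\<sigma> \<circ> \<tau>))"
    unfolding fc_def using \<tau> by (intro sum_permutations_compose_right) auto
  also have "\<dots> = (\<Sum>\<sigma>\<in>S. of_int (sign \<tau>) * ?f \<mu> \<sigma>)"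
  proof (rule sum.cong)
    fix \<sigma> assume \<sigma>: "\<sigma> \<in> S"
    have 1: "(\<forall>i. staircase n ((\<sigma> \<circ> \<tau>) i) \<le> \<mu> (\<tau> i)) \<longleftrightarrow> (\<forall>i. staircase n (\<sigma> i) \<le> \<mu> i)"
      using permutes_surj[of \<tau>] \<tau> by (auto simp: surj_def) metis
    have "wt_mult (\<lambda>i. \<mu> (\<tau> i) - staircase n (\<sigma> (\<tau> i))) = wt_mult (\<lambda>i. \<mu> i - staircase n (\<sigma> i))"
      using wt_mult_symmetric[of \<tau> "\<lambda>i. \<mu> i - staircase n (\<sigma> i)"] \<tau> by simp
    then show "?f (\<lambda>i. \<mu> (\<tau> i)) (\<sigma> \<circ> \<tau>) = of_int (sign \<tau>) * ?f \<mu> \<sigma>"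
      unfolding 1 using perm[OF \<sigma>] perm[OF \<tau>] by (simp add: sign_compose)
  qed simp
  finally show ?thesis by (simp add: fc_def sum_distrib_left)
qed

lemma Ld_dec: "i < j \<Longrightarrow> j < n \<Longrightarrow> Ld j < Ld i"
  using L_dec[of i j] by (simp add: Ld_def staircase_def)

lemma staircase_dec: "i \<le> j \<Longrightarrow> staircase n j \<le> staircase n i" by (simp add: staircase_def)

lemma Ld_dec': "i \<le> j \<Longrightarrow> Ld j \<le> Ld i"
  using L_dec[of i j] staircase_dec[of i j] by (simp add: Ld_def)

lemma pairing_le:
  assumes dec: "\<And>i j. i \<le> j \<Longrightarrow> w j \<le> w i" and \<sigma>: "\<sigma> \<in> S" and \<nu>: "wt_mult \<nu> \<noteq> 0"
  shows "(\<Sum>i<n. w i * shift \<sigma> \<nu> i) \<le> (\<Sum>i<n. w i * Ld i)"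
  using rearrangement[of \<sigma> n w] weight_le[of w \<nu>] assms
  by (simp add: shift_def Ld_def distrib_left sum.distrib add.commute add_mono)

text \<open>Let \<open>w\<close> be the decreasing rearrangement of \<open>\<mu>\<close>. Its
  pairing with itself is at most its pairing with \<open>Ld\<close>, by \<open>pairing_le\<close>,
  while both have the same norm; so the squared distance from \<open>w\<close> to \<open>Ld\<close>
  is not positive.\<close>

lemma fc_support:
  assumes f: "fc \<mu> \<noteq> 0"
  shows "\<exists>\<tau>\<in>S. (\<lambda>i. \<mu> (\<tau> i)) = Ld"
proof -
  obtain \<tau> where \<tau>: "\<tau> permutes {..<n}" "\<And>i j. i \<le> j \<Longrightarrow> j < n \<Longrightarrow> \<mu> (\<tau> j) \<le> \<mu> (\<tau> i)"
    using sorting_permutation by blast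
  define w where "w i = \<mu> (\<tau> i)" for i
  have fw: "fc w \<noteq> 0" using fc_perm[of \<tau> \<mu>] \<tau>(1) f by (simp add: w_def[abs_def] sign_def)
  have supp: "w i = 0" if "i \<ge> n" for i using M_supp[OF fc_in_M[OF fw]] that by simp
  have dec: "w j \<le> w i" if "i \<le> j" for i j
    using \<tau>(2)[OF that] supp[of j] by (cases "j < n") (auto simp: w_def)
  obtain \<sigma> \<nu> where \<sigma>: "\<sigma> \<in> S" "wt_mult \<nu> \<noteq> 0" "w = shift \<sigma> \<nu>" using fc_nonzero[OF fw] by blast
  have "(\<Sum>i<n. w i * w i) \<le> (\<Sum>i<n. w i * Ld i)"
    using pairing_le[of w \<sigma> \<nu>] dec \<sigma> by simp
  moreover have "(\<Sum>i<n. w i * w i) = (\<Sum>i<n. Ld i * Ld i)"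
    using fc_sqn[OF fw] by (simp add: sqn_def power2_eq_square)
  ultimately have "int (\<Sum>i<n. w i * w i) + int (\<Sum>i<n. Ld i * Ld i) - 2 * int (\<Sum>i<n. w i * Ld i) \<le> 0" by linarith
  also have "int (\<Sum>i<n. w i * w i) + int (\<Sum>i<n. Ld i * Ld i) - 2 * int (\<Sum>i<n. w i * Ld i) = (\<Sum>i<n. (int (w i) - int (Ld i)) ^ 2)"
    by (simp add: sum.distrib sum_subtractf sum_distrib_left power2_eq_square algebra_simps)
  finally have "(\<Sum>i<n. (int (w i) - int (Ld i)) ^ 2) = 0" by (intro antisym sum_nonneg) auto
  then have eq: "w i = Ld i" if "i < n" for i using that by (subst (asm) sum_nonneg_eq_0_iff) auto
  have "w i = Ld i" for i
  proof (cases "i < n")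
    case False
    then show ?thesis using supp[of i] L0[of i] by (simp add: Ld_def staircase_def)
  qed (rule eq)
  then show ?thesis using \<tau>(1) by (intro bexI[of _ \<tau>]) (auto simp: w_def)
qed

text \<open>A contributing term writes \<open>Ld\<close> as a permuted staircase plus a weight.
  Paired with \<open>Ld\<close>, both summands attain their upper bounds, and the equality case of
  the rearrangement inequality leaves the identity permutation, with the multiplicity of
  \<open>L\<close>.\<close>

lemma fc_Ld: "fc Ld = 1"
proof -
  let ?f = "\<lambda>\<sigma>. of_int (sign \<sigma>) *
     (if \<forall>i. staircase n (\<sigma> i) \<le> Ld i then wt_mult (\<lambda>i. Ld i - staircase n (\<sigma> i)) else 0)"
  have "?f \<sigma> = 0" if \<sigma>: "\<sigma> \<in> S" "\<sigma> \<noteq> id" for \<sigma>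
  proof (rule ccontr)
    assume "?f \<sigma> \<noteq> 0"
    then have le: "\<forall>i. staircase n (\<sigma> i) \<le> Ld i" and w: "wt_mult (\<lambda>i. Ld i - staircase n (\<sigma> i)) \<noteq> 0"
      by (auto split: if_splits)
    define \<nu> where "\<nu> i = Ld i - staircase n (\<sigma> i)" for i
    have Ld: "Ld i = staircase n (\<sigma> i) + \<nu> i" for i using le by (simp add: \<nu>_def)
    have 1: "(\<Sum>i<n. Ld i * \<nu> i) \<le> (\<Sum>i<n. Ld i * L i)"
      using weight_le[of Ld \<nu>] w Ld_dec' by (simp add: \<nu>_def[abs_def])
    have 2: "(\<Sum>i<n. Ld i * staircase n (\<sigma> i)) \<le> (\<Sum>i<n. Ld i * staircase n i)"
      using rearrangement[of \<sigma> n Ld] Ld_dec' \<sigma> by simp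
    have "(\<Sum>i<n. Ld i * staircase n (\<sigma> i)) + (\<Sum>i<n. Ld i * \<nu> i) = (\<Sum>i<n. Ld i * Ld i)"
      unfolding sum.distrib[symmetric] by (intro sum.cong refl) (metis Ld distrib_left)
    moreover have "(\<Sum>i<n. Ld i * staircase n i) + (\<Sum>i<n. Ld i * L i) = (\<Sum>i<n. Ld i * Ld i)"
      unfolding sum.distrib[symmetric] by (intro sum.cong refl) (metis Ld_def add.commute distrib_left)
    ultimately have "(\<Sum>i<n. Ld i * staircase n (\<sigma> i)) = (\<Sum>i<n. Ld i * staircase n i)" using 1 2 by linarith
    then have "\<sigma> = id" using rearrangement_strict[of \<sigma> n Ld] \<sigma> Ld_dec by simp
    with \<sigma> show False by simp
  qed
  then have "fc Ld = (\<Sum>\<sigma>\<in>S. if \<sigma> = id then ?f id else 0)"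
    unfolding fc_def by (intro sum.cong refl) auto
  also have "\<dots> = ?f id" by (simp add: permutes_id)
  also have "\<dots> = wt_mult L"
  proof -
    have "(\<lambda>i. Ld i - staircase n i) = L" by (simp add: Ld_def)
    then show ?thesis by (simp add: Ld_def)
  qed
  finally show ?thesis by (simp add: wt_mult_hw)
qed

text \<open>Alternation and \<open>fc_support\<close> leave only the permutations of
  \<open>Ld\<close>, with their signs as coefficients. The multiplied form is an identity of
  coefficients and so passes to every commutative algebra.\<close>

theorem Weyl_character:
  fixes \<phi> :: "'a \<Rightarrow> 'r :: comm_ring_1"
  assumes \<phi>: "comm_ring_hom \<phi>"
  shows "alternant n x (staircase n) * tr m (ext \<phi> (dg n x)) = alternant n x Ld"
proof -
  interpret \<phi>: comm_ring_hom \<phi> by fact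
  have "alternant n x (staircase n) * tr m (ext \<phi> (dg n x)) =
      (\<Sum>(\<sigma>, \<nu>)\<in>S \<times> W. of_int (sign \<sigma>) * \<phi> (wt_mult \<nu>) * wmon n x (shift \<sigma> \<nu>))"
    unfolding tr_ext_dg[OF \<phi>] alternant_altdef sum_product sum.cartesian_product
    by (intro sum.cong refl) (auto simp: shift_def[abs_def] wmon_add wmon_def[of n x "\<lambda>i. staircase n (_ i)"])
  also have "\<dots> = (\<Sum>\<mu>\<in>M. \<phi> (fc \<mu>) * wmon n x \<mu>)" by (rule group_by_weight[OF \<phi>])
  also have "\<dots> = (\<Sum>\<mu>\<in>(\<lambda>\<tau> i. Ld (\<tau> i)) ` S. \<phi> (fc \<mu>) * wmon n x \<mu>)"
  proof (rule sum.mono_neutral_cong)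
    show "\<phi> (fc \<mu>) * wmon n x \<mu> = 0" if "\<mu> \<in> (\<lambda>\<tau> i. Ld (\<tau> i)) ` S - M" for \<mu>
    proof -
      have "fc \<mu> = 0" using fc_in_M that by blast
      then show ?thesis by simp
    qed
    show "\<phi> (fc \<mu>) * wmon n x \<mu> = 0" if \<mu>: "\<mu> \<in> M - (\<lambda>\<tau> i. Ld (\<tau> i)) ` S" for \<mu>
    proof -
      have "fc \<mu> = 0"
      proof (rule ccontr)
        assume "fc \<mu> \<noteq> 0"
        then obtain \<tau> where \<tau>: "\<tau> \<in> S" "(\<lambda>i. \<mu> (\<tau> i)) = Ld" using fc_support by blast
        then have p: "\<tau> permutes {..<n}" by simp
        have "\<mu> i = Ld (Hilbert_Choice.inv \<tau> i)" for i
          using fun_cong[OF \<tau>(2), of "Hilbert_Choice.inv \<tau> i"] permutes_inverses(1)[OF p] by simp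
        then have "\<mu> = (\<lambda>i. Ld (Hilbert_Choice.inv \<tau> i))" by auto
        then show False using \<mu> permutes_inv[OF p] by auto
      qed
      then show ?thesis by simp
    qed
  qed auto
  also have "\<dots> = (\<Sum>\<tau>\<in>S. \<phi> (fc (\<lambda>i. Ld (\<tau> i))) * wmon n x (\<lambda>i. Ld (\<tau> i)))"
  proof (rule sum.reindex[unfolded o_def])
    show "inj_on (\<lambda>\<tau> i. Ld (\<tau> i)) S"
    proof
      fix \<sigma> \<tau> assume *: "\<sigma> \<in> S" "\<tau> \<in> S" "(\<lambda>i. Ld (\<sigma> i)) = (\<lambda>i. Ld (\<tau> i))"
      then have p: "\<sigma> permutes {..<n}" "\<tau> permutes {..<n}" by auto
      show "\<sigma> = \<tau>"
      proof
        fix i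
        show "\<sigma> i = \<tau> i"
        proof (cases "i < n")
          case True
          then have "\<sigma> i < n" "\<tau> i < n" using permutes_in_image[OF p(1), of i] permutes_in_image[OF p(2), of i] by auto
          then show ?thesis using fun_cong[OF *(3), of i] Ld_dec[of "\<sigma> i" "\<tau> i"] Ld_dec[of "\<tau> i" "\<sigma> i"]
            by (metis linorder_neqE_nat less_irrefl)
        next
          case False
          then show ?thesis using permutes_not_in[OF p(1), of i] permutes_not_in[OF p(2), of i] by simp
        qed
      qed
    qed
  qed
  also have "\<dots> = alternant n x Ld"
    unfolding alternant_altdef
    by (intro sum.cong refl) (simp add: fc_perm fc_Ld \<phi>.hom_of_int wmon_def)
  finally show ?thesis .
qed

text \<open>For repeated entries of \<open>x\<close> the Vandermonde determinant is zero. The points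
  \<open>y i\<close> = x i + i s are distinct over the polynomial ring in s, where the determinant
  cancels; then s is set to 0.\<close>

lemma trace_diagonal:
  fixes \<phi> :: "'a \<Rightarrow> 'f :: field_char_0"
  assumes \<phi>: "comm_ring_hom \<phi>"
  shows "tr m (ext \<phi> (dg n x)) = det (mat n n (\<lambda>(i, j). chs n x (int (L i) + int j - int i)))"
proof -
  interpret \<phi>: comm_ring_hom \<phi> by fact
  have \<psi>: "comm_ring_hom (\<lambda>c. [:\<phi> c:])"
    by unfold_locales (auto simp: \<phi>.hom_add \<phi>.hom_mult one_pCons)
  define y where "y i = [:x i, of_nat i:]" for i
  have "inj_on y {..<n}" by (auto simp: inj_on_def y_def)
  then have V: "alternant n y (staircase n) \<noteq> 0" by (rule Vandermonde_nonzero)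
  have "alternant n y (staircase n) * tr m (ext (\<lambda>c. [:\<phi> c:]) (dg n y)) =
      det (mat n n (\<lambda>(i, j). chs n y (int (L i) + int j - int i))) * alternant n y (staircase n)"
    unfolding Weyl_character[OF \<psi>] Jacobi_Trudi_alternant[symmetric] by (simp add: Ld_def[abs_def])
  then have "tr m (ext (\<lambda>c. [:\<phi> c:]) (dg n y)) = det (mat n n (\<lambda>(i, j). chs n y (int (L i) + int j - int i)))"
    using V by simp
  then have "poly (tr m (ext (\<lambda>c. [:\<phi> c:]) (dg n y))) 0 = poly (det (mat n n (\<lambda>(i, j). chs n y (int (L i) + int j - int i)))) 0"
    by simp
  also have "poly (tr m (ext (\<lambda>c. [:\<phi> c:]) (dg n y))) 0 = tr m (ext \<phi> (map_mat (\<lambda>p. poly p 0) (dg n y)))"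
    by (subst tr_ext_natural[OF poly_comm_ring_hom]) auto
  also have "map_mat (\<lambda>p. poly p 0) (dg n y) = dg n x"
    by (rule eq_matI) (auto simp: dg_def y_def)
  also have "poly (det (mat n n (\<lambda>(i, j). chs n y (int (L i) + int j - int i)))) 0 =
      det (mat n n (\<lambda>(i, j). chs n x (int (L i) + int j - int i)))"
    by (subst hom_det_mat[OF poly_comm_ring_hom]) (simp add: chs_hom[OF poly_comm_ring_hom] y_def)
  finally show ?thesis .
qed

end

section \<open>From the torus to permutation matrices\<close>

text \<open>An eigenvector is split off and the remaining block is treated by induction. Triangular
  form suffices because \<open>tr_ext_triangular\<close> discards the entries above the
  diagonal.\<close>

lemma triangularisation:
  fixes A :: "'f :: alg_closed_field mat"
  assumes "A \<in> carrier_mat n n"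
  shows "\<exists>B P Q. similar_mat_wit A B P Q \<and> upper_triangular B"
  using assms
proof (induction n arbitrary: A)
  case 0
  then show ?case by (intro exI[of _ A] exI[of _ "1\<^sub>m 0"]) (auto simp: similar_mat_wit_def Let_def intro!: eq_matI)
next
  case (Suc n)
  have A: "A \<in> carrier_mat (Suc n) (Suc n)" by fact
  have "degree (char_poly A) > 0" using degree_monic_char_poly[OF A] by simp
  then obtain e where "poly (char_poly A) e = 0" using alg_closed_imp_poly_has_root by blast
  then have "eigenvalue A e" by (simp add: eigenvalue_root_char_poly[OF A])
  then obtain v where v: "v \<in> carrier_vec (Suc n)" "v \<noteq> 0\<^sub>v (Suc n)" "A *\<^sub>v v = e \<cdot>\<^sub>v v"
    using A by (auto simp: eigenvalue_def eigenvector_def)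
  obtain k where k: "k < Suc n" "v $ k \<noteq> 0"
    using v by (metis carrier_vecD eq_vecI index_zero_vec(1) index_zero_vec(2))
  \<comment> \<open>In \<open>P\<close> the eigenvector comes first, followed by the unit vectors
    with index \<open>s j\<close> for \<open>j > 0\<close>. Swapping 0 and \<open>k\<close> omits
    exactly unit vector \<open>k\<close>, which \<open>v\<close> replaces since its entry
    \<open>k\<close> is nonzero.\<close>
  define s where "s = Transposition.transpose 0 k"
  have ss: "s (s i) = i" for i by (simp add: s_def)
  have s_lt: "s i < Suc n" if "i < Suc n" for i using that k by (auto simp: s_def Transposition.transpose_def)
  have s0: "s i = k \<longleftrightarrow> i = 0" for i by (auto simp: s_def Transposition.transpose_def)
  define P where "P = mat (Suc n) (Suc n) (\<lambda>(i, j). if j = 0 then v $ i else if i = s j then 1 else 0)"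
  have P: "P \<in> carrier_mat (Suc n) (Suc n)" by (simp add: P_def)
  have "det P \<noteq> 0"
  proof
    assume "det P = 0"
    then obtain w where w: "w \<in> carrier_vec (Suc n)" "w \<noteq> 0\<^sub>v (Suc n)" "P *\<^sub>v w = 0\<^sub>v (Suc n)"
      using det_0_iff_vec_prod_zero_field[OF P] by blast
    have Pw: "v $ i * w $ 0 + (if i = k then 0 else w $ s i) = 0" if i: "i < Suc n" for i
    proof -
      have "0 = (P *\<^sub>v w) $ i" using w i by simp
      also have "\<dots> = (\<Sum>j<Suc n. (if j = 0 then v $ i * w $ 0 else 0) + (if j = s i then if i = k then 0 else w $ s i else 0))"
        unfolding mult_mat_vec_index[OF P w(1) i]
      proof (rule sum.cong)
        fix j assume "j \<in> {..<Suc n}"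
        moreover have "i = s j \<longleftrightarrow> j = s i" using ss by metis
        moreover have "s i = 0 \<longleftrightarrow> i = k" using s0[of "s i"] ss[of i] by simp
        ultimately show "P $$ (i, j) * w $ j = (if j = 0 then v $ i * w $ 0 else 0) + (if j = s i then if i = k then 0 else w $ s i else 0)"
          using i by (auto simp: P_def)
      qed simp
      also have "\<dots> = v $ i * w $ 0 + (if i = k then 0 else w $ s i)"
        using s_lt[OF i] by (simp add: sum.distrib del: sum.lessThan_Suc)
      finally show ?thesis ..
    qed
    have w0: "w $ 0 = 0" using Pw[OF k(1)] k(2) by simp
    have "w $ j = 0" if "j < Suc n" for j
    proof (cases "j = 0")
      case False
      then have "s j \<noteq> k" using s0 by simp
      then show ?thesis using Pw[OF s_lt[OF that]] w0 ss by simp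
    qed (simp add: w0)
    then have "w = 0\<^sub>v (Suc n)" using w(1) by (intro eq_vecI) auto
    then show False using w(2) by simp
  qed
  then have "P \<in> GL (Suc n)" using P by (simp add: GL_iff_det)
  then obtain Q where Q: "Q \<in> GL (Suc n)" "P * Q = 1\<^sub>m (Suc n)" "Q * P = 1\<^sub>m (Suc n)" by (rule GL_inverse)
  then have Qc: "Q \<in> carrier_mat (Suc n) (Suc n)" by (simp add: GL_iff_det)
  define A' where "A' = Q * A * P"
  have A': "A' \<in> carrier_mat (Suc n) (Suc n)" unfolding A'_def using Qc A P by (auto intro!: mult_carrier_mat)
  have "P * A' * Q = A"
  proof -
    have "P * A' = P * (Q * (A * P))" unfolding A'_def using assoc_mult_mat[OF Qc A P] by simp
    also have "\<dots> = (P * Q) * (A * P)" using P Qc A by (intro assoc_mult_mat[symmetric]) auto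
    also have "\<dots> = A * P" unfolding Q(2) using A P by (intro left_mult_one_mat) auto
    finally have "P * A' * Q = A * (P * Q)" using A P Qc by (simp add: assoc_mult_mat)
    then show ?thesis unfolding Q(2) using A by simp
  qed
  then have sim1: "similar_mat_wit A A' P Q"
    using A A' P Qc Q by (auto simp: similar_mat_wit_def Let_def)
  have Pu: "P *\<^sub>v unit_vec (Suc n) 0 = v"
  proof (rule eq_vecI)
    fix i assume "i < dim_vec v"
    then have i: "i < Suc n" using v by simp
    have "(P *\<^sub>v unit_vec (Suc n) 0) $ i = (\<Sum>j<Suc n. if j = 0 then v $ i else 0)"
      unfolding mult_mat_vec_index[OF P unit_vec_carrier i] using i by (intro sum.cong) (auto simp: P_def)
    then show "(P *\<^sub>v unit_vec (Suc n) 0) $ i = v $ i" by (simp del: sum.lessThan_Suc)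
  qed (use P v in auto)
  have col0: "A' *\<^sub>v unit_vec (Suc n) 0 = e \<cdot>\<^sub>v unit_vec (Suc n) 0"
  proof -
    have "A' *\<^sub>v unit_vec (Suc n) 0 = (Q * A) *\<^sub>v v"
      unfolding A'_def Pu[symmetric] using Qc A P by (intro assoc_mult_mat_vec) auto
    also have "\<dots> = Q *\<^sub>v (e \<cdot>\<^sub>v v)" unfolding v(3)[symmetric] using Qc A v by (intro assoc_mult_mat_vec) auto
    also have "\<dots> = e \<cdot>\<^sub>v (Q *\<^sub>v v)" using Qc v by (intro mult_mat_vec) auto
    also have "Q *\<^sub>v v = (Q * P) *\<^sub>v unit_vec (Suc n) 0"
      unfolding Pu[symmetric] using Qc P by (intro assoc_mult_mat_vec[symmetric]) auto
    finally show ?thesis unfolding Q(3) by simp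
  qed
  have entry: "A' $$ (i, 0) = (if i = 0 then e else 0)" if i: "i < Suc n" for i
  proof -
    have "(A' *\<^sub>v unit_vec (Suc n) 0) $ i = (\<Sum>j<Suc n. if j = 0 then A' $$ (i, 0) else 0)"
      unfolding mult_mat_vec_index[OF A' unit_vec_carrier i] by (intro sum.cong) auto
    then have "A' $$ (i, 0) = (e \<cdot>\<^sub>v unit_vec (Suc n) 0) $ i" unfolding col0 by (simp del: sum.lessThan_Suc)
    then show ?thesis using i by simp
  qed
  define A1 where "A1 = mat 1 1 (\<lambda>_. e)"
  define A2 where "A2 = mat 1 n (\<lambda>(i, j). A' $$ (0, Suc j))"
  define D where "D = mat n n (\<lambda>(i, j). A' $$ (Suc i, Suc j))"
  have blk: "A' = four_block_mat A1 A2 (0\<^sub>m n 1) D"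
    using A' entry by (intro eq_matI) (auto simp: A1_def A2_def D_def)
  have D: "D \<in> carrier_mat n n" by (simp add: D_def)
  obtain B P2 Q2 where IH: "similar_mat_wit D B P2 Q2" "upper_triangular B" using Suc.IH[OF D] by blast
  from similar_mat_witD2[OF D IH(1)] have c: "B \<in> carrier_mat n n" "P2 \<in> carrier_mat n n" "Q2 \<in> carrier_mat n n" "P2 * Q2 = 1\<^sub>m n" by auto
  have A1: "A1 \<in> carrier_mat 1 1" and A2: "A2 \<in> carrier_mat 1 n" by (auto simp: A1_def A2_def)
  have "A2 * P2 * Q2 = A2 * (P2 * Q2)" using A2 c by (intro assoc_mult_mat) auto
  then have A2': "A2 = 1\<^sub>m 1 * (A2 * P2) * Q2" using A2 c by simp
  have "similar_mat_wit A' (four_block_mat A1 (A2 * P2) (0\<^sub>m n 1) B)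
      (four_block_mat (1\<^sub>m 1) (0\<^sub>m 1 n) (0\<^sub>m n 1) P2) (four_block_mat (1\<^sub>m 1) (0\<^sub>m 1 n) (0\<^sub>m n 1) Q2)"
    unfolding blk
    by (rule similar_mat_wit_four_block[OF similar_mat_wit_refl[OF A1] IH(1) A2' _ A1 D]) (use A2 c in auto)
  from similar_mat_wit_trans[OF sim1 this]
  have "similar_mat_wit A (four_block_mat A1 (A2 * P2) (0\<^sub>m n 1) B)
      (P * four_block_mat (1\<^sub>m 1) (0\<^sub>m 1 n) (0\<^sub>m n 1) P2) (four_block_mat (1\<^sub>m 1) (0\<^sub>m 1 n) (0\<^sub>m n 1) Q2 * Q)" .
  moreover have "upper_triangular (four_block_mat A1 (A2 * P2) (0\<^sub>m n 1) B)"
    by (rule upper_triangular_four_block[OF A1 c(1) _ IH(2)]) (auto simp: A1_def)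
  ultimately show ?case by blast
qed

context polyrep begin

text \<open>The identity is proved for generic matrices with entries in a polynomial
  ring over the base field; in this form it specialises to every extension.\<close>

lemma tr_ext_comm:
  fixes \<phi> :: "'a \<Rightarrow> 'f :: field"
  assumes \<phi>: "comm_ring_hom \<phi>" and A: "A \<in> GL n" and B: "B \<in> GL n"
  shows "tr m (ext \<phi> (A * B)) = tr m (ext \<phi> (B * A))"
proof -
  define c where "c = (mp_const :: 'a \<Rightarrow> (bool \<times> nat \<times> nat, 'a) mpoly)"
  define G where "G b = mat n n (\<lambda>(i, j). Poly_Mapping.single (Poly_Mapping.single (b, i, j) 1) 1 :: (bool \<times> nat \<times> nat, 'a) mpoly)" for b
  \<comment> \<open>\<open>G True\<close> and \<open>G False\<close> are independent generic
    matrices. The determinant factors make \<open>d\<close> vanish also at singular pairs over the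
    base field, so \<open>d\<close> is the zero polynomial and vanishes over every
    extension.\<close>
  define d where "d = det (G True) * det (G False) * (tr m (ext c (G True * G False)) - tr m (ext c (G False * G True)))"
  have G: "G b \<in> carrier_mat n n" for b by (simp add: G_def)
  have ev: "mp_ev \<psi> x d = det (mat n n (\<lambda>(i, j). x (True, i, j))) * det (mat n n (\<lambda>(i, j). x (False, i, j))) *
      (tr m (ext \<psi> (mat n n (\<lambda>(i, j). x (True, i, j)) * mat n n (\<lambda>(i, j). x (False, i, j)))) -
       tr m (ext \<psi> (mat n n (\<lambda>(i, j). x (False, i, j)) * mat n n (\<lambda>(i, j). x (True, i, j)))))"
    if \<psi>: "comm_ring_hom \<psi>" for \<psi> :: "'a \<Rightarrow> 's :: comm_ring_1" and x
  proof -
    interpret \<psi>: comm_ring_hom \<psi> by fact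
    have h: "comm_ring_hom (mp_ev \<psi> x :: (bool \<times> nat \<times> nat, 'a) mpoly \<Rightarrow> 's)" by (rule mp_ev_comm_ring_hom[OF \<psi>])
    interpret h: comm_ring_hom "mp_ev \<psi> x :: (bool \<times> nat \<times> nat, 'a) mpoly \<Rightarrow> 's" by fact
    have sh: "semiring_hom (mp_ev \<psi> x :: (bool \<times> nat \<times> nat, 'a) mpoly \<Rightarrow> 's)" by unfold_locales
    have mG: "map_mat (mp_ev \<psi> x) (G b) = mat n n (\<lambda>(i, j). x (b, i, j))" for b
      by (rule eq_matI) (auto simp: G_def mp_ev_single)
    have dG: "mp_ev \<psi> x (det (G b)) = det (mat n n (\<lambda>(i, j). x (b, i, j)))" for b
      unfolding mG[symmetric] by (rule comm_ring_hom.hom_det[OF h, symmetric])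
    have tG: "mp_ev \<psi> x (tr m (ext c (G b * G b'))) = tr m (ext \<psi> (mat n n (\<lambda>(i, j). x (b, i, j)) * mat n n (\<lambda>(i, j). x (b', i, j))))" for b b'
    proof -
      have "mp_ev \<psi> x (tr m (ext c (G b * G b'))) = tr m (ext (\<lambda>a. mp_ev \<psi> x (c a)) (map_mat (mp_ev \<psi> x) (G b * G b')))"
        by (rule tr_ext_natural[OF h mult_carrier_mat[OF G G]])
      also have "map_mat (mp_ev \<psi> x) (G b * G b') = map_mat (mp_ev \<psi> x) (G b) * map_mat (mp_ev \<psi> x) (G b')"
        by (rule semiring_hom.mat_hom_mult[OF sh G G])
      also have "(\<lambda>a. mp_ev \<psi> x (c a)) = \<psi>" by (simp add: c_def mp_ev_const)
      finally show ?thesis by (simp only: mG)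
    qed
    show ?thesis unfolding d_def by (simp only: h.hom_mult h.hom_minus dG tG)
  qed
  have "mp_eval x d = 0" for x :: "bool \<times> nat \<times> nat \<Rightarrow> 'a"
  proof -
    let ?X = "mat n n (\<lambda>(i, j). x (True, i, j))" and ?Y = "mat n n (\<lambda>(i, j). x (False, i, j))"
    have "tr m (ext (\<lambda>c. c) (?X * ?Y)) = tr m (ext (\<lambda>c. c) (?Y * ?X))" if "det ?X \<noteq> 0" "det ?Y \<noteq> 0"
    proof -
      have XY: "?X \<in> GL n" "?Y \<in> GL n" using that by (auto simp: GL_iff_det)
      then show ?thesis
        by (simp add: ext_id GL_mult \<rho>_mult tr_comm[OF \<rho>_carrier \<rho>_carrier])
    qed
    then show ?thesis unfolding mp_eval_eq_mp_ev ev[OF id_comm_ring_hom] by auto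
  qed
  then have "d = 0" by (rule mp_eval_vanish)
  then have "mp_ev \<phi> x d = 0" for x by (simp add: mp_ev_def)
  from this[of "\<lambda>(b, i, j). if b then A $$ (i, j) else B $$ (i, j)"]
  have "det A * det B * (tr m (ext \<phi> (A * B)) - tr m (ext \<phi> (B * A))) = 0"
  proof -
    have "mat n n (\<lambda>(i, j). A $$ (i, j)) = A" "mat n n (\<lambda>(i, j). B $$ (i, j)) = B"
      using A B by (auto simp: GL_iff_det intro!: eq_matI)
    then show ?thesis using \<open>\<And>x. mp_ev \<phi> x d = 0\<close>[of "\<lambda>(b, i, j). if b then A $$ (i, j) else B $$ (i, j)"]
      unfolding ev[OF \<phi>] by simp
  qed
  then show ?thesis using A B by (simp add: GL_iff_det)
qed

text \<open>Conjugation by the diagonal matrix with entries s^(-i) multiplies entry (i, j) by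
  s^(j-i) and keeps the trace. The trace is a polynomial in s, constant for natural s > 0, so its
  value at s = 0, where only the diagonal survives, is the same.\<close>

lemma tr_ext_triangular:
  fixes \<phi> :: "'a \<Rightarrow> 'f :: field_char_0"
  assumes \<phi>: "comm_ring_hom \<phi>" and B: "B \<in> GL n" "upper_triangular B"
  shows "tr m (ext \<phi> B) = tr m (ext \<phi> (dg n (\<lambda>i. B $$ (i, i))))"
proof -
  interpret \<phi>: comm_ring_hom \<phi> by fact
  have Bc: "B \<in> carrier_mat n n" using B by (simp add: GL_iff_det)
  have \<psi>: "comm_ring_hom (\<lambda>c. [:\<phi> c:])"
    by unfold_locales (auto simp: \<phi>.hom_add \<phi>.hom_mult one_pCons)
  define \<gamma> where "\<gamma> = mat n n (\<lambda>(i, j). if i \<le> j then monom (B $$ (i, j)) (j - i) else 0)"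
  define p where "p = tr m (ext (\<lambda>c. [:\<phi> c:]) \<gamma>)"
  have ev: "poly p s = tr m (ext \<phi> (ev_mat s \<gamma>))" for s
    unfolding p_def by (subst tr_ext_natural[OF poly_comm_ring_hom]) (auto simp: \<gamma>_def ev_mat_def)
  have "p - [:tr m (ext \<phi> B):] = 0"
  proof (rule poly_eq_0_if_nat_roots[of 1])
    fix k :: nat assume "1 \<le> k"
    define s where "s = (of_nat k :: 'f)"
    have s: "s \<noteq> 0" using \<open>1 \<le> k\<close> by (simp add: s_def)
    define t where "t i = (1 / s) ^ i" for i
    define t' where "t' i = s ^ i" for i
    have tG: "dg n t \<in> GL n" "dg n t' \<in> GL n" using s by (auto intro!: dg_GL simp: t_def t'_def)
    have tB: "dg n t * B \<in> GL n" by (rule GL_mult[OF tG(1) B(1)])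
    have "ev_mat s \<gamma> = dg n t * B * dg n t'"
    proof (rule eq_matI)
      fix i j assume "i < dim_row (dg n t * B * dg n t')" "j < dim_col (dg n t * B * dg n t')"
      then have ij: "i < n" "j < n" by (auto simp: dg_def)
      have 1: "(dg n t * B) $$ (i, l) = t i * B $$ (i, l)" if "l < n" for l
      proof -
        have "(dg n t * B) $$ (i, l) = (\<Sum>k<n. if k = i then t i * B $$ (i, l) else 0)"
          unfolding mult_mat_index[OF dg_carrier Bc ij(1) that] using ij by (intro sum.cong) (auto simp: dg_def)
        then show ?thesis using ij by simp
      qed
      have dgl: "dg n t' $$ (l, j) = (if l = j then t' j else 0)" if "l < n" for l
        using that ij by (simp add: dg_def)
      have "(dg n t * B * dg n t') $$ (i, j) = (\<Sum>l<n. if l = j then t i * B $$ (i, j) * t' j else 0)"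
        unfolding mult_mat_index[OF mult_carrier_mat[OF dg_carrier Bc] dg_carrier ij] using ij
        by (intro sum.cong) (auto simp: 1 dgl)
      then have e: "(dg n t * B * dg n t') $$ (i, j) = t i * B $$ (i, j) * t' j" using ij by simp
      show "ev_mat s \<gamma> $$ (i, j) = (dg n t * B * dg n t') $$ (i, j)"
      proof (cases "i \<le> j")
        case True
        have "s ^ j = s ^ (j - i) * s ^ i" using True by (simp add: power_add[symmetric])
        then have "t i * t' j = s ^ (j - i)" using s by (simp add: t_def t'_def power_one_over field_simps)
        then have eq: "t i * B $$ (i, j) * t' j = B $$ (i, j) * s ^ (j - i)" by (metis mult.assoc mult.commute)
        show ?thesis unfolding e eq using True ij by (simp add: ev_mat_def \<gamma>_def poly_monom)
      next
        case False
        then have "B $$ (i, j) = 0" using B Bc ij by (auto simp: upper_triangular_def)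
        then show ?thesis unfolding e using False ij by (simp add: ev_mat_def \<gamma>_def)
      qed
    qed (auto simp: \<gamma>_def ev_mat_def dg_def)
    then have "poly p s = tr m (ext \<phi> (dg n t * B * dg n t'))" by (simp add: ev)
    also have "\<dots> = tr m (ext \<phi> (dg n t' * (dg n t * B)))" by (rule tr_ext_comm[OF \<phi> tB tG(2)])
    also have "dg n t' * (dg n t * B) = dg n t' * dg n t * B" using Bc by (intro assoc_mult_mat[of _ n n _ n _ n, symmetric]) auto
    also have "dg n t' * dg n t = 1\<^sub>m n"
      unfolding dg_mult using s by (intro dg_one) (simp add: t_def t'_def power_one_over)
    also have "1\<^sub>m n * B = B" using Bc by simp
    finally show "poly (p - [:tr m (ext \<phi> B):]) (of_nat k) = 0" by (simp add: s_def)
  qed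
  then have "tr m (ext \<phi> B) = poly p 0" by simp
  also have "\<dots> = tr m (ext \<phi> (ev_mat 0 \<gamma>))" by (rule ev)
  also have "ev_mat 0 \<gamma> = dg n (\<lambda>i. B $$ (i, i))"
    using B Bc by (intro eq_matI) (auto simp: ev_mat_def \<gamma>_def dg_def poly_monom power_0_left upper_triangular_def)
  finally show ?thesis .
qed

lemma tr_ext_similar:
  fixes \<phi> :: "'a \<Rightarrow> 'f :: field"
  assumes \<phi>: "comm_ring_hom \<phi>" and A: "A \<in> GL n" and sim: "similar_mat_wit A B U V"
  shows "tr m (ext \<phi> A) = tr m (ext \<phi> B)" "B \<in> GL n"
proof -
  have Ac: "A \<in> carrier_mat n n" using A by (simp add: GL_iff_det)
  from similar_mat_witD2[OF Ac sim]
  have c: "A = U * B * V" "B \<in> carrier_mat n n" "U \<in> carrier_mat n n" "V \<in> carrier_mat n n" "U * V = 1\<^sub>m n" "V * U = 1\<^sub>m n" by auto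
  have "det U * det V = 1" using det_mult[OF c(3,4)] c(5) by simp
  then have UG: "U \<in> GL n" "V \<in> GL n" using c by (auto simp: GL_iff_det)
  have "det A = det U * det B * det V" unfolding c(1) using c(2-4) by (simp add: det_mult[of _ n])
  then show BG: "B \<in> GL n" using A c(2) by (auto simp: GL_iff_det)
  have "tr m (ext \<phi> A) = tr m (ext \<phi> (V * (U * B)))"
    unfolding c(1) by (rule tr_ext_comm[OF \<phi> GL_mult[OF UG(1) BG] UG(2)])
  also have "V * (U * B) = V * U * B" using c(2-4) by (intro assoc_mult_mat[of _ n n _ n _ n, symmetric]) auto
  finally show "tr m (ext \<phi> A) = tr m (ext \<phi> B)" using c(2,6) by simp
qed

end

section \<open>Eigenvalues of a permutation matrix and fixed points of powers\<close>

lemma upper_triangular_mult: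
  fixes A B :: "'r :: comm_ring_1 mat"
  assumes c: "A \<in> carrier_mat n n" "B \<in> carrier_mat n n" and ut: "upper_triangular A" "upper_triangular B"
  shows "upper_triangular (A * B)" "i < n \<Longrightarrow> (A * B) $$ (i, i) = A $$ (i, i) * B $$ (i, i)"
proof -
  have z: "A $$ (i, l) * B $$ (l, j) = 0" if "i < n" "l < n" "j < i \<or> (j = i \<and> l \<noteq> i)" for i j l
  proof (cases "l < i")
    case True
    then show ?thesis using ut(1) c that by (auto simp: upper_triangular_def)
  next
    case False
    then have "j < l" using that by auto
    then show ?thesis using ut(2) c that by (auto simp: upper_triangular_def)
  qed
  show "upper_triangular (A * B)"
    unfolding upper_triangular_def
  proof (intro allI impI)
    fix i j assume ij: "i < dim_row (A * B)" "j < i"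
    then have i: "i < n" "j < n" using c by auto
    show "(A * B) $$ (i, j) = 0"
      unfolding mult_mat_index[OF c i] using z ij i by (intro sum.neutral) auto
  qed
  assume i: "i < n"
  have "(A * B) $$ (i, i) = (\<Sum>l<n. if l = i then A $$ (i, i) * B $$ (i, i) else 0)"
    unfolding mult_mat_index[OF c i i] using z[OF i] by (intro sum.cong) auto
  then show "(A * B) $$ (i, i) = A $$ (i, i) * B $$ (i, i)" using i by simp
qed

lemma upper_triangular_pow:
  fixes B :: "'r :: comm_ring_1 mat"
  assumes c: "B \<in> carrier_mat n n" and ut: "upper_triangular B"
  shows "upper_triangular (B ^\<^sub>m k) \<and> (\<forall>i<n. (B ^\<^sub>m k) $$ (i, i) = (B $$ (i, i)) ^ k)"
proof (induction k)
  case 0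
  then show ?case using c by (auto simp: upper_triangular_def)
next
  case (Suc k)
  have "B ^\<^sub>m k \<in> carrier_mat n n" using c by simp
  from upper_triangular_mult[OF this c _ ut] Suc show ?case by (simp add: mult.commute)
qed

lemma perm_matrix_pow:
  assumes "w permutes {..<n}"
  shows "perm_matrix n w ^\<^sub>m k = (perm_matrix n (w ^^ k) :: 'r :: comm_ring_1 mat)"
proof (induction k)
  case 0
  then show ?case by (auto simp: perm_matrix_def intro!: eq_matI)
next
  case (Suc k)
  then show ?case by (simp add: perm_matrix_mult[OF assms] o_def funpow_Suc_right del: funpow.simps)
qed

lemma tr_perm_matrix: "tr n (perm_matrix n u) = of_nat (card {i. i < n \<and> u i = i})"
proof -
  have "tr n (perm_matrix n u) = (\<Sum>i<n. if u i = i then 1 else 0)"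
    unfolding tr_def by (intro sum.cong) (auto simp: perm_matrix_def)
  also have "\<dots> = of_nat (card {i \<in> {..<n}. u i = i})" by (subst sum.inter_filter[symmetric]) auto
  finally show ?thesis by (simp add: lessThan_def)
qed

text \<open>Both sides are the trace of the k-th power, computed in the triangular form and in the
  permutation basis.\<close>

lemma power_sums_perm_matrix:
  fixes B :: "'f :: field mat"
  assumes w: "w permutes {..<n}" and sim: "similar_mat_wit (perm_matrix n w) B P Q" and ut: "upper_triangular B"
  shows "(\<Sum>i<n. (B $$ (i, i)) ^ k) = of_nat (card {i. i < n \<and> (w ^^ k) i = i})"
proof -
  let ?A = "perm_matrix n w :: 'f mat"
  from similar_mat_witD2[OF perm_matrix_carrier sim]
  have c: "B \<in> carrier_mat n n" "P \<in> carrier_mat n n" "Q \<in> carrier_mat n n" "P * Q = 1\<^sub>m n" "Q * P = 1\<^sub>m n" by auto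
  have Bk: "B ^\<^sub>m k \<in> carrier_mat n n" using c by simp
  have "of_nat (card {i. i < n \<and> (w ^^ k) i = i}) = tr n (?A ^\<^sub>m k)"
    by (simp add: perm_matrix_pow[OF w] tr_perm_matrix)
  also have "?A ^\<^sub>m k = P * B ^\<^sub>m k * Q" by (rule similar_mat_wit_pow_id[OF sim])
  also have "tr n \<dots> = tr n (B ^\<^sub>m k * (Q * P))" using c Bk by (intro tr_mult3) auto
  also have "\<dots> = tr n (B ^\<^sub>m k)" using c Bk by simp
  also have "\<dots> = (\<Sum>i<n. (B $$ (i, i)) ^ k)"
    using upper_triangular_pow[OF c(1) ut, of k] by (simp add: tr_def)
  finally show ?thesis ..
qed

text \<open>The size of the orbit is the first return time, and the exponent matters only modulo
  that time.\<close>

lemma funpow_fixed_iff_card_orbit: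
  assumes "permutation w"
  shows "(w ^^ k) x = x \<longleftrightarrow> card (orbit w x) dvd k"
proof -
  define c where "c = funpow_dist1 w x x"
  have x: "x \<in> orbit w x" by (rule permutation_self_in_orbit[OF assms])
  have "card (orbit w x) = card {0..<c}"
    unfolding orbit_conv_funpow_dist1[OF x] c_def by (rule card_image[OF inj_on_funpow_dist1[OF x]])
  then have c: "card (orbit w x) = c" by simp
  have cx: "(w ^^ c) x = x" unfolding c_def by (rule funpow_dist1_prop[OF x])
  have "(w ^^ k) x = (w ^^ (k mod c)) x" by (rule funpow_mod_eq[OF cx, symmetric])
  moreover have "(w ^^ (k mod c)) x = x \<longleftrightarrow> k mod c = 0"
  proof
    assume *: "(w ^^ (k mod c)) x = x"
    show "k mod c = 0"
    proof (rule ccontr)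
      assume "k mod c \<noteq> 0"
      moreover have "k mod c < c" by (simp add: c_def)
      ultimately show False using funpow_dist1_least[of "k mod c" w x x] * by (simp add: c_def)
    qed
  qed simp
  ultimately show ?thesis by (simp add: c dvd_eq_mod_eq_0)
qed

text \<open>The fixed points of the k-th power are the points on cycles whose length divides
  \<open>k\<close>. A bound \<open>N \<ge> n\<close> catches all cycles, as none is longer than
  \<open>n\<close>.\<close>

lemma card_fixed_points_funpow:
  assumes w: "w permutes {..<n}" and "n \<le> N"
  shows "card {j. j < n \<and> (w ^^ k) j = j} = (\<Sum>i<N. if Suc i dvd k then Suc i * num_cycles n w (Suc i) else 0)"
proof -
  have pw: "permutation w" using w by (auto simp: permutation_permutes)
  have sub: "orbit w j \<subseteq> {..<n}" if "j < n" for j using permutes_orbit_subset[OF w] that by simp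
  have self: "j \<in> orbit w j" for j by (rule permutation_self_in_orbit[OF pw])
  have eq: "orbit w j' = orbit w j" if "j' \<in> orbit w j" for j j'
    by (rule orbit_cyclic_eq3[OF cyclic_on_orbit'[OF pw] that])
  define C where "C i = {A. \<exists>x<n. A = orbit w x \<and> card A = Suc i}" for i
  have C_sub: "C i \<subseteq> Pow {..<n}" for i using sub by (auto simp: C_def)
  then have fin: "finite (C i)" "finite (\<Union>(C i))" for i
    by (meson finite_Pow_iff finite_lessThan finite_subset, meson Sup_le_iff PowD finite_lessThan finite_subset subsetD)
  have card: "card (\<Union>(C i)) = Suc i * num_cycles n w (Suc i)" for i
  proof -
    have "Suc i * card (C i) = card (\<Union>(C i))"
    proof (rule card_partition[OF fin])
      show "card c = Suc i" if "c \<in> C i" for c using that by (auto simp: C_def)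
      show "c1 \<inter> c2 = {}" if "c1 \<in> C i" "c2 \<in> C i" "c1 \<noteq> c2" for c1 c2
        using that eq by (auto simp: C_def) (metis, metis)
    qed
    then show ?thesis by (simp add: num_cycles_def C_def)
  qed
  have mem: "j \<in> \<Union>(C i) \<longleftrightarrow> j < n \<and> card (orbit w j) = Suc i" for i j
  proof
    assume "j \<in> \<Union>(C i)"
    then obtain x where x: "x < n" "card (orbit w x) = Suc i" "j \<in> orbit w x" by (auto simp: C_def)
    then show "j < n \<and> card (orbit w j) = Suc i" using sub[OF x(1)] eq[OF x(3)] by auto
  next
    assume "j < n \<and> card (orbit w j) = Suc i"
    then show "j \<in> \<Union>(C i)" using self[of j] by (auto simp: C_def)
  qed
  have "{j. j < n \<and> (w ^^ k) j = j} = (\<Union>i\<in>{i\<in>{..<N}. Suc i dvd k}. \<Union>(C i))"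
  proof (rule Set.set_eqI)
    fix j
    have "card (orbit w j) - 1 < N \<and> Suc (card (orbit w j) - 1) = card (orbit w j)" if "j < n"
    proof -
      have "finite (orbit w j)" using sub[OF that] by (rule finite_subset) simp
      then have "0 < card (orbit w j)" using self[of j] by (auto simp: card_gt_0_iff)
      moreover have "card (orbit w j) \<le> n" using card_mono[OF _ sub[OF that]] by simp
      ultimately show ?thesis using \<open>n \<le> N\<close> by simp
    qed
    then have "j < n \<and> card (orbit w j) dvd k \<longleftrightarrow> (\<exists>i. i < N \<and> Suc i dvd k \<and> j < n \<and> card (orbit w j) = Suc i)"
      by metis
    then show "j \<in> {j. j < n \<and> (w ^^ k) j = j} \<longleftrightarrow> j \<in> (\<Union>i\<in>{i\<in>{..<N}. Suc i dvd k}. \<Union>(C i))"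
      unfolding UN_iff mem by (auto simp: funpow_fixed_iff_card_orbit[OF pw])
  qed
  also have "card \<dots> = (\<Sum>i\<in>{i\<in>{..<N}. Suc i dvd k}. card (\<Union>(C i)))"
  proof (rule card_UN_disjoint)
    show "\<forall>i\<in>{i\<in>{..<N}. Suc i dvd k}. \<forall>j\<in>{i\<in>{..<N}. Suc i dvd k}. i \<noteq> j \<longrightarrow> \<Union>(C i) \<inter> \<Union>(C j) = {}"
      using mem by (metis (no_types, lifting) disjoint_iff nat.inject)
  qed (use fin in auto)
  also have "\<dots> = (\<Sum>i<N. if Suc i dvd k then Suc i * num_cycles n w (Suc i) else 0)"
    unfolding card by (rule sum.inter_filter) simp
  finally show ?thesis .
qed

section \<open>Logarithmic derivatives and the product over cycles\<close>

definition euler :: "'r fps \<Rightarrow> 'r :: comm_ring_1 fps" where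
  "euler F = Abs_fps (\<lambda>d. of_nat d * fps_nth F d)"

lemma euler_altdef: "euler F = fps_X * fps_deriv F"
  by (simp add: euler_def fps_mult_fps_X_deriv_shift)

lemma euler_mult: "euler (F * G) = euler F * G + F * euler G"
  by (simp add: euler_altdef algebra_simps)

lemma euler_prod:
  assumes "finite A" "\<And>k. k \<in> A \<Longrightarrow> euler (f k) = f k * g k"
  shows "euler (\<Prod>k\<in>A. f k) = (\<Prod>k\<in>A. f k) * (\<Sum>k\<in>A. g k)"
  using assms
proof (induction A rule: finite_induct)
  case empty
  then show ?case by (simp add: euler_altdef)
qed (simp add: euler_mult algebra_simps)

text \<open>Comparing coefficients gives d F_d as a combination of the F_i with i < d, a recursion
  that determines the series from its constant term in characteristic zero.\<close>

lemma euler_unique: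
  fixes F :: "'f :: field_char_0 fps"
  assumes F: "euler F = F * g" and F': "euler F' = F' * g" and 0: "fps_nth F 0 = fps_nth F' 0" "fps_nth g 0 = 0"
  shows "F = F'"
proof (rule fps_ext)
  fix d show "fps_nth F d = fps_nth F' d"
  proof (induction d rule: less_induct)
    case (less d)
    have rec: "of_nat d * fps_nth G d = (\<Sum>i<d. fps_nth G i * fps_nth g (d - i))" if "euler G = G * g" for G
    proof -
      have "of_nat d * fps_nth G d = fps_nth (G * g) d" by (simp flip: that add: euler_def)
      also have "\<dots> = (\<Sum>i<Suc d. fps_nth G i * fps_nth g (d - i))"
        by (simp only: fps_mult_nth lessThan_Suc_atMost atMost_atLeast0)
      finally show ?thesis using 0 by simp
    qed
    have "of_nat d * fps_nth F d = of_nat d * fps_nth F' d"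
      unfolding rec[OF F] rec[OF F'] using less by (intro sum.cong) auto
    then show ?case using 0 by (cases "d = 0") auto
  qed
qed

lemma euler_linear_factor:
  "euler (1 - fps_const a * fps_X) = (1 - fps_const a * fps_X) * (- Abs_fps (\<lambda>e. if e = 0 then 0 else a ^ e))"
proof (rule fps_ext)
  fix d show "fps_nth (euler (1 - fps_const a * fps_X)) d =
      fps_nth ((1 - fps_const a * fps_X) * (- Abs_fps (\<lambda>e. if e = 0 then 0 else a ^ e))) d"
    by (cases d) (auto simp: euler_def algebra_simps)
qed

lemma euler_cycle_factor:
  assumes "0 < c"
  shows "euler (1 - fps_X ^ c) =
    (1 - fps_X ^ c) * (- Abs_fps (\<lambda>e. if e \<noteq> 0 \<and> c dvd e then of_nat c else 0) :: 'r :: comm_ring_1 fps)"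
proof (rule fps_ext)
  fix d
  have "c dvd d \<longleftrightarrow> c dvd d - c" if "\<not> d < c" using that by (metis dvd_minus_self linorder_not_less)
  moreover have "\<not> c dvd d" if "d < c" "d \<noteq> 0" using that by (auto dest: dvd_imp_le)
  ultimately show "fps_nth (euler (1 - fps_X ^ c)) d =
      fps_nth ((1 - fps_X ^ c) * (- Abs_fps (\<lambda>e. if e \<noteq> 0 \<and> c dvd e then of_nat c else 0) :: 'r fps)) d"
    using assms by (auto simp: euler_def left_diff_distrib fps_X_power_mult_nth fps_X_power_nth)
qed

text \<open>At a permutation the exponents are cycle counts, so the binomial series is the inverse
  of an honest power.\<close>

lemma H_factor_of_nat:
  fixes x :: "nat \<Rightarrow> 'a :: field_char_0"
  assumes "x k = of_nat a"
  shows "H_factor x k * (1 - fps_X ^ Suc k) ^ a = 1"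
proof -
  have "fps_compose (fps_binomial (x k)) (- (fps_X ^ Suc k)) = fps_compose (1 + fps_X) (- (fps_X ^ Suc k)) ^ a"
    unfolding assms fps_binomial_of_nat by (rule fps_compose_power[symmetric]) simp
  also have "fps_compose (1 + fps_X) (- (fps_X ^ Suc k)) = (1 - fps_X ^ Suc k :: 'a fps)"
    unfolding fps_compose_add_distrib by (subst fps_X_fps_compose_startby0) simp_all
  finally show ?thesis using H_factor_inverse[of x k] by simp
qed

text \<open>Both sides are determined by their logarithmic derivatives: the coefficients of the left-hand one are the
  power sums of the eigenvalues, that is, the numbers of fixed points of the powers of \<open>w\<close>.\<close>

lemma eigenvalue_product_eq_cycle_product:
  fixes B :: "'f :: field_char_0 mat"
  assumes w: "w permutes {..<n}" and "n \<le> N"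
    and sim: "similar_mat_wit (perm_matrix n w) B P Q" and ut: "upper_triangular B"
  shows "(\<Prod>i<n. 1 - fps_const (B $$ (i, i)) * fps_X) = (\<Prod>k<N. (1 - fps_X ^ Suc k) ^ num_cycles n w (Suc k))"
proof -
  define p where "p = (\<Sum>i<n. - Abs_fps (\<lambda>e. if e = 0 then 0 else B $$ (i, i) ^ e))"
  define q where "q = (\<Sum>k<N. of_nat (num_cycles n w (Suc k)) *
    - Abs_fps (\<lambda>e. if e \<noteq> 0 \<and> Suc k dvd e then of_nat (Suc k) else 0 :: 'f))"
  have pn: "fps_nth p e = (if e = 0 then 0 else - of_nat (card {j. j < n \<and> (w ^^ e) j = j}))" for e
    using power_sums_perm_matrix[OF w sim ut, of e] by (simp add: p_def fps_sum_nth sum_negf)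
  have "fps_nth q e = (if e = 0 then 0 else - of_nat (card {j. j < n \<and> (w ^^ e) j = j}))" for e
  proof -
    have "fps_nth q e = - (\<Sum>k<N. if e = 0 then 0 else of_nat (if Suc k dvd e then Suc k * num_cycles n w (Suc k) else 0))"
      unfolding q_def fps_sum_nth sum_negf[symmetric]
      by (intro sum.cong refl) (simp add: fps_of_nat[symmetric] algebra_simps)
    then show ?thesis unfolding card_fixed_points_funpow[OF w \<open>n \<le> N\<close>] of_nat_sum
      by (cases "e = 0") (simp_all only: if_True if_False simp_thms sum.neutral_const minus_zero)
  qed
  then have pq: "p = q" by (intro fps_ext) (simp add: pn)
  show ?thesis
  proof (rule euler_unique)
    show "euler (\<Prod>i<n. 1 - fps_const (B $$ (i, i)) * fps_X) = (\<Prod>i<n. 1 - fps_const (B $$ (i, i)) * fps_X) * p"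
      unfolding p_def by (rule euler_prod) (auto simp: euler_linear_factor)
    have "euler ((1 - fps_X ^ Suc k) ^ a) = (1 - fps_X ^ Suc k) ^ a * (of_nat a *
      - Abs_fps (\<lambda>e. if e \<noteq> 0 \<and> Suc k dvd e then of_nat (Suc k) else 0 :: 'f))" for k a
      using euler_prod[of "{..<a}" "\<lambda>_. 1 - fps_X ^ Suc k", OF _ euler_cycle_factor] by (simp del: power_Suc)
    then show "euler (\<Prod>k<N. (1 - fps_X ^ Suc k) ^ num_cycles n w (Suc k)) =
        (\<Prod>k<N. (1 - fps_X ^ Suc k) ^ num_cycles n w (Suc k)) * p"
      unfolding pq q_def by (intro euler_prod) auto
    have "fps_nth (\<Prod>k\<in>A. f k) 0 = (\<Prod>k\<in>A. fps_nth (f k) 0)" for A :: "nat set" and f :: "nat \<Rightarrow> 'f fps"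
      by (induction A rule: infinite_finite_induct) auto
    then show "fps_nth (\<Prod>i<n. 1 - fps_const (B $$ (i, i)) * fps_X) 0 =
        fps_nth (\<Prod>k<N. (1 - fps_X ^ Suc k) ^ num_cycles n w (Suc k)) 0"
      by (simp add: fps_power_zeroth)
    show "fps_nth p 0 = 0" by (simp add: pn)
  qed
qed

text \<open>Both generating series are inverse to the same polynomial: the cycle product on one
  side, the product over the eigenvalues on the other.\<close>

lemma H_poly_perm_eq_chs:
  fixes \<phi> :: "'a :: field_char_0 \<Rightarrow> 'f :: field_char_0"
  assumes \<phi>: "comm_ring_hom \<phi>" and w: "w permutes {..<n}"
    and sim: "similar_mat_wit (perm_matrix n w) B P Q" and ut: "upper_triangular B"
  shows "\<phi> (mp_eval (\<lambda>k. of_nat (num_cycles n w (Suc k))) (H_poly d)) = chs n (\<lambda>i. B $$ (i, i)) d"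
proof (cases "d < 0")
  case True
  interpret comm_ring_hom \<phi> by fact
  show ?thesis using True by (simp add: chs_def H_poly_def mp_eval_def)
next
  case False
  interpret \<phi>: comm_ring_hom \<phi> by fact
  interpret F: comm_ring_hom "fps_map \<phi>" by (rule fps_map_comm_ring_hom[OF \<phi>])
  \<comment> \<open>At least \<open>nat d\<close>, to reach coefficient \<open>d\<close> of the
    infinite product, and at least \<open>n\<close>, so that every cycle length occurs.\<close>
  define N where "N = max n (nat d)"
  define x where "x k = (of_nat (num_cycles n w (Suc k)) :: 'a)" for k
  define R where "R = (\<Prod>i<n. 1 - fps_const (B $$ (i, i)) * fps_X)"
  define Qc where "Qc = (\<Prod>k<N. (1 - fps_X ^ Suc k) ^ num_cycles n w (Suc k) :: 'a fps)"
  have "(\<Prod>k<N. H_factor x k) * Qc = 1"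
    unfolding Qc_def prod.distrib[symmetric] by (intro prod.neutral ballI H_factor_of_nat) (simp add: x_def)
  then have "fps_map \<phi> (\<Prod>k<N. H_factor x k) * fps_map \<phi> Qc = 1" by (simp only: F.hom_mult[symmetric] F.hom_one)
  moreover have "fps_map \<phi> Qc = R"
  proof -
    have "n \<le> N" by (simp add: N_def)
    then show ?thesis unfolding R_def eigenvalue_product_eq_cycle_product[OF w \<open>n \<le> N\<close> sim ut]
      by (simp only: Qc_def F.hom_prod F.hom_power F.hom_minus F.hom_one fps_map_X[OF \<phi>])
  qed
  moreover have "R * (\<Prod>i<n. geo (B $$ (i, i))) = 1"
    unfolding R_def prod.distrib[symmetric] by (simp add: geo_inverse)
  ultimately have 1: "fps_map \<phi> (\<Prod>k<N. H_factor x k) * R = 1" and 2: "R * (\<Prod>i<n. geo (B $$ (i, i))) = 1"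
    by simp_all
  have "fps_map \<phi> (\<Prod>k<N. H_factor x k) = fps_map \<phi> (\<Prod>k<N. H_factor x k) * (R * (\<Prod>i<n. geo (B $$ (i, i))))"
    unfolding 2 by simp
  also have "\<dots> = (\<Prod>i<n. geo (B $$ (i, i)))"
    unfolding mult.assoc[symmetric] 1 by simp
  finally have 3: "\<phi> (fps_nth (\<Prod>k<N. H_factor x k) (nat d)) = fps_nth (\<Prod>i<n. geo (B $$ (i, i))) (nat d)"
    by (simp only: fps_map_nth[of \<phi>, symmetric])
  have "nat d \<le> N" by (simp add: N_def)
  then have "mp_eval x (H_poly d) = fps_nth (\<Prod>k<N. H_factor x k) (nat d)"
    using mp_eval_H_poly[of d N x] False by simp
  then show ?thesis using False 3 unfolding x_def[abs_def, symmetric] by (simp add: chs_def)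
qed

text \<open>A zero part in row \<open>i\<close> has the entries
  \<open>chs q y (int j - int i)\<close>, which vanish left of the diagonal and are 1 on it; the
  matrix is block triangular with a unitriangular second block.\<close>

lemma det_chs_pad:
  fixes y :: "nat \<Rightarrow> 'f :: idom"
  assumes "length lam \<le> n"
  defines "L \<equiv> \<lambda>i. if i < length lam then lam ! i else 0"
  shows "det (mat n n (\<lambda>(i, j). chs q y (int (L i) + int j - int i))) =
    det (mat (length lam) (length lam) (\<lambda>(i, j). chs q y (int (lam ! i) + int j - int i)))"
proof -
  define l where "l = length lam"
  define r where "r = n - l"
  have n: "n = l + r" using assms(1) by (simp add: l_def r_def)
  define f where "f = (\<lambda>i j. chs q y (int (L i) + int j - int i))"
  define A1 where "A1 = mat l l (\<lambda>(i, j). chs q y (int (lam ! i) + int j - int i))"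
  define A2 where "A2 = mat l r (\<lambda>(i, j). f i (j + l))"
  define A4 where "A4 = mat r r (\<lambda>(i, j). chs q y (int j - int i))"
  have "mat n n (\<lambda>(i, j). f i j) = four_block_mat A1 A2 (0\<^sub>m r l) A4"
    by (rule eq_matI) (auto simp: n A1_def A2_def A4_def f_def L_def l_def[symmetric] chs_def)
  then have "det (mat n n (\<lambda>(i, j). f i j)) = det A1 * det A4"
    by (simp add: det_four_block_mat_lower_left_zero[of _ l _ r] A1_def A2_def A4_def)
  also have "det A4 = 1"
  proof -
    have "upper_triangular A4" by (auto simp: A4_def upper_triangular_def chs_def)
    moreover have "A4 \<in> carrier_mat r r" by (simp add: A4_def)
    moreover have "diag_mat A4 = replicate r 1"
      by (rule nth_equalityI) (auto simp: diag_mat_def A4_def)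
    ultimately show ?thesis using det_upper_triangular[of A4 r] by simp
  qed
  finally show ?thesis by (simp add: f_def A1_def l_def)
qed

text \<open>With fewer variables than rows, the coefficients of \<open>\<Prod>(1 - y\<^sub>i t)\<close> give a linear relation between the columns.\<close>

lemma det_chs_eq_0:
  fixes y :: "nat \<Rightarrow> 'f :: idom"
  assumes pos: "\<And>i. i < length lam \<Longrightarrow> 0 < lam ! i" and n: "n < length lam"
  shows "det (mat (length lam) (length lam) (\<lambda>(i, j). chs n y (int (lam ! i) + int j - int i))) = 0"
proof -
  define l where "l = length lam"
  define R where "R = (\<Prod>i<n. 1 - fps_const (y i) * fps_X)"
  define H where "H = (\<Prod>i<n. geo (y i))"
  have RH: "R * H = 1" unfolding R_def H_def prod.distrib[symmetric] by (simp add: geo_inverse)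
  have R_deg: "fps_nth R s = 0" if "n < s" for s
    using fps_prod_linear_nth[of "{..<n}" y s] that by (simp add: R_def)
  have "fps_nth R 0 * fps_nth H 0 = 1" using arg_cong[OF RH, of "\<lambda>f. fps_nth f 0"] by simp
  then have R0: "fps_nth R 0 \<noteq> 0" by auto
  let ?A = "mat l l (\<lambda>(i, j). chs n y (int (lam ! i) + int j - int i))"
  \<comment> \<open>The coefficients of \<open>R\<close> in reverse order; the last entry is the
    constant coefficient, so \<open>v\<close> is nonzero.\<close>
  define v where "v = vec l (\<lambda>j. fps_nth R (l - 1 - j))"
  have A: "?A \<in> carrier_mat l l" and v: "v \<in> carrier_vec l" by (auto simp: v_def)
  have "v $ (l - 1) = fps_nth R ((l - 1) - (l - 1))" unfolding v_def using n by (intro index_vec) (simp add: l_def)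
  then have "v $ (l - 1) \<noteq> 0" using R0 by (simp only: diff_self_eq_0 not_False_eq_True)
  then have "v \<noteq> 0\<^sub>v l" using n by (auto simp: l_def)
  moreover have "?A *\<^sub>v v = 0\<^sub>v l"
  proof (rule eq_vecI)
    fix i assume "i < dim_vec (0\<^sub>v l)"
    then have i: "i < l" by simp
    \<comment> \<open>Row \<open>i\<close> of the product is the coefficient of degree
      \<open>d\<close> in \<open>R * H = 1\<close>. It vanishes since \<open>d > 0\<close>, which in
      the last row relies on positive parts; and since \<open>n < l\<close>, all coefficients of
      \<open>R\<close> fit into \<open>v\<close>.\<close>
    define d where "d = lam ! i + (l - 1 - i)"
    have d: "0 < d" using pos[of i] i by (simp add: d_def l_def)
    have dl: "int d = int (lam ! i) + int l - 1 - int i" using i by (simp add: d_def of_nat_diff)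
    have "(?A *\<^sub>v v) $ i = (\<Sum>j<l. chs n y (int (lam ! i) + int j - int i) * fps_nth R (l - 1 - j))"
      unfolding mult_mat_vec_index[OF A v i] using i by (intro sum.cong) (auto simp: v_def)
    also have "\<dots> = (\<Sum>s<l. chs n y (int d - int s) * fps_nth R s)"
      by (rule sum.reindex_bij_witness[of _ "\<lambda>s. l - 1 - s" "\<lambda>j. l - 1 - j"])
         (auto simp: dl of_nat_diff algebra_simps)
    also have "\<dots> = (\<Sum>s\<le>d. fps_nth R s * fps_nth H (d - s))"
    proof -
      have "(\<Sum>s<l. chs n y (int d - int s) * fps_nth R s) = (\<Sum>s<l + d. if s \<le> d then fps_nth R s * fps_nth H (d - s) else 0)"
      proof (rule sum.mono_neutral_cong_left)
        show "\<forall>s\<in>{..<l + d} - {..<l}. (if s \<le> d then fps_nth R s * fps_nth H (d - s) else 0) = 0"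
          using R_deg n by (auto simp: l_def)
        show "chs n y (int d - int s) * fps_nth R s = (if s \<le> d then fps_nth R s * fps_nth H (d - s) else 0)"
          if "s \<in> {..<l}" for s
        proof (cases "s \<le> d")
          case True
          then have "nat (int d - int s) = d - s" by simp
          then show ?thesis using True by (simp add: chs_def H_def mult.commute)
        qed (simp add: chs_def)
      qed auto
      also have "\<dots> = (\<Sum>s\<le>d. fps_nth R s * fps_nth H (d - s))"
        using i by (intro sum.mono_neutral_cong_right) auto
      finally show ?thesis .
    qed
    also have "\<dots> = fps_nth (R * H) d" by (simp add: fps_mult_nth atMost_atLeast0)
    finally show "(?A *\<^sub>v v) $ i = 0\<^sub>v l $ i" using d i by (simp add: RH)
  qed simp
  ultimately show ?thesis unfolding l_def[symmetric] using det_0_iff_vec_prod_zero[OF A] v by blast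
qed

context hwrep begin

lemma trace_perm_matrix:
  fixes \<phi> :: "'a \<Rightarrow> 'f :: field_char_0"
  assumes \<phi>: "comm_ring_hom \<phi>" and w: "w permutes {..<n}"
    and sim: "similar_mat_wit (perm_matrix n w) B U V" and ut: "upper_triangular B"
  shows "\<phi> (tr m (\<rho> (perm_matrix n w))) =
    det (mat n n (\<lambda>(i, j). chs n (\<lambda>i. B $$ (i, i)) (int (L i) + int j - int i)))"
proof -
  interpret \<phi>: comm_ring_hom \<phi> by fact
  have pG: "perm_matrix n w \<in> GL n" and pG': "perm_matrix n w \<in> GL n" by (rule perm_matrix_GL[OF w])+
  have map: "map_mat \<phi> (perm_matrix n w) = perm_matrix n w"
    by (rule eq_matI) (auto simp: perm_matrix_def)
  have "\<phi> (tr m (ext (\<lambda>c. c) (perm_matrix n w))) = tr m (ext \<phi> (map_mat \<phi> (perm_matrix n w)))"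
    by (rule tr_ext_natural[OF \<phi> perm_matrix_carrier])
  then show ?thesis
    unfolding map ext_id[OF pG] tr_ext_similar(1)[OF \<phi> pG' sim]
      tr_ext_triangular[OF \<phi> tr_ext_similar(2)[OF \<phi> pG' sim] ut] trace_diagonal[OF \<phi>] .
qed

end

theorem theorem2p7:
  fixes lam :: "nat list"
  assumes "is_partition lam"
  shows "(det_H lam :: 'a :: field_char_0 cycle_poly) = det_E lam \<and>
    (\<forall>n w m (\<rho> :: 'a mat \<Rightarrow> 'a mat).
       n > 0 \<and> w permutes {..<n} \<and> is_Weyl_module lam n m \<rho> \<longrightarrow>
       eval_perm (S_poly lam :: 'a cycle_poly) n w = mat_trace (\<rho> (perm_matrix n w)))"
proof (intro conjI allI impI)
  show "(det_H lam :: 'a cycle_poly) = det_E lam" by (rule det_H_eq_det_E[OF assms])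
  fix n w m and \<rho> :: "'a mat \<Rightarrow> 'a mat"
  assume asm: "n > 0 \<and> w permutes {..<n} \<and> is_Weyl_module lam n m \<rho>"
  then have w: "w permutes {..<n}" and pr: "polynomial_representation n m \<rho>"
    by (auto simp: is_Weyl_module_def)
  \<comment> \<open>The eigenvalues of the permutation matrix lie in the algebraic closure. Both
    sides are compared there, and the result descends because the embedding is injective.\<close>
  let ?\<phi> = "to_ac :: 'a \<Rightarrow> 'a alg_closure"
  have \<phi>: "comm_ring_hom ?\<phi>" by unfold_locales auto
  let ?x = "\<lambda>k. of_nat (num_cycles n w (Suc k)) :: 'a"
  have ev: "comm_ring_hom (mp_eval ?x)" by (rule mp_eval_comm_ring_hom)
  obtain B U V where sim: "similar_mat_wit (perm_matrix n w :: 'a alg_closure mat) B U V" and ut: "upper_triangular B"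
    using triangularisation[OF perm_matrix_carrier] by blast
  define y where "y i = B $$ (i, i)" for i
  define l where "l = length lam"
  have S: "?\<phi> (eval_perm (S_poly lam) n w) = det (mat l l (\<lambda>(i, j). chs n y (int (lam ! i) + int j - int i)))"
    unfolding eval_perm_def S_poly_def det_H_def hom_det_mat[OF ev] hom_det_mat[OF \<phi>]
      H_poly_perm_eq_chs[OF \<phi> w sim ut] l_def y_def ..
  have rep: "representation n m \<rho>" using pr by (simp add: polynomial_representation_def)
  have pG: "(perm_matrix n w :: 'a mat) \<in> GL n" by (rule perm_matrix_GL[OF w])
  then have "\<rho> (perm_matrix n w) \<in> carrier_mat m m" using rep by (simp add: representation_def)
  then have tr: "mat_trace (\<rho> (perm_matrix n w)) = tr m (\<rho> (perm_matrix n w))"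
    by (auto simp: mat_trace_def tr_def)
  show "eval_perm (S_poly lam :: 'a cycle_poly) n w = mat_trace (\<rho> (perm_matrix n w))"
  proof (cases "length lam \<le> n")
    case False
    \<comment> \<open>With more than \<open>n\<close> parts the module is zero and so is the trace;
      the determinant vanishes because there are fewer eigenvalues than rows.\<close>
    then have "m = 0" using asm by (simp add: is_Weyl_module_def)
    moreover have "0 < lam ! i" if "i < length lam" for i
      using assms that by (metis is_partition_def neq0_conv nth_mem)
    then have "?\<phi> (eval_perm (S_poly lam) n w) = 0"
      unfolding S l_def using False by (intro det_chs_eq_0) auto
    ultimately show ?thesis by (simp add: tr tr_def)
  next
    case True
    define L where "L i = (if i < length lam then lam ! i else 0)" for i
    have irr: "irreducible_representation n m \<rho>" and hwt: "has_highest_weight n m \<rho> lam"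
      using asm True by (auto simp: is_Weyl_module_def)
    \<comment> \<open>One polynomial is chosen for each matrix entry, as the locale takes them as a
      function of the indices.\<close>
    define p where "p a b = (SOME q. \<forall>g\<in>GL n. \<rho> g $$ (a, b) = mp_eval (mat_vars n g) q)" for a b
    have p: "\<rho> g $$ (a, b) = mp_eval (mat_vars n g) (p a b)" if "a < m" "b < m" "g \<in> GL n" for a b g
    proof -
      have "\<forall>a<m. \<forall>b<m. \<exists>q. \<forall>g\<in>GL n. \<rho> g $$ (a, b) = mp_eval (mat_vars n g) q"
        using pr unfolding polynomial_representation_def mat_vars_def by (rule conjunct2)
      then have "\<exists>q. \<forall>g\<in>GL n. \<rho> g $$ (a, b) = mp_eval (mat_vars n g) q"
        using that(1,2) by simp
      then have "\<forall>g\<in>GL n. \<rho> g $$ (a, b) = mp_eval (mat_vars n g) (p a b)"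
        unfolding p_def by (rule someI_ex)
      then show ?thesis using that(3) by (rule bspec)
    qed
    obtain v where v: "v \<in> carrier_vec m" "v \<noteq> 0\<^sub>v m"
      and hw: "\<And>b. b \<in> GL n \<Longrightarrow> upper_triangular b \<Longrightarrow>
        \<rho> b *\<^sub>v v = (\<Prod>i<length lam. b $$ (i, i) ^ (lam ! i)) \<cdot>\<^sub>v v"
      using hwt by (auto simp: has_highest_weight_def)
    have prod: "(\<Prod>i<length lam. b $$ (i, i) ^ (lam ! i)) = (\<Prod>i<n. b $$ (i, i) ^ L i)" for b :: "'a mat"
      using True by (intro prod.mono_neutral_cong_left) (auto simp: L_def)
    have hw': "\<rho> b *\<^sub>v v = (\<Prod>i<n. b $$ (i, i) ^ L i) \<cdot>\<^sub>v v" if "b \<in> GL n" "upper_triangular b" for b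
      unfolding hw[OF that] prod ..
    have L0: "L i = 0" if "n \<le> i" for i using that True by (simp add: L_def)
    have L_dec: "L j \<le> L i" if "i \<le> j" for i j
      using assms that by (cases "i = j") (auto simp: L_def is_partition_def sorted_wrt_iff_nth_less)
    have "polyrep n m \<rho> p" by (rule polyrep.intro[OF rep p])
    then have rep': "hwrep n m \<rho> p v L"
      by (rule hwrep.intro[OF _ hwrep_axioms.intro[OF v hw' irr L0 L_dec]])
    have 4: "?\<phi> (tr m (\<rho> (perm_matrix n w))) = det (mat n n (\<lambda>(i, j). chs n y (int (L i) + int j - int i)))"
      unfolding y_def by (rule hwrep.trace_perm_matrix[OF rep' \<phi> w sim ut])
    have 5: "det (mat n n (\<lambda>(i, j). chs n y (int (L i) + int j - int i))) = ?\<phi> (eval_perm (S_poly lam) n w)"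
      unfolding S l_def L_def by (rule det_chs_pad[OF True])
    have "?\<phi> (eval_perm (S_poly lam) n w) = ?\<phi> (tr m (\<rho> (perm_matrix n w)))"
      unfolding 4 5 ..
    then have "eval_perm (S_poly lam) n w = tr m (\<rho> (perm_matrix n w))" by (rule injD[OF inj_to_ac])
    then show ?thesis unfolding tr .
  qed
qed

end
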